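(* Let $n\ge3$, let $\Sigma\subset S^{n-1}$ be a domain with Lipschitz boundary and let $\mathcal{C}_1=\{x\in\mathbb{R}^n\setminus\{0\}:\ x/|x|\in\Sigma,\ |x|<1\}$. There exists a positive constant $C$ depending only on $\Sigma$ such that $$\int_{\mathcal{C}_1}|\nabla u|^2dx\ \ge\ \Big(\frac{(n-2)^2}{4}+\mu_1(\Sigma)\Big)\int_{\mathcal{C}_1}\frac{u^2}{|x|^2}dx+C\Big(\int_{\mathcal{C}_1}X_1^{\frac{2n-2}{n-2}}|u|^{\frac{2n}{n-2}}dx\Big)^{\frac{n-2}{n}}\qquad( * )$$ for all $u\in C_c^\infty(\mathcal{C}_1)$, where $X_1=X_1(|x|)$. The exponent $\frac{2n-2}{n-2}$ of $X_1$ is the best possible, i.e. it cannot be replaced by any smaller number, whatever the constant $C>0$. Moreover the best constant $C$ in $( * )$ satisfies $$C\le C_n|\Sigma|^{2/n}$$ for some positive constant $C_n$ depending only on $n$. In particular the best constant $C$ in $( * )$ cannot be taken to be independent of $\Sigma$.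
   Context: $S^{n-1}$ is the unit sphere of $\mathbb{R}^n$; a domain in $S^{n-1}$ is a subset which is open and connected in the relative topology; $|\Sigma|$ is its surface measure. $\mu_1(\Sigma)$ is the first Dirichlet eigenvalue of (minus) the Laplace–Beltrami operator on $\Sigma$. $X_1(t)=\frac1{1-\ln t}$ for $t\in(0,1)$. *)

theory Defs
  imports "HOL-Analysis.Analysis"
begin

section \<open>Gradients and smooth functions\<close>

definition grad :: "('a::euclidean_space \<Rightarrow> real) \<Rightarrow> 'a \<Rightarrow> 'a" where
  "grad f x = (THE D. GDERIV f x :> D)"

(* Intended for open S only: derivatives are taken at x, not within S. *)
primrec Ck_on :: "nat \<Rightarrow> 'a::euclidean_space set \<Rightarrow> ('a \<Rightarrow> real) \<Rightarrow> bool" where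
  "Ck_on 0 S f \<longleftrightarrow> continuous_on S f"
| "Ck_on (Suc k) S f \<longleftrightarrow>
     (\<forall>x\<in>S. f differentiable (at x)) \<and> (\<forall>b\<in>Basis. Ck_on k S (\<lambda>x. grad f x \<bullet> b))"

definition smooth_on :: "'a::euclidean_space set \<Rightarrow> ('a \<Rightarrow> real) \<Rightarrow> bool" where
  "smooth_on S f \<longleftrightarrow> (\<forall>k. Ck_on k S f)"

(* Functions in C_c^infinity(Omega) are total, i.e. extended by zero outside Omega. *)
definition test_functions :: "'a::euclidean_space set \<Rightarrow> ('a \<Rightarrow> real) set" where
  "test_functions \<Omega> =
     {u. smooth_on UNIV u \<and> compact (closure {x. u x \<noteq> 0}) \<and> closure {x. u x \<noteq> 0} \<subseteq> \<Omega>}"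

section \<open>The unit sphere\<close>

(* Normalised as in the polar coordinate formula: the surface measure of A is n times the
   volume of the part of the unit ball lying over A. Recall sgn x = x / |x|; the origin is a
   Lebesgue null set, so the value sgn 0 = 0 is irrelevant. *)
definition surface_measure :: "(real^'n) measure" where
  "surface_measure =
     scale_measure (of_nat CARD('n)) (distr (restrict_space lborel (ball 0 1)) borel sgn)"

lemma emeasure_surface_measure:
  fixes A :: "(real^'n) set"
  assumes "A \<in> sets borel"
  shows "emeasure surface_measure A =
           of_nat CARD('n) * emeasure lborel {x \<in> ball 0 1. sgn x \<in> A}"
proof -
  have m: "sgn \<in> restrict_space lborel (ball (0::real^'n) 1) \<rightarrow>\<^sub>M borel"
    by (intro measurable_restrict_space1) simp
  have "sgn -` A \<inter> space (restrict_space lborel (ball 0 1)) = {x \<in> ball (0::real^'n) 1. sgn x \<in> A}"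
    by (auto simp: space_restrict_space)
  then show ?thesis
    using assms m
    by (simp add: surface_measure_def emeasure_distr emeasure_restrict_space subset_eq)
qed

(* A function on the sphere is represented by any total function with these values on the
   sphere; smoothness and gradient are those of its extension to R^n - {0} that is
   homogeneous of degree 0. At points of the sphere the gradient of that extension is
   tangential and coincides with the Riemannian gradient. *)
definition sphere_grad :: "(real^'n \<Rightarrow> real) \<Rightarrow> real^'n \<Rightarrow> real^'n" where
  "sphere_grad \<psi> \<theta> = grad (\<lambda>x. \<psi> (sgn x)) \<theta>"

(* The support is closed in the sphere, hence automatically compact. *)
definition sphere_test_functions :: "(real^'n) set \<Rightarrow> (real^'n \<Rightarrow> real) set" where
  "sphere_test_functions \<Sigma> =
     {\<psi>. smooth_on (- {0}) (\<lambda>x. \<psi> (sgn x)) \<and> closure {\<theta> \<in> sphere 0 1. \<psi> \<theta> \<noteq> 0} \<subseteq> \<Sigma>}"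

definition sphere_domain :: "(real^'n) set \<Rightarrow> bool" where
  "sphere_domain \<Sigma> \<longleftrightarrow>
     openin (top_of_set (sphere 0 1)) \<Sigma> \<and> connected \<Sigma> \<and> \<Sigma> \<noteq> {}"

(* Near each boundary point p, in the smooth chart y |-> sgn (p + y) from the tangent
   hyperplane at p onto the open hemisphere around p, the set is the strict subgraph, in some
   tangent direction e, of a Lipschitz function g of the remaining n - 2 variables. *)
definition lipschitz_boundary :: "(real^'n) set \<Rightarrow> bool" where
  "lipschitz_boundary \<Sigma> \<longleftrightarrow>
     (\<forall>p \<in> top_of_set (sphere 0 1) frontier_of \<Sigma>.
        \<exists>e g L r. norm e = 1 \<and> e \<bullet> p = 0 \<and> r > 0 \<and>
          L-lipschitz_on {z. z \<bullet> p = 0 \<and> z \<bullet> e = 0} (g :: real^'n \<Rightarrow> real) \<and>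
          (\<forall>y. y \<bullet> p = 0 \<and> norm y < r \<longrightarrow>
             (sgn (p + y) \<in> \<Sigma> \<longleftrightarrow> y \<bullet> e < g (y - (y \<bullet> e) *\<^sub>R e))))"

section \<open>Dirichlet eigenvalues of the Laplace--Beltrami operator\<close>

(* \<phi> belongs to the closure of C_c^infinity in H^1, and G is its weak tangential gradient. *)
definition sphere_H10 :: "(real^'n) set \<Rightarrow> (real^'n \<Rightarrow> real) \<Rightarrow> (real^'n \<Rightarrow> real^'n) \<Rightarrow> bool" where
  "sphere_H10 \<Sigma> \<phi> G \<longleftrightarrow>
     \<phi> \<in> borel_measurable borel \<and> G \<in> borel_measurable borel \<and>
     set_integrable surface_measure \<Sigma> (\<lambda>\<theta>. (\<phi> \<theta>)\<^sup>2) \<and>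
     set_integrable surface_measure \<Sigma> (\<lambda>\<theta>. (norm (G \<theta>))\<^sup>2) \<and>
     (\<exists>\<psi>. (\<forall>k::nat. \<psi> k \<in> sphere_test_functions \<Sigma>) \<and>
        (\<lambda>k. LINT \<theta>:\<Sigma>|surface_measure. (\<psi> k \<theta> - \<phi> \<theta>)\<^sup>2) \<longlonglongrightarrow> 0 \<and>
        (\<lambda>k. LINT \<theta>:\<Sigma>|surface_measure. (norm (sphere_grad (\<psi> k) \<theta> - G \<theta>))\<^sup>2) \<longlonglongrightarrow> 0)"

(* There is a nonzero \<phi> in H^1_0 with - Laplacian \<phi> = c \<phi> in the weak sense. *)
definition dirichlet_eigenvalue :: "(real^'n) set \<Rightarrow> real \<Rightarrow> bool" where
  "dirichlet_eigenvalue \<Sigma> c \<longleftrightarrow>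
     (\<exists>\<phi> G. sphere_H10 \<Sigma> \<phi> G \<and>
        \<not> (AE \<theta> in surface_measure. \<theta> \<in> \<Sigma> \<longrightarrow> \<phi> \<theta> = 0) \<and>
        (\<forall>\<psi> \<in> sphere_test_functions \<Sigma>.
           (LINT \<theta>:\<Sigma>|surface_measure. G \<theta> \<bullet> sphere_grad \<psi> \<theta>) =
           c * (LINT \<theta>:\<Sigma>|surface_measure. \<phi> \<theta> * \<psi> \<theta>)))"

definition \<mu>\<^sub>1 :: "(real^'n) set \<Rightarrow> real" where
  "\<mu>\<^sub>1 \<Sigma> = (LEAST c. dirichlet_eigenvalue \<Sigma> c)"

section \<open>The Hardy--Sobolev inequality in truncated cones\<close>

definition trunc_cone :: "(real^'n) set \<Rightarrow> (real^'n) set" where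
  "trunc_cone \<Sigma> = {x. x \<noteq> 0 \<and> x /\<^sub>R norm x \<in> \<Sigma> \<and> norm x < 1}"

definition X\<^sub>1 :: "real \<Rightarrow> real" where
  "X\<^sub>1 t = 1 / (1 - ln t)"

(* q is the exponent of the logarithmic weight. *)
definition hardy_sobolev :: "(real^'n) set \<Rightarrow> real \<Rightarrow> real \<Rightarrow> bool" where
  "hardy_sobolev \<Sigma> q C \<longleftrightarrow>
     (\<forall>u \<in> test_functions (trunc_cone \<Sigma>).
        (LINT x:trunc_cone \<Sigma>|lborel. (norm (grad u x))\<^sup>2) \<ge>
          ((real CARD('n) - 2)\<^sup>2 / 4 + \<mu>\<^sub>1 \<Sigma>) *
            (LINT x:trunc_cone \<Sigma>|lborel. (u x)\<^sup>2 / (norm x)\<^sup>2) +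
          C * (LINT x:trunc_cone \<Sigma>|lborel.
                 X\<^sub>1 (norm x) powr q *
                 \<bar>u x\<bar> powr (2 * real CARD('n) / (real CARD('n) - 2)))
               powr ((real CARD('n) - 2) / real CARD('n)))"

definition weight_exponent :: "'n::finite itself \<Rightarrow> real" where
  "weight_exponent _ = (2 * real CARD('n) - 2) / (real CARD('n) - 2)"

(* Extended real, so that an upper bound for it is not vacuous. *)
definition best_constant :: "(real^'n) set \<Rightarrow> ereal" where
  "best_constant \<Sigma> =
     (SUP C \<in> {C. C > 0 \<and> hardy_sobolev \<Sigma> (weight_exponent TYPE('n)) C}. ereal C)"

end

theory Submission
  imports Defs "HOL-Complex_Analysis.Great_Picard"
begin

text \<open>In logarithmic polar coordinates $x = e^t \theta$ put
  $u(x) = |x|^{-(n-2)/2} v(t, \theta)$ (the transform of Emden and Fowler). The Hardy term with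
  its constant $(n-2)^2/4$ cancels, because the mixed term $v v_t$ integrates to zero on every
  ray, and with $p = 2n/(n-2)$ the inequality becomes
  $$\int v_t^2 + \int (|\nabla_\theta v|^2 - \mu_1 v^2) \ge
    C \Big(\int (1-t)^{-q} |v|^p\Big)^{2/p}$$
  on the half-cylinder $t < 0$, $\theta \in \Sigma$ (\<open>hardy_sobolev_emden\<close>). All parts of the
  theorem are read off from this form.

  The angular term. Every slice $v(t, \cdot)$ is a test function on $\Sigma$, so the second
  integral is nonnegative as soon as $\mu_1$ is the infimum of the Rayleigh quotient over test
  functions. Since $\mu_1$ is the least number for which the weak eigenvalue equation has a nonzero
  solution, this requires that the infimum is attained (\<open>mu1_eq_rayleigh\<close>): a minimising
  sequence has a subsequence that is Cauchy in $L^2$ by Rellich compactness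
  (\<open>Rellich_sphere\<close>), the parallelogram identity makes its gradients Cauchy too, and the limit
  satisfies the Euler--Lagrange equation.

  Existence of $C$ (\<open>hardy_sobolev_inequality\<close>). Substitute $1 - t = e^{-s}$ and
  $v = (1-t)^{1/2} w$, where $(1-t)^{1/2}$ is the ground state of the one-dimensional Hardy
  inequality. Then $\int v_t^2 \, dt = \int (w_s^2 + w^2/4) \, ds$, the angular terms acquire the
  factor $(1-t)^{-2} \le 1$, and $\int (1-t)^{-q} |v|^p \, dt = \int |w|^p \, ds$ precisely for
  $q = p/2 + 1 = (2n-2)/(n-2)$. So the logarithmic weight disappears, and on undoing the
  Emden--Fowler transform in $(s, \theta)$ what remains to be shown follows from the Sobolev
  inequality in $\mathbb{R}^n$. Geometrically, $u$ is transplanted by the radial map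
  $x \mapsto X_1(|x|) \, x/|x|$. The Sobolev inequality itself is obtained from the inequality of
  Gagliardo and Nirenberg (\<open>Sobolev_inequality\<close>).

  Optimality and the upper bound. Test with $v(t, \theta) = f(-t/R) \psi(\theta)$, where $f$ is a fixed
  bump supported in $[1,2]$ and $\psi$ almost minimises the Rayleigh quotient. The left-hand side is
  of order $1/R$, while the weighted integral is at least of order $R^{1-q}$; Hoelder's inequality
  on $\Sigma$ replaces $\|\psi\|_p$ by a power of $|\Sigma|$. This gives
  $C R^{(1-q)(n-2)/n} \le c R^{-1} |\Sigma|^{2/n}$ for all $R \ge 1$ (\<open>profile_bound\<close>,
  \<open>profile_lower_bound\<close>). Letting $R \to \infty$ excludes every $q < (2n-2)/(n-2)$, and $R = 1$ is
  the bound for the best constant. That bound tends to zero along thin lunes, which have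
  Lipschitz boundary, so no constant serves all $\Sigma$.\<close>

section \<open>Calculus of smooth functions\<close>

lemma GDERIV_unique:
  assumes "GDERIV f x :> D" "GDERIV f x :> E"
  shows "D = E"
proof -
  have "(\<lambda>h. inner h D) = (\<lambda>h. inner h E)"
    using assms unfolding gderiv_def by (rule has_derivative_unique)
  then have "inner h D = inner h E" for h
    by meson
  then show ?thesis
    by (metis vector_eq_ldot)
qed

lemma grad_eqI: "GDERIV f x :> D \<Longrightarrow> grad f x = D"
  unfolding grad_def using GDERIV_unique by (intro the_equality) auto

lemma GDERIV_grad:
  fixes f :: "'a::euclidean_space \<Rightarrow> real"
  assumes "f differentiable (at x)"
  shows "GDERIV f x :> grad f x"
proof -
  obtain f' where f': "(f has_derivative f') (at x)"
    using assms differentiable_def by blast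
  interpret bounded_linear f' using f' has_derivative_bounded_linear by blast
  define D where "D = (\<Sum>b\<in>Basis. f' b *\<^sub>R b)"
  have "f' h = inner h D" for h
  proof -
    have "f' h = f' (\<Sum>b\<in>Basis. (h \<bullet> b) *\<^sub>R b)" by (simp add: euclidean_representation)
    also have "\<dots> = (\<Sum>b\<in>Basis. (h \<bullet> b) * f' b)" by (simp add: sum scaleR)
    finally show ?thesis by (simp add: D_def inner_sum_right mult.commute)
  qed
  then have "f' = (\<lambda>h. inner h D)" by blast
  then have "GDERIV f x :> D" using f' by (simp add: gderiv_def)
  then show ?thesis using grad_eqI by metis
qed

lemma has_derivative_grad:
  fixes f :: "'a::euclidean_space \<Rightarrow> real"
  assumes "f differentiable (at x)"
  shows "(f has_derivative (\<lambda>h. h \<bullet> grad f x)) (at x)"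
  using GDERIV_grad[OF assms] by (simp add: gderiv_def)

lemma GDERIV_cong_open:
  assumes "open S" "x \<in> S" "\<And>y. y \<in> S \<Longrightarrow> f y = g y"
  shows "GDERIV f x :> D \<longleftrightarrow> GDERIV g x :> D"
  unfolding gderiv_def
  using assms has_derivative_transform_within_open[of _ _ x UNIV S] by (metis)

lemma grad_cong_open:
  assumes "open S" "x \<in> S" "\<And>y. y \<in> S \<Longrightarrow> f y = g y"
  shows "grad f x = grad g x"
proof -
  have "gderiv f x = gderiv g x"
    by (intro ext GDERIV_cong_open[OF assms(1,2)] assms(3))
  then show ?thesis unfolding grad_def by simp
qed

lemma Ck_on_cong:
  assumes "open S" "\<And>x. x \<in> S \<Longrightarrow> f x = g x" "Ck_on k S f"
  shows "Ck_on k S g"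
  using assms(2,3)
proof (induction k arbitrary: f g)
  case 0
  then show ?case using continuous_on_cong[of S S f g] by auto
next
  case (Suc k)
  have "g differentiable (at x)" if "x \<in> S" for x
    using Suc.prems that assms(1) GDERIV_grad GDERIV_cong_open[of S x f g]
    by (metis Ck_on.simps(2) differentiableI gderiv_def)
  moreover have "Ck_on k S (\<lambda>x. grad g x \<bullet> b)" if "b \<in> Basis" for b
  proof (rule Suc.IH)
    show "Ck_on k S (\<lambda>x. grad f x \<bullet> b)" using Suc.prems that by simp
    show "grad f x \<bullet> b = grad g x \<bullet> b" if "x \<in> S" for x
      using grad_cong_open[OF assms(1) that] Suc.prems(1) by metis
  qed
  ultimately show ?case by simp
qed

lemma Ck_on_subset: "Ck_on k T f \<Longrightarrow> S \<subseteq> T \<Longrightarrow> Ck_on k S f"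
  by (induction k arbitrary: f) (auto intro: continuous_on_subset)

lemma Ck_on_SucD: "Ck_on (Suc k) S f \<Longrightarrow> Ck_on k S f"
proof (induction k arbitrary: f)
  case 0
  then show ?case
    by (auto intro!: continuous_at_imp_continuous_on differentiable_imp_continuous_within)
next
  case (Suc k)
  then show ?case by auto
qed

lemma Ck_on_Un:
  assumes "open S" "open T" "Ck_on k S f" "Ck_on k T f"
  shows "Ck_on k (S \<union> T) f"
  using assms(3,4)
  by (induction k arbitrary: f) (auto intro: continuous_on_open_Un assms(1,2))

lemma Ck_on_const: "Ck_on k S (\<lambda>x. c)"
proof (induction k arbitrary: c)
  case (Suc k)
  have "grad (\<lambda>x. c) = (\<lambda>x::'a. 0)"
    by (intro ext grad_eqI GDERIV_const)
  then show ?case using Suc by simp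
qed auto

lemma Ck_on_inner: "Ck_on k S (\<lambda>x. x \<bullet> b)"
proof (cases k)
  case (Suc j)
  have "GDERIV (\<lambda>x::'a. x \<bullet> b) x :> b" for x
    unfolding gderiv_def by (auto intro!: derivative_eq_intros)
  then have "grad (\<lambda>x. x \<bullet> b) = (\<lambda>x::'a. b)"
    by (intro ext grad_eqI)
  then show ?thesis using Suc Ck_on_const by (auto intro!: derivative_intros)
qed (auto intro: continuous_intros)

lemma Ck_on_add:
  assumes "open S" "Ck_on k S f" "Ck_on k S g"
  shows "Ck_on k S (\<lambda>x. f x + g x)"
  using assms(2,3)
proof (induction k arbitrary: f g)
  case 0
  then show ?case by (auto intro: continuous_intros)
next
  case (Suc k)
  have "Ck_on k S (\<lambda>x. grad (\<lambda>x. f x + g x) x \<bullet> b)" if "b \<in> Basis" for b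
  proof (rule Ck_on_cong[OF assms(1)])
    show "Ck_on k S (\<lambda>x. grad f x \<bullet> b + grad g x \<bullet> b)"
      using Suc.prems that by (intro Suc.IH) auto
    show "grad f x \<bullet> b + grad g x \<bullet> b = grad (\<lambda>x. f x + g x) x \<bullet> b" if "x \<in> S" for x
      using Suc.prems that grad_eqI[OF GDERIV_add[OF GDERIV_grad GDERIV_grad], of f x g]
      by (simp add: inner_add_left)
  qed
  then show ?case using Suc.prems by auto
qed

lemma Ck_on_mult:
  assumes "open S" "Ck_on k S f" "Ck_on k S g"
  shows "Ck_on k S (\<lambda>x. f x * g x)"
  using assms(2,3)
proof (induction k arbitrary: f g)
  case 0
  then show ?case by (auto intro: continuous_intros)
next
  case (Suc k)
  have "Ck_on k S (\<lambda>x. grad (\<lambda>x. f x * g x) x \<bullet> b)" if "b \<in> Basis" for b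
  proof (rule Ck_on_cong[OF assms(1)])
    show "Ck_on k S (\<lambda>x. f x * (grad g x \<bullet> b) + g x * (grad f x \<bullet> b))"
      using Suc.prems that Ck_on_SucD[of k S f] Ck_on_SucD[of k S g]
      by (intro Ck_on_add assms(1) Suc.IH) simp_all
    show "f x * (grad g x \<bullet> b) + g x * (grad f x \<bullet> b) = grad (\<lambda>x. f x * g x) x \<bullet> b"
      if "x \<in> S" for x
      using Suc.prems that grad_eqI[OF GDERIV_mult[OF GDERIV_grad GDERIV_grad], of f x g]
      by (simp add: inner_add_left)
  qed
  then show ?case using Suc.prems by auto
qed

lemma Ck_on_sum:
  assumes "open S" "\<And>i. i \<in> I \<Longrightarrow> Ck_on k S (f i)"
  shows "Ck_on k S (\<lambda>x. \<Sum>i\<in>I. f i x)"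
  using assms(2)
proof (induction I rule: infinite_finite_induct)
  case (insert i I)
  then have "Ck_on k S (\<lambda>x. f i x + (\<Sum>i\<in>I. f i x))"
    by (intro Ck_on_add assms(1)) simp_all
  with insert show ?case by simp
qed (simp_all add: Ck_on_const)

lemma GDERIV_compose:
  fixes \<Psi> :: "'a::euclidean_space \<Rightarrow> 'b::euclidean_space"
  assumes "\<And>c. c \<in> Basis \<Longrightarrow> (\<lambda>x. \<Psi> x \<bullet> c) differentiable (at x)" "u differentiable (at (\<Psi> x))"
  shows "GDERIV (\<lambda>x. u (\<Psi> x)) x :>
           (\<Sum>c\<in>Basis. (grad u (\<Psi> x) \<bullet> c) *\<^sub>R grad (\<lambda>x. \<Psi> x \<bullet> c) x)"
proof -
  define \<Psi>' where "\<Psi>' h = (\<Sum>c\<in>Basis. (h \<bullet> grad (\<lambda>x. \<Psi> x \<bullet> c) x) *\<^sub>R c)" for h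
  have "(\<Psi> has_derivative \<Psi>') (at x)"
    unfolding has_derivative_componentwise_within[of \<Psi>] \<Psi>'_def
    using has_derivative_grad[OF assms(1)] by simp
  from diff_chain_at[OF this has_derivative_grad[OF assms(2)]]
  have "((\<lambda>x. u (\<Psi> x)) has_derivative (\<lambda>h. \<Psi>' h \<bullet> grad u (\<Psi> x))) (at x)"
    by (simp add: o_def)
  moreover have "\<Psi>' h \<bullet> grad u (\<Psi> x) =
      h \<bullet> (\<Sum>c\<in>Basis. (grad u (\<Psi> x) \<bullet> c) *\<^sub>R grad (\<lambda>x. \<Psi> x \<bullet> c) x)" for h
    by (simp add: \<Psi>'_def inner_sum_left inner_sum_right inner_commute mult.commute)
  ultimately show ?thesis unfolding gderiv_def by simp
qed

lemma Ck_on_compose: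
  fixes \<Psi> :: "'a::euclidean_space \<Rightarrow> 'b::euclidean_space"
  assumes "open S" "open T" "\<Psi> ` S \<subseteq> T"
    and "\<And>c. c \<in> Basis \<Longrightarrow> Ck_on k S (\<lambda>x. \<Psi> x \<bullet> c)" "Ck_on k T u"
  shows "Ck_on k S (\<lambda>x. u (\<Psi> x))"
  using assms(4,5)
proof (induction k arbitrary: u)
  case 0
  then have "continuous_on S \<Psi>" by (simp add: continuous_on_componentwise[of S \<Psi>])
  with 0(2) assms(3) show ?case
    using continuous_on_compose2[of T u S \<Psi>] by simp
next
  case (Suc k)
  have g: "GDERIV (\<lambda>x. u (\<Psi> x)) x :>
      (\<Sum>c\<in>Basis. (grad u (\<Psi> x) \<bullet> c) *\<^sub>R grad (\<lambda>x. \<Psi> x \<bullet> c) x)" if "x \<in> S" for x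
  proof (rule GDERIV_compose)
    show "(\<lambda>x. \<Psi> x \<bullet> c) differentiable (at x)" if "c \<in> Basis" for c
      using Suc.prems(1)[OF that] \<open>x \<in> S\<close> by simp
    show "u differentiable (at (\<Psi> x))"
      using Suc.prems(2) \<open>x \<in> S\<close> assms(3) by (simp add: image_subset_iff)
  qed
  have "Ck_on k S (\<lambda>x. grad (\<lambda>x. u (\<Psi> x)) x \<bullet> b)" if b: "b \<in> Basis" for b
  proof (rule Ck_on_cong[OF assms(1)])
    show "Ck_on k S (\<lambda>x. \<Sum>c\<in>Basis. (grad u (\<Psi> x) \<bullet> c) * (grad (\<lambda>x. \<Psi> x \<bullet> c) x \<bullet> b))"
    proof (intro Ck_on_sum Ck_on_mult assms(1))
      fix c :: 'b assume c: "c \<in> Basis"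
      show "Ck_on k S (\<lambda>x. grad u (\<Psi> x) \<bullet> c)"
      proof (rule Suc.IH[where u = "\<lambda>y. grad u y \<bullet> c"])
        show "Ck_on k T (\<lambda>y. grad u y \<bullet> c)" using Suc.prems(2) c by simp
      qed (rule Ck_on_SucD[OF Suc.prems(1)])
      show "Ck_on k S (\<lambda>x. grad (\<lambda>x. \<Psi> x \<bullet> c) x \<bullet> b)"
        using Suc.prems(1)[OF c] b by simp
    qed
    show "(\<Sum>c\<in>Basis. (grad u (\<Psi> x) \<bullet> c) * (grad (\<lambda>x. \<Psi> x \<bullet> c) x \<bullet> b)) =
        grad (\<lambda>x. u (\<Psi> x)) x \<bullet> b" if "x \<in> S" for x
      by (simp only: grad_eqI[OF g[OF that]] inner_sum_left inner_scaleR_left)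
  qed
  moreover have "(\<lambda>x. u (\<Psi> x)) differentiable (at x)" if "x \<in> S" for x
    using g[OF that] unfolding gderiv_def by (rule differentiableI)
  ultimately show ?case by simp
qed

text \<open>For functions of a real variable the recursion runs through the ordinary derivative; this reduces the
  smoothness of a concrete function to an induction over a family closed under differentiation.\<close>

lemma Ck_on_real_Suc:
  fixes f :: "real \<Rightarrow> real"
  assumes "open S" "\<And>x. x \<in> S \<Longrightarrow> (f has_real_derivative f' x) (at x)" "Ck_on k S f'"
  shows "Ck_on (Suc k) S f"
proof -
  have "grad f x = f' x" if "x \<in> S" for x
    using assms(2)[OF that] by (intro grad_eqI) simp
  then have "Ck_on k S (\<lambda>x. grad f x \<bullet> 1)"
    using Ck_on_cong[OF assms(1) _ assms(3), of "\<lambda>x. grad f x \<bullet> 1"] by simp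
  moreover have "f differentiable (at x)" if "x \<in> S" for x
    using assms(2)[OF that] by (auto simp: real_differentiable_def)
  ultimately show ?thesis by simp
qed

subsection \<open>Smooth functions\<close>

lemma smooth_on_const: "smooth_on S (\<lambda>x. c)"
  by (simp add: smooth_on_def Ck_on_const)

lemma smooth_on_inner: "smooth_on S (\<lambda>x. x \<bullet> b)"
  by (simp add: smooth_on_def Ck_on_inner)

lemma smooth_on_add:
  "open S \<Longrightarrow> smooth_on S f \<Longrightarrow> smooth_on S g \<Longrightarrow> smooth_on S (\<lambda>x. f x + g x)"
  by (simp add: smooth_on_def Ck_on_add)

lemma smooth_on_mult:
  "open S \<Longrightarrow> smooth_on S f \<Longrightarrow> smooth_on S g \<Longrightarrow> smooth_on S (\<lambda>x. f x * g x)"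
  by (simp add: smooth_on_def Ck_on_mult)

lemma smooth_on_diff:
  assumes "open S" "smooth_on S f" "smooth_on S g"
  shows "smooth_on S (\<lambda>x. f x - g x)"
  using smooth_on_add[OF assms(1,2) smooth_on_mult[OF assms(1) smooth_on_const assms(3)], of "-1"]
  by simp

lemma smooth_on_sum:
  "open S \<Longrightarrow> (\<And>i. i \<in> I \<Longrightarrow> smooth_on S (f i)) \<Longrightarrow> smooth_on S (\<lambda>x. \<Sum>i\<in>I. f i x)"
  by (simp add: smooth_on_def Ck_on_sum)

lemma smooth_on_cong:
  "open S \<Longrightarrow> smooth_on S f \<Longrightarrow> (\<And>x. x \<in> S \<Longrightarrow> f x = g x) \<Longrightarrow> smooth_on S g"
  unfolding smooth_on_def using Ck_on_cong by blast

lemma smooth_on_Un: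
  "open S \<Longrightarrow> open T \<Longrightarrow> smooth_on S f \<Longrightarrow> smooth_on T f \<Longrightarrow> smooth_on (S \<union> T) f"
  unfolding smooth_on_def using Ck_on_Un by blast

lemma smooth_on_compose:
  fixes \<Psi> :: "'a::euclidean_space \<Rightarrow> 'b::euclidean_space"
  assumes "open S" "open T" "\<And>x. x \<in> S \<Longrightarrow> \<Psi> x \<in> T"
    and "\<And>c. c \<in> Basis \<Longrightarrow> smooth_on S (\<lambda>x. \<Psi> x \<bullet> c)" "smooth_on T u"
  shows "smooth_on S (\<lambda>x. u (\<Psi> x))"
  unfolding smooth_on_def
proof
  fix k show "Ck_on k S (\<lambda>x. u (\<Psi> x))"
  proof (rule Ck_on_compose[OF assms(1,2)])
    show "\<Psi> ` S \<subseteq> T" using assms(3) by blast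
    show "Ck_on k S (\<lambda>x. \<Psi> x \<bullet> c)" if "c \<in> Basis" for c
      using assms(4)[OF that] by (simp add: smooth_on_def)
    show "Ck_on k T u" using assms(5) by (simp add: smooth_on_def)
  qed
qed

lemma smooth_on_compose_real:
  fixes f :: "'a::euclidean_space \<Rightarrow> real"
  assumes "smooth_on T u" "open T" "open S" "smooth_on S f" "\<And>x. x \<in> S \<Longrightarrow> f x \<in> T"
  shows "smooth_on S (\<lambda>x. u (f x))"
proof (rule smooth_on_compose[OF assms(3,2,5) _ assms(1)])
  show "smooth_on S (\<lambda>x. f x \<bullet> c)" if "c \<in> Basis" for c using assms(4) that by simp
qed

lemma smooth_on_continuous: "smooth_on S f \<Longrightarrow> continuous_on S f"
  unfolding smooth_on_def by (drule spec[of _ 0]) simp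

lemma smooth_on_differentiable: "smooth_on S f \<Longrightarrow> x \<in> S \<Longrightarrow> f differentiable (at x)"
  unfolding smooth_on_def by (drule spec[of _ "Suc 0"]) simp

lemma smooth_on_continuous_grad:
  fixes f :: "'a::euclidean_space \<Rightarrow> real"
  assumes "smooth_on S f"
  shows "continuous_on S (grad f)"
proof -
  have "Ck_on (Suc 0) S f" using assms unfolding smooth_on_def by blast
  then show ?thesis by (simp add: continuous_on_componentwise[of S "grad f"])
qed

lemma smooth_on_ident: "smooth_on S (\<lambda>s::real. s)"
  using smooth_on_inner[of S "1::real"] by simp

lemma smooth_on_exp: "smooth_on UNIV (exp :: real \<Rightarrow> real)"
proof -
  have "Ck_on k UNIV (exp :: real \<Rightarrow> real)" for k
  proof (induction k)
    case (Suc k)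
    then show ?case by (rule Ck_on_real_Suc[rotated 2]) (auto intro!: derivative_eq_intros)
  qed (auto intro!: continuous_intros)
  then show ?thesis by (simp add: smooth_on_def)
qed

lemma smooth_on_inverse: "smooth_on (- {0}) (inverse :: real \<Rightarrow> real)"
proof -
  have "Ck_on k (- {0}) (inverse :: real \<Rightarrow> real)" for k
  proof (induction k)
    case 0
    show ?case by (auto intro!: continuous_intros)
  next
    case (Suc k)
    show ?case
    proof (rule Ck_on_real_Suc)
      show "Ck_on k (- {0}) (\<lambda>x::real. (-1) * (inverse x * inverse x))"
        by (intro Ck_on_mult Ck_on_const Suc) auto
    qed (auto intro!: derivative_eq_intros)
  qed
  then show ?thesis by (simp add: smooth_on_def)
qed

lemma smooth_on_ln: "smooth_on {0<..} (ln :: real \<Rightarrow> real)"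
proof -
  have "Ck_on k {0<..} (ln :: real \<Rightarrow> real)" for k
  proof (cases k)
    case 0
    then show ?thesis by (auto intro!: continuous_intros)
  next
    case (Suc j)
    have "Ck_on j {0<..} (inverse :: real \<Rightarrow> real)"
      using smooth_on_inverse Ck_on_subset[of j "-{0}" inverse "{0<..}"]
      by (auto simp: smooth_on_def)
    then show ?thesis unfolding Suc
      by (rule Ck_on_real_Suc[rotated 2]) (auto intro!: derivative_eq_intros simp: divide_simps)
  qed
  then show ?thesis by (simp add: smooth_on_def)
qed

lemma smooth_on_powr: "smooth_on {0<..} (\<lambda>x::real. x powr a)"
proof (rule smooth_on_cong)
  show "smooth_on {0<..} (\<lambda>x. exp (a * ln x))"
    by (intro smooth_on_compose_real[OF smooth_on_exp] smooth_on_mult smooth_on_const smooth_on_ln) auto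
qed (auto simp: powr_def)

lemma smooth_on_norm: "smooth_on (- {0}) (norm :: 'a::euclidean_space \<Rightarrow> real)"
proof (rule smooth_on_cong)
  show "smooth_on (- {0}) (\<lambda>x::'a. (\<Sum>b\<in>Basis. (x \<bullet> b) * (x \<bullet> b)) powr (1/2))"
    by (intro smooth_on_compose_real[OF smooth_on_powr] smooth_on_sum smooth_on_mult smooth_on_inner)
      (auto simp flip: euclidean_inner)
qed (auto simp: norm_eq_sqrt_inner powr_half_sqrt simp flip: euclidean_inner)

lemma smooth_on_inverse_norm: "smooth_on (- {0}) (\<lambda>x::'a::euclidean_space. inverse (norm x))"
  by (intro smooth_on_compose_real[OF smooth_on_inverse] smooth_on_norm) auto

lemma smooth_on_sgn: "smooth_on (- {0}) (\<lambda>x::'a::euclidean_space. sgn x \<bullet> b)"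
proof (rule smooth_on_cong)
  show "smooth_on (- {0}) (\<lambda>x::'a. inverse (norm x) * (x \<bullet> b))"
    by (intro smooth_on_mult smooth_on_inner smooth_on_inverse_norm) auto
qed (auto simp: sgn_div_norm)

text \<open>The functions $y^{-j} e^{-1/y}$, continued by zero to $y \le 0$. The case $j = 0$ is the
  smooth cut-off; its derivatives are combinations of the others.\<close>

definition flat_exp :: "nat \<Rightarrow> real \<Rightarrow> real" where
  "flat_exp j y = (if y > 0 then inverse y ^ j * exp (- inverse y) else 0)"

lemma flat_exp_tendsto_0: "(flat_exp j \<longlongrightarrow> 0) (at 0)"
proof -
  have "((\<lambda>y::real. inverse y ^ j / exp (inverse y)) \<longlongrightarrow> 0) (at_right 0)"
    by (rule filterlim_compose[OF tendsto_power_div_exp_0 filterlim_inverse_at_top_right])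
  then have "(flat_exp j \<longlongrightarrow> 0) (at_right 0)"
    by (rule Lim_transform_eventually)
      (auto simp: flat_exp_def exp_minus divide_inverse eventually_at_right_less
        intro!: eventually_at_rightI[of 0 1])
  moreover have "(flat_exp j \<longlongrightarrow> 0) (at_left 0)"
    by (rule Lim_transform_eventually[OF tendsto_const])
      (auto simp: flat_exp_def intro!: eventually_at_leftI[of "-1"])
  ultimately show ?thesis by (simp add: filterlim_split_at_real)
qed

lemma DERIV_flat_exp:
  "(flat_exp j has_real_derivative flat_exp (j + 2) y - real j * flat_exp (j + 1) y) (at y)"
proof -
  consider "y > 0" | "y < 0" | "y = 0" by linarith
  then show ?thesis
  proof cases
    case 1
    have "((\<lambda>y. inverse y ^ j * exp (- inverse y)) has_real_derivative
        flat_exp (j + 2) y - real j * flat_exp (j + 1) y) (at y)"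
      using 1 by (auto intro!: derivative_eq_intros simp: flat_exp_def, cases j, auto simp: field_simps)
    then show ?thesis
      by (rule has_field_derivative_transform_within_open[of _ _ _ "{0<..}"])
        (use 1 in \<open>auto simp: flat_exp_def\<close>)
  next
    case 2
    have "((\<lambda>y. 0) has_real_derivative 0) (at y)" by simp
    then have "(flat_exp j has_real_derivative 0) (at y)"
      by (rule has_field_derivative_transform_within_open[of _ _ _ "{..<0}"])
        (use 2 in \<open>auto simp: flat_exp_def\<close>)
    then show ?thesis using 2 by (simp add: flat_exp_def)
  next
    case 3
    \<comment> \<open>The difference quotient at 0 is again a member of the family.\<close>
    have "(\<lambda>t. (flat_exp j (0 + t) - flat_exp j 0) / t) = flat_exp (Suc j)"
      by (auto simp: flat_exp_def divide_inverse)
    then show ?thesis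
      using flat_exp_tendsto_0[of "Suc j"] 3 by (simp add: DERIV_def flat_exp_def[of _ 0])
  qed
qed

lemma smooth_on_flat_exp: "smooth_on UNIV (flat_exp j)"
proof -
  have "Ck_on k UNIV (flat_exp j)" for k
  proof (induction k arbitrary: j)
    case 0
    show ?case
      by (auto intro!: continuous_at_imp_continuous_on DERIV_isCont DERIV_flat_exp)
  next
    case (Suc k)
    show ?case
    proof (rule Ck_on_real_Suc)
      show "Ck_on k UNIV (\<lambda>y. flat_exp (j + 2) y + (- real j) * flat_exp (j + 1) y)"
        by (intro Ck_on_add Ck_on_mult Suc Ck_on_const) auto
    qed (use DERIV_flat_exp in auto)
  qed
  then show ?thesis by (simp add: smooth_on_def)
qed

definition bump :: "real \<Rightarrow> real" where
  "bump s = flat_exp 0 (s - 1) * flat_exp 0 (2 - s)"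

lemma smooth_on_bump: "smooth_on UNIV bump"
  unfolding bump_def
  by (intro smooth_on_mult smooth_on_compose_real[OF smooth_on_flat_exp] smooth_on_diff
      smooth_on_const smooth_on_ident) auto

lemma bump_zero_iff: "bump s = 0 \<longleftrightarrow> s \<le> 1 \<or> s \<ge> 2"
  by (auto simp: bump_def flat_exp_def)


section \<open>Polar coordinates\<close>

lemma sets_surface_measure [measurable_cong, simp]: "sets surface_measure = sets borel"
  by (simp add: surface_measure_def)

lemma space_surface_measure [simp]: "space surface_measure = UNIV"
  using sets_eq_imp_space_eq[OF sets_surface_measure] by simp

lemma borel_measurable_sgn_vec [measurable]: "sgn \<in> borel_measurable (borel :: 'a::euclidean_space measure)"
proof (rule borel_measurable_continuous_countable_exceptions[of "{0}"])
  show "continuous_on (- {0}) (sgn :: 'a \<Rightarrow> 'a)"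
    unfolding sgn_div_norm[abs_def] by (intro continuous_intros) auto
qed simp

lemma finite_measure_surface_measure:
  "finite_measure (surface_measure :: (real^'n) measure)"
proof
  have "emeasure lborel (ball (0::real^'n) 1) < \<infinity>"
    by (rule emeasure_lborel_ball_finite)
  then show "emeasure (surface_measure :: (real^'n) measure) (space surface_measure) \<noteq> \<infinity>"
    by (simp add: emeasure_surface_measure ennreal_mult_eq_top_iff ball_def)
qed

interpretation surface: finite_measure surface_measure
  by (rule finite_measure_surface_measure)

lemma AE_surface_measure_norm:
  "AE \<theta> in (surface_measure :: (real^'n) measure). norm \<theta> = 1"
proof (rule AE_I)
  show "{\<theta> \<in> space (surface_measure :: (real^'n) measure). norm \<theta> \<noteq> 1} \<subseteq> {\<theta>. norm \<theta> \<noteq> 1}"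
    by auto
  have "{x \<in> ball 0 1. sgn x \<in> {\<theta>::real^'n. norm \<theta> \<noteq> 1}} = {0}"
    by (auto simp: norm_sgn)
  then show "emeasure surface_measure {\<theta>::real^'n. norm \<theta> \<noteq> 1} = 0"
    by (subst emeasure_surface_measure) auto
  show "{\<theta>::real^'n. norm \<theta> \<noteq> 1} \<in> sets surface_measure" by simp
qed

lemma emeasure_lborel_scaled:
  fixes A :: "('a::euclidean_space) set"
  assumes "A \<in> sets borel" "c > 0"
  shows "emeasure lborel A = ennreal (c ^ DIM('a)) * emeasure lborel {x. c *\<^sub>R x \<in> A}"
proof -
  have "emeasure lborel A =
      emeasure (density (distr lborel borel (\<lambda>x. 0 + c *\<^sub>R x)) (\<lambda>_. \<bar>c\<bar>^DIM('a))) A"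
    using assms(2) by (intro arg_cong2[where f = emeasure] lborel_affine) auto
  also have "\<dots> = (\<integral>\<^sup>+x. ennreal (\<bar>c\<bar>^DIM('a)) * indicator A x \<partial>distr lborel borel (\<lambda>x. 0 + c *\<^sub>R x))"
    using assms(1) by (subst emeasure_density) auto
  also have "\<dots> = ennreal (c ^ DIM('a)) * emeasure (distr lborel borel (\<lambda>x. c *\<^sub>R x)) A"
    using assms by (subst nn_integral_cmult_indicator) auto
  also have "emeasure (distr lborel borel (\<lambda>x. c *\<^sub>R x)) A = emeasure lborel {x. c *\<^sub>R x \<in> A}"
    using assms by (subst emeasure_distr) (auto simp: vimage_def)
  finally show ?thesis .
qed

lemma nn_integral_exp_lessThan:
  assumes "k > 0"
  shows "(\<integral>\<^sup>+s. ennreal (exp (k * s)) * indicator {..<t} s \<partial>lborel) = ennreal (exp (k * t) / k)"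
proof -
  have lim: "((\<lambda>s. exp (- (k * s))) \<longlongrightarrow> 0) at_top"
  proof (rule filterlim_compose[OF exp_at_bot])
    show "filterlim (\<lambda>s. - (k * s)) at_bot at_top"
      using filterlim_tendsto_pos_mult_at_top[OF tendsto_const assms filterlim_ident]
      by (simp add: filterlim_uminus_at_bot)
  qed
  have "(\<integral>\<^sup>+s. ennreal (exp (k * s)) * indicator {..<t} s \<partial>lborel) =
      (\<integral>\<^sup>+s. ennreal (exp (- (k * s))) * indicator {..<t} (- s) \<partial>lborel)"
    using nn_integral_real_affine[of "\<lambda>s. ennreal (exp (k * s)) * indicator {..<t} s" "-1" 0]
    by simp
  also have "\<dots> = (\<integral>\<^sup>+s. ennreal (exp (- (k * s))) * indicator {-t..} s \<partial>lborel)"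
  proof (rule nn_integral_cong_AE)
    show "AE s in lborel. ennreal (exp (- (k * s))) * indicator {..<t} (- s) =
        ennreal (exp (- (k * s))) * indicator {-t..} s"
      using AE_lborel_singleton[of "-t"] by eventually_elim (auto simp: indicator_def)
  qed
  also have "\<dots> = ennreal (0 - (- exp (- (k * (- t))) / k))"
  proof (rule nn_integral_FTC_atLeast)
    show "((\<lambda>s. - exp (- (k * s)) / k) \<longlongrightarrow> 0) at_top"
      using tendsto_divide[OF tendsto_minus[OF lim] tendsto_const, of k] assms by simp
    show "((\<lambda>s. - exp (- (k * s)) / k) has_real_derivative exp (- (k * x))) (at x)" for x
      using assms by (auto intro!: derivative_eq_intros)
  qed (use assms in simp_all)
  finally show ?thesis by simp
qed

text \<open>Scaling by $e^t$ reduces a sector to the part of the unit ball that defines the surface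
  measure; the factor $1/n$ undoes the normalisation of that measure.\<close>

lemma emeasure_sector:
  fixes B :: "(real^'n) set"
  assumes [measurable]: "B \<in> sets borel"
  shows "emeasure lborel {x. ln (norm x) < t \<and> sgn x \<in> B} =
           ennreal (exp (real CARD('n) * t) / real CARD('n)) * emeasure surface_measure B"
proof -
  define K where "K = {x::real^'n. norm x < exp t \<and> sgn x \<in> B}"
  have K: "K \<in> sets borel" unfolding K_def by measurable
  have m: "{x::real^'n. ln (norm x) < t \<and> sgn x \<in> B} \<in> sets lborel" by measurable
  have "emeasure lborel {x::real^'n. ln (norm x) < t \<and> sgn x \<in> B} = emeasure lborel K"
  proof (rule emeasure_eq_AE)
    show "AE x in lborel. (x \<in> {x. ln (norm x) < t \<and> sgn x \<in> B}) = (x \<in> K)"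
      using AE_lborel_singleton[of 0]
    proof eventually_elim
      case (elim x)
      then have "ln (norm x) < t \<longleftrightarrow> norm x < exp t"
        by (metis exp_less_cancel_iff exp_ln zero_less_norm_iff)
      then show ?case by (simp add: K_def)
    qed
  qed (use K m in auto)
  also have "\<dots> = ennreal (exp t ^ CARD('n)) * emeasure lborel {x. exp t *\<^sub>R x \<in> K}"
    using emeasure_lborel_scaled[OF K, of "exp t"] by simp
  also have "{x. exp t *\<^sub>R x \<in> K} = {x \<in> ball 0 1. sgn x \<in> B}"
    by (auto simp: K_def sgn_scaleR)
  also have "emeasure lborel {x \<in> ball 0 1. sgn x \<in> B} = emeasure surface_measure B / of_nat CARD('n)"
    by (simp only: emeasure_surface_measure[OF assms] mult.commute[of "of_nat CARD('n)"])
      (simp add: ennreal_mult_divide_eq)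
  also have "exp t ^ CARD('n) = exp (real CARD('n) * t)"
    by (rule exp_of_nat_mult[symmetric])
  also have "ennreal (exp (real CARD('n) * t)) * (emeasure surface_measure B / of_nat CARD('n)) =
      ennreal (exp (real CARD('n) * t) / real CARD('n)) * emeasure surface_measure B"
    by (simp add: divide_ennreal_def divide_inverse ennreal_mult'
        ennreal_of_nat_eq_real_of_nat inverse_ennreal mult_ac)
  finally show ?thesis .
qed

lemma lessThan_generator:
  "sets borel = sigma_sets UNIV (range (lessThan :: real \<Rightarrow> real set))"
proof -
  have "borel = sigma UNIV (range (lessThan :: real \<Rightarrow> real set))"
    using borel_eq_lessThan[where 'a=real] by (simp add: eucl_lessThan)
  then have "sets borel = sets (sigma UNIV (range (lessThan :: real \<Rightarrow> real set)))"
    by (rule arg_cong)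
  also have "\<dots> = sigma_sets UNIV (range lessThan)"
    by (rule sets_measure_of) auto
  finally show ?thesis .
qed

abbreviation cylinder_measure :: "(real \<times> (real^'n)) measure" where
  "cylinder_measure \<equiv> lborel \<Otimes>\<^sub>M surface_measure"

text \<open>For fixed $B$ both sides are measures in $A$ that are finite on the half-lines $(-\infty, t)$, so it
  suffices to compare them there; this is \<open>emeasure_sector\<close>, as $e^{nt}/n$ is the integral of
  $e^{ns}$ over $s < t$.\<close>

lemma polar_measure:
  "distr lborel (borel \<Otimes>\<^sub>M borel) (\<lambda>x::real^'n. (ln (norm x), sgn x)) =
     density cylinder_measure (\<lambda>(t, \<theta>). ennreal (exp (real CARD('n) * t)))"
proof -
  let ?n = "real CARD('n)"
  let ?w = "\<lambda>t. ennreal (exp (?n * t))"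
  have sf: "sigma_finite_measure (density lborel ?w)"
    by (subst sigma_finite_measure.sigma_finite_iff_density_finite)
      (auto intro: sigma_finite_lborel)
  have "density lborel ?w \<Otimes>\<^sub>M surface_measure =
      distr lborel (borel \<Otimes>\<^sub>M borel) (\<lambda>x::real^'n. (ln (norm x), sgn x))"
  proof (rule pair_measure_eqI)
    fix A :: "real set" and B :: "(real^'n) set"
    assume "A \<in> sets (density lborel ?w)" and "B \<in> sets surface_measure"
    then have [measurable]: "A \<in> sets borel" "B \<in> sets borel" by auto
    define N1 where "N1 = distr (density lborel (indicator {x::real^'n. sgn x \<in> B})) borel (\<lambda>x. ln (norm x))"
    define N2 where "N2 = density lborel (\<lambda>t. ?w t * emeasure surface_measure B)"
    have N1: "emeasure N1 A = emeasure lborel {x. ln (norm x) \<in> A \<and> sgn x \<in> B}"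
      if [measurable]: "A \<in> sets borel" for A
    proof -
      have "emeasure N1 A = emeasure (density lborel (indicator {x::real^'n. sgn x \<in> B}))
          {x. ln (norm x) \<in> A}"
        unfolding N1_def by (subst emeasure_distr) (auto simp: vimage_def)
      also have "\<dots> = (\<integral>\<^sup>+x. indicator {x. sgn x \<in> B} x * indicator {x. ln (norm x) \<in> A} x \<partial>lborel)"
        by (subst emeasure_density) auto
      also have "\<dots> = (\<integral>\<^sup>+x. indicator {x. ln (norm x) \<in> A \<and> sgn x \<in> B} x \<partial>lborel)"
        by (intro nn_integral_cong) (auto simp: indicator_def)
      finally show ?thesis by simp
    qed
    have N2: "emeasure N2 A = emeasure (density lborel ?w) A * emeasure surface_measure B"
      if [measurable]: "A \<in> sets borel" for A
    proof -
      have "emeasure N2 A = (\<integral>\<^sup>+t. ?w t * indicator A t * emeasure surface_measure B \<partial>lborel)"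
        unfolding N2_def by (subst emeasure_density) (auto simp: mult_ac)
      also have "\<dots> = (\<integral>\<^sup>+t. ?w t * indicator A t \<partial>lborel) * emeasure surface_measure B"
        by (subst nn_integral_multc) auto
      finally show ?thesis by (subst emeasure_density) auto
    qed
    have eq: "emeasure N1 {..<t} = emeasure N2 {..<t}" for t
    proof -
      have "emeasure (density lborel ?w) {..<t} = ennreal (exp (?n * t) / ?n)"
        using nn_integral_exp_lessThan[of ?n t] by (subst emeasure_density) auto
      then show ?thesis
        using emeasure_sector[of B t] by (simp add: N1 N2 lessThan_iff)
    qed
    \<comment> \<open>Half-lines are stable under intersection and generate the Borel sets.\<close>
    have "N1 = N2"
    proof (rule measure_eqI_generator_eq[where \<Omega>=UNIV and E="range lessThan" and A="\<lambda>i. {..<real i}"])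
      show "Int_stable (range (lessThan :: real \<Rightarrow> real set))"
      proof (rule Int_stableI_image)
        fix i j :: real
        show "\<exists>k\<in>UNIV. {..<i} \<inter> {..<j} = {..<k}"
          by (rule bexI[of _ "min i j"]) auto
      qed
      show "(\<Union>i. {..<real i}) = UNIV"
        using reals_Archimedean2 by auto
      show "emeasure N1 {..<real i} \<noteq> \<infinity>" for i
        using surface.emeasure_finite[of B] emeasure_sector[of B "real i"]
        by (simp add: N1 ennreal_mult_eq_top_iff)
    qed (use eq in \<open>auto simp: N1_def N2_def lessThan_generator\<close>)
    then have "emeasure N1 A = emeasure N2 A" by simp
    moreover have "(\<lambda>x::real^'n. (ln (norm x), sgn x)) -` (A \<times> B) \<inter> space lborel =
        {x. ln (norm x) \<in> A \<and> sgn x \<in> B}" by auto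
    ultimately show "emeasure (density lborel ?w) A * emeasure surface_measure B =
        emeasure (distr lborel (borel \<Otimes>\<^sub>M borel) (\<lambda>x::real^'n. (ln (norm x), sgn x))) (A \<times> B)"
      by (subst emeasure_distr) (auto simp: N1 N2)
  qed (auto intro!: sf surface.sigma_finite_measure_axioms cong: sets_pair_measure_cong)
  moreover have "density lborel ?w \<Otimes>\<^sub>M (density surface_measure (\<lambda>_. 1)) =
      density cylinder_measure (\<lambda>(t, \<theta>::real^'n). ?w t * 1)"
    by (rule pair_measure_density)
      (auto simp: density_1 intro: surface.sigma_finite_measure_axioms)
  ultimately show ?thesis by (simp add: density_1)
qed

lemma sets_cylinder_measure: "sets (cylinder_measure :: (real \<times> (real^'n)) measure) = sets (borel \<Otimes>\<^sub>M borel)"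
  by (intro sets_pair_measure_cong) auto

lemma borel_measurable_cylinder_iff:
  "f \<in> borel_measurable (cylinder_measure :: (real \<times> (real^'n)) measure) \<longleftrightarrow> f \<in> borel_measurable borel"
proof -
  have "sets (cylinder_measure :: (real \<times> (real^'n)) measure) = sets borel"
    by (simp only: sets_cylinder_measure borel_prod)
  from measurable_cong_sets[OF this refl] show ?thesis by blast
qed

lemma polar_integral:
  fixes f :: "real^'n \<Rightarrow> real"
  assumes [measurable]: "f \<in> borel_measurable borel"
  shows "(LINT x|lborel. f x) =
    (LINT z|cylinder_measure. exp (real CARD('n) * fst z) * f (exp (fst z) *\<^sub>R snd z))"
proof -
  define F where "F = (\<lambda>z::real \<times> (real^'n). f (exp (fst z) *\<^sub>R snd z))"
  define P where "P = (\<lambda>x::real^'n. (ln (norm x), sgn x))"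
  have F [measurable]: "F \<in> borel_measurable (borel \<Otimes>\<^sub>M borel)" unfolding F_def by measurable
  have P [measurable]: "P \<in> lborel \<rightarrow>\<^sub>M borel \<Otimes>\<^sub>M borel" unfolding P_def by measurable
  have F': "F \<in> borel_measurable cylinder_measure"
    using F by (simp add: borel_measurable_cylinder_iff borel_prod)
  have dens: "distr lborel (borel \<Otimes>\<^sub>M borel) P =
      density cylinder_measure (\<lambda>z. ennreal (exp (real CARD('n) * fst z)))"
    using polar_measure[where 'n='n] by (simp add: P_def case_prod_unfold)
  have w: "(\<lambda>z. exp (real CARD('n) * fst z)) \<in> borel_measurable (cylinder_measure :: (real \<times> (real^'n)) measure)"
    by measurable
  have FP: "AE x in lborel. f x = F (P x)"
    using AE_lborel_singleton[of "0::real^'n"]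
    by eventually_elim (simp add: F_def P_def sgn_div_norm)
  have "(LINT x|lborel. f x) = (LINT x|lborel. F (P x))"
    by (intro integral_cong_AE FP) measurable
  also have "\<dots> = integral\<^sup>L (distr lborel (borel \<Otimes>\<^sub>M borel) P) F"
    by (subst integral_distr) auto
  also have "\<dots> = (LINT z|cylinder_measure. exp (real CARD('n) * fst z) *\<^sub>R F z)"
    unfolding dens by (rule integral_density[OF F' w]) simp
  finally show ?thesis by (simp add: F_def)
qed

interpretation cylinder: pair_sigma_finite lborel surface_measure
  by (intro pair_sigma_finite.intro sigma_finite_lborel surface.sigma_finite_measure_axioms)

lemma AE_cylinder_norm:
  "AE z in (cylinder_measure :: (real \<times> (real^'n)) measure). norm (snd z) = 1"
proof (rule cylinder.AE_pair_measure)
  show "{z \<in> space (cylinder_measure :: (real \<times> (real^'n)) measure). norm (snd z) = 1} \<in> sets cylinder_measure"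
    by measurable
  show "AE t in lborel. AE \<theta> in (surface_measure :: (real^'n) measure). norm (snd (t, \<theta>)) = 1"
    by (rule AE_I2) (simp add: AE_surface_measure_norm)
qed

lemma integrable_cylinderI:
  fixes F :: "real \<times> (real^'n) \<Rightarrow> real"
  assumes "F \<in> borel_measurable borel"
    and "\<And>t \<theta>. norm \<theta> = 1 \<Longrightarrow> t \<in> {a..b} \<Longrightarrow> \<bar>F (t, \<theta>)\<bar> \<le> B"
    and "\<And>t \<theta>. norm \<theta> = 1 \<Longrightarrow> t \<notin> {a..b} \<Longrightarrow> F (t, \<theta>) = 0"
  shows "integrable cylinder_measure F"
proof (rule Bochner_Integration.integrable_bound)
  let ?A = "{a..b} \<times> (UNIV :: (real^'n) set)"
  have "emeasure (cylinder_measure :: (real \<times> (real^'n)) measure) ?A =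
      emeasure lborel {a..b} * emeasure (surface_measure :: (real^'n) measure) UNIV"
    by (rule surface.emeasure_pair_measure_Times) auto
  also have "\<dots> < \<infinity>"
    using top.not_eq_extremum[THEN iffD1, OF surface.emeasure_finite[of "UNIV :: (real^'n) set"]]
    by (auto simp: ennreal_mult_less_top emeasure_lborel_Icc_eq)
  finally show "integrable cylinder_measure (\<lambda>z. B * indicator ?A z)"
    by (intro integrable_mult_right integrable_real_indicator) auto
  show "F \<in> borel_measurable cylinder_measure"
    using assms(1) by (simp add: borel_measurable_cylinder_iff)
  show "AE z in cylinder_measure. norm (F z) \<le> norm (B * indicator ?A z)"
    using AE_cylinder_norm
  proof eventually_elim
    case (elim z)
    then show ?case
      using assms(2)[of "snd z" "fst z"] assms(3)[of "snd z" "fst z"]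
      by (cases z) (auto simp: indicator_def)
  qed
qed


section \<open>The Emden--Fowler transform\<close>

text \<open>The exponent $(n-2)/2$ is the one for which neither the Hardy term nor the critical power carries
  a weight in $t$ (\<open>mass_density_emden\<close>, \<open>power_density_emden\<close>).\<close>

definition emden :: "(real^'n \<Rightarrow> real) \<Rightarrow> real \<Rightarrow> real^'n \<Rightarrow> real" where
  "emden u t \<theta> = exp ((real CARD('n) - 2) / 2 * t) * u (exp t *\<^sub>R \<theta>)"

text \<open>The derivative of the transform in $t$ and the squared length of its tangential gradient (see
  \<open>DERIV_emden\<close> and \<open>norm_sphere_grad_emden\<close>), expressed through the gradient of $u$: in this form
  both are visibly continuous and vanish off the support.\<close>

definition emden_dt :: "(real^'n \<Rightarrow> real) \<Rightarrow> real \<Rightarrow> real^'n \<Rightarrow> real" where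
  "emden_dt u t \<theta> = (real CARD('n) - 2) / 2 * emden u t \<theta> +
     exp (real CARD('n) / 2 * t) * (grad u (exp t *\<^sub>R \<theta>) \<bullet> \<theta>)"

definition emden_ang :: "(real^'n \<Rightarrow> real) \<Rightarrow> real \<Rightarrow> real^'n \<Rightarrow> real" where
  "emden_ang u t \<theta> = exp (real CARD('n) * t) *
     ((norm (grad u (exp t *\<^sub>R \<theta>)))\<^sup>2 - (grad u (exp t *\<^sub>R \<theta>) \<bullet> \<theta>)\<^sup>2)"

lemma DERIV_emden:
  fixes u :: "real^'n \<Rightarrow> real"
  assumes "u differentiable (at (exp t *\<^sub>R \<theta>))"
  shows "((\<lambda>t. emden u t \<theta>) has_real_derivative emden_dt u t \<theta>) (at t)"
proof -
  let ?n = "real CARD('n)"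
  have "((\<lambda>t. exp t *\<^sub>R \<theta>) has_derivative (\<lambda>h. (h * exp t) *\<^sub>R \<theta>)) (at t)"
    by (auto intro!: derivative_eq_intros)
  from diff_chain_at[OF this has_derivative_grad[OF assms]]
  have "((\<lambda>t. u (exp t *\<^sub>R \<theta>)) has_derivative (\<lambda>h. h * (exp t * (\<theta> \<bullet> grad u (exp t *\<^sub>R \<theta>))))) (at t)"
    by (simp add: o_def mult.assoc)
  then have d: "((\<lambda>t. u (exp t *\<^sub>R \<theta>)) has_real_derivative exp t * (\<theta> \<bullet> grad u (exp t *\<^sub>R \<theta>))) (at t)"
    by (simp add: has_field_derivative_def mult_commute_abs)
  have e: "exp ((?n - 2) / 2 * t) * exp t = exp (?n / 2 * t)"
    by (simp add: exp_add[symmetric] field_simps)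
  have "((\<lambda>t. emden u t \<theta>) has_real_derivative
      exp ((?n - 2) / 2 * t) * ((?n - 2) / 2) * u (exp t *\<^sub>R \<theta>) +
      (exp t * (\<theta> \<bullet> grad u (exp t *\<^sub>R \<theta>))) * exp ((?n - 2) / 2 * t)) (at t)"
    unfolding emden_def by (rule DERIV_mult[OF _ d]) (auto intro!: derivative_eq_intros)
  also have "exp ((?n - 2) / 2 * t) * ((?n - 2) / 2) * u (exp t *\<^sub>R \<theta>) +
      (exp t * (\<theta> \<bullet> grad u (exp t *\<^sub>R \<theta>))) * exp ((?n - 2) / 2 * t) = emden_dt u t \<theta>"
    unfolding emden_dt_def emden_def e[symmetric] by (simp add: inner_commute algebra_simps)
  finally show ?thesis .
qed

lemma GDERIV_sgn_slice:
  fixes u :: "real^'n \<Rightarrow> real"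
  assumes "u differentiable (at (r *\<^sub>R \<theta>))" "norm \<theta> = 1"
  shows "GDERIV (\<lambda>x. c * u (r *\<^sub>R sgn x)) \<theta> :>
           (c * r) *\<^sub>R (grad u (r *\<^sub>R \<theta>) - (grad u (r *\<^sub>R \<theta>) \<bullet> \<theta>) *\<^sub>R \<theta>)"
proof -
  have [simp]: "\<theta> \<noteq> 0" using assms(2) by auto
  have "(norm has_derivative (\<lambda>h. h \<bullet> \<theta>)) (at \<theta>)"
    using has_derivative_norm[of \<theta>] assms(2) by (simp add: sgn_div_norm)
  then have der: "((\<lambda>x. r *\<^sub>R sgn x) has_derivative (\<lambda>h. r *\<^sub>R (h - (h \<bullet> \<theta>) *\<^sub>R \<theta>))) (at \<theta>)"
    unfolding sgn_div_norm using assms(2)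
    by (auto intro!: derivative_eq_intros simp: algebra_simps)
  have "sgn \<theta> = \<theta>" using assms(2) by (simp add: sgn_div_norm)
  then have du: "(u has_derivative (\<lambda>h. h \<bullet> grad u (r *\<^sub>R \<theta>))) (at (r *\<^sub>R sgn \<theta>))"
    using has_derivative_grad[OF assms(1)] by simp
  have "((\<lambda>x. u (r *\<^sub>R sgn x)) has_derivative
      (\<lambda>h. (r *\<^sub>R (h - (h \<bullet> \<theta>) *\<^sub>R \<theta>)) \<bullet> grad u (r *\<^sub>R \<theta>))) (at \<theta>)"
    using diff_chain_at[OF der du] by (simp only: o_def)
  then have "((\<lambda>x. c * u (r *\<^sub>R sgn x)) has_derivative
      (\<lambda>h. c * ((r *\<^sub>R (h - (h \<bullet> \<theta>) *\<^sub>R \<theta>)) \<bullet> grad u (r *\<^sub>R \<theta>)))) (at \<theta>)"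
    by (rule has_derivative_mult_right)
  then show ?thesis
    by (simp add: gderiv_def inner_diff_left inner_diff_right inner_commute algebra_simps)
qed

lemma norm_tangential_part:
  assumes "norm \<theta> = 1"
  shows "(norm (g - (g \<bullet> \<theta>) *\<^sub>R \<theta>))\<^sup>2 = (norm g)\<^sup>2 - (g \<bullet> \<theta>)\<^sup>2"
proof -
  have "\<theta> \<bullet> \<theta> = 1" using assms by (simp add: norm_eq_1)
  then show ?thesis unfolding power2_norm_eq_inner
    by (simp add: inner_diff_left inner_diff_right inner_commute power2_eq_square algebra_simps)
qed

lemma norm_sphere_grad_emden:
  fixes u :: "real^'n \<Rightarrow> real"
  assumes "u differentiable (at (exp t *\<^sub>R \<theta>))" "norm \<theta> = 1"
  shows "(norm (sphere_grad (emden u t) \<theta>))\<^sup>2 = emden_ang u t \<theta>"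
proof -
  let ?n = "real CARD('n)" let ?g = "grad u (exp t *\<^sub>R \<theta>)"
  have "sphere_grad (emden u t) \<theta> =
      (exp ((?n - 2) / 2 * t) * exp t) *\<^sub>R (?g - (?g \<bullet> \<theta>) *\<^sub>R \<theta>)"
    unfolding sphere_grad_def emden_def by (rule grad_eqI[OF GDERIV_sgn_slice[OF assms]])
  moreover have "(exp ((?n - 2) / 2 * t) * exp t)\<^sup>2 = exp (?n * t)"
    by (simp add: exp_add[symmetric] exp_double[symmetric] power2_eq_square field_simps)
  ultimately show ?thesis
    by (simp add: power_mult_distrib emden_ang_def norm_tangential_part[OF assms(2)])
qed

lemma dirichlet_density_emden:
  fixes u :: "real^'n \<Rightarrow> real"
  shows "exp (real CARD('n) * t) * (norm (grad u (exp t *\<^sub>R \<theta>)))\<^sup>2 =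
    (emden_dt u t \<theta> - (real CARD('n) - 2) / 2 * emden u t \<theta>)\<^sup>2 + emden_ang u t \<theta>"
proof -
  have "(exp (real CARD('n) / 2 * t))\<^sup>2 = exp (real CARD('n) * t)"
    by (simp add: exp_double[symmetric])
  then show ?thesis
    by (simp add: emden_dt_def emden_ang_def power_mult_distrib algebra_simps)
qed

lemma power_density_emden:
  fixes u :: "real^'n \<Rightarrow> real"
  assumes "CARD('n) \<ge> 3"
  shows "exp (real CARD('n) * t) * \<bar>u (exp t *\<^sub>R \<theta>)\<bar> powr (2 * real CARD('n) / (real CARD('n) - 2)) =
    \<bar>emden u t \<theta>\<bar> powr (2 * real CARD('n) / (real CARD('n) - 2))"
proof -
  have "real CARD('n) - 2 > 0" using assms by simp
  then have "exp ((real CARD('n) - 2) / 2 * t) powr (2 * real CARD('n) / (real CARD('n) - 2)) =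
      exp (real CARD('n) * t)"
    by (simp add: powr_def field_simps)
  then show ?thesis by (simp add: emden_def abs_mult powr_mult)
qed

lemma mass_density_emden:
  fixes u :: "real^'n \<Rightarrow> real"
  assumes "norm \<theta> = 1"
  shows "exp (real CARD('n) * t) * ((u (exp t *\<^sub>R \<theta>))\<^sup>2 / (norm (exp t *\<^sub>R \<theta>))\<^sup>2) = (emden u t \<theta>)\<^sup>2"
proof -
  have "exp (real CARD('n) * t) / (exp t)\<^sup>2 = (exp ((real CARD('n) - 2) / 2 * t))\<^sup>2"
    by (simp add: exp_double[symmetric] exp_diff[symmetric] field_simps)
  then show ?thesis using assms
    by (simp add: emden_def power_mult_distrib field_simps)
qed

subsection \<open>Test functions away from the origin\<close>

lemma test_functions_mono: "u \<in> test_functions A \<Longrightarrow> A \<subseteq> B \<Longrightarrow> u \<in> test_functions B"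
  by (auto simp: test_functions_def)

lemma test_functions_differentiable: "u \<in> test_functions A \<Longrightarrow> u differentiable (at x)"
  by (auto simp: test_functions_def intro: smooth_on_differentiable)

lemma test_functions_continuous: "u \<in> test_functions A \<Longrightarrow> continuous_on UNIV u"
  by (auto simp: test_functions_def intro: smooth_on_continuous)

lemma test_functions_continuous_grad: "u \<in> test_functions A \<Longrightarrow> continuous_on UNIV (grad u)"
  by (auto simp: test_functions_def intro: smooth_on_continuous_grad)

lemma grad_zero_outside:
  fixes u :: "'a::euclidean_space \<Rightarrow> real"
  assumes "x \<notin> closure {x. u x \<noteq> 0}"
  shows "grad u x = 0"
proof (rule grad_eqI)
  have z: "u y = 0" if "y \<in> - closure {x. u x \<noteq> 0}" for y
    using that closure_subset[of "{x. u x \<noteq> 0}"] by blast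
  have "open (- closure {x. u x \<noteq> 0})" "x \<in> - closure {x. u x \<noteq> 0}"
    using assms by (blast intro: open_Compl closed_closure)+
  then have "GDERIV u x :> 0 \<longleftrightarrow> GDERIV (\<lambda>x. 0) x :> 0"
    by (rule GDERIV_cong_open) (rule z)
  then show "GDERIV u x :> 0" by (simp only: GDERIV_const)
qed

text \<open>The support is compact and avoids the origin, so it lies in a spherical shell; hence everything below is
  supported in a compact part of the cylinder.\<close>

lemma test_functions_annulus:
  fixes u :: "'a::euclidean_space \<Rightarrow> real"
  assumes "u \<in> test_functions (- {0})"
  obtains a b :: real where
    "\<And>t \<theta>. norm \<theta> = 1 \<Longrightarrow> t \<notin> {a..b} \<Longrightarrow> exp t *\<^sub>R \<theta> \<notin> closure {x. u x \<noteq> 0}"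
proof (cases "closure {x. u x \<noteq> 0} = {}")
  case False
  define K where "K = closure {x. u x \<noteq> 0}"
  have K: "compact K" "K \<subseteq> - {0}" "K \<noteq> {}"
    using assms False by (auto simp: test_functions_def K_def)
  have "continuous_on K (\<lambda>x. ln (norm x))"
    using K by (intro continuous_intros) auto
  then have "bounded ((\<lambda>x. ln (norm x)) ` K)"
    using K(1) compact_continuous_image compact_imp_bounded by blast
  then obtain B where B: "\<And>x. x \<in> K \<Longrightarrow> \<bar>ln (norm x)\<bar> \<le> B"
    unfolding bounded_iff by auto
  show ?thesis
  proof (rule that[of "-\<bar>B\<bar>" "\<bar>B\<bar>"])
    fix t and \<theta> :: 'a assume "norm \<theta> = 1" "t \<notin> {-\<bar>B\<bar>..\<bar>B\<bar>}"
    then show "exp t *\<^sub>R \<theta> \<notin> closure {x. u x \<noteq> 0}"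
      using B[of "exp t *\<^sub>R \<theta>"] by (auto simp: K_def)
  qed
qed (use that[of 0 0] in auto)

lemma emden_zero_outside:
  fixes u :: "real^'n \<Rightarrow> real"
  assumes "exp t *\<^sub>R \<theta> \<notin> closure {x. u x \<noteq> 0}"
  shows "emden u t \<theta> = 0" "emden_dt u t \<theta> = 0" "emden_ang u t \<theta> = 0"
proof -
  have "u (exp t *\<^sub>R \<theta>) = 0"
    using assms closure_subset[of "{x. u x \<noteq> 0}"] by auto
  with grad_zero_outside[OF assms]
  show "emden u t \<theta> = 0" "emden_dt u t \<theta> = 0" "emden_ang u t \<theta> = 0"
    by (simp_all add: emden_def emden_dt_def emden_ang_def)
qed

lemma integrable_cylinder_continuous:
  fixes F :: "real \<times> (real^'n) \<Rightarrow> real"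
  assumes "continuous_on UNIV F"
    and "\<And>t \<theta>. norm \<theta> = 1 \<Longrightarrow> t \<notin> {a..b} \<Longrightarrow> F (t, \<theta>) = 0"
  shows "integrable cylinder_measure F"
proof -
  have "compact ({a..b} \<times> sphere (0::real^'n) 1)" by (intro compact_Times) auto
  then have "bounded (F ` ({a..b} \<times> sphere 0 1))"
    using assms(1) continuous_on_subset compact_continuous_image compact_imp_bounded by blast
  then obtain B where B: "\<And>z. z \<in> {a..b} \<times> sphere 0 1 \<Longrightarrow> \<bar>F z\<bar> \<le> B"
    unfolding bounded_iff by auto
  show ?thesis
  proof (rule integrable_cylinderI[of F a b B])
    show "F \<in> borel_measurable borel"
      using assms(1) by (rule borel_measurable_continuous_onI)
  qed (use B assms(2) in auto)
qed

lemma continuous_on_emden [continuous_intros]: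
  assumes "u \<in> test_functions (- {0})" "continuous_on S f" "continuous_on S g"
  shows "continuous_on S (\<lambda>x. emden u (f x) (g x))"
    and "continuous_on S (\<lambda>x. emden_dt u (f x) (g x))"
    and "continuous_on S (\<lambda>x. emden_ang u (f x) (g x))"
proof -
  have 1: "continuous_on S (\<lambda>x. u (exp (f x) *\<^sub>R g x))"
    by (rule continuous_on_compose2[OF test_functions_continuous[OF assms(1)]])
      (auto intro!: continuous_intros assms)
  have 2: "continuous_on S (\<lambda>x. grad u (exp (f x) *\<^sub>R g x))"
    by (rule continuous_on_compose2[OF test_functions_continuous_grad[OF assms(1)]])
      (auto intro!: continuous_intros assms)
  show 3: "continuous_on S (\<lambda>x. emden u (f x) (g x))"
    unfolding emden_def by (intro continuous_intros assms 1)
  show "continuous_on S (\<lambda>x. emden_dt u (f x) (g x))"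
    unfolding emden_dt_def by (intro continuous_intros assms 2 3)
  show "continuous_on S (\<lambda>x. emden_ang u (f x) (g x))"
    unfolding emden_ang_def by (intro continuous_intros assms 2)
qed

lemma integrable_emden:
  fixes u :: "real^'n \<Rightarrow> real"
  assumes "u \<in> test_functions (- {0})"
  shows "integrable cylinder_measure (\<lambda>(t, \<theta>). (emden u t \<theta>)\<^sup>2)"
    and "integrable cylinder_measure (\<lambda>(t, \<theta>). (emden_dt u t \<theta>)\<^sup>2)"
    and "integrable cylinder_measure (\<lambda>(t, \<theta>). emden u t \<theta> * emden_dt u t \<theta>)"
    and "integrable cylinder_measure (\<lambda>(t, \<theta>). emden_ang u t \<theta>)"
proof -
  from test_functions_annulus[OF assms] obtain a b where
    ab: "\<And>t \<theta>. norm \<theta> = 1 \<Longrightarrow> t \<notin> {a..b} \<Longrightarrow> exp t *\<^sub>R \<theta> \<notin> closure {x. u x \<noteq> 0}" by metis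
  note z = emden_zero_outside[OF ab]
  show "integrable cylinder_measure (\<lambda>(t, \<theta>). (emden u t \<theta>)\<^sup>2)"
    by (rule integrable_cylinder_continuous[of _ a b])
      (auto simp: case_prod_unfold z intro!: continuous_intros assms)
  show "integrable cylinder_measure (\<lambda>(t, \<theta>). (emden_dt u t \<theta>)\<^sup>2)"
    by (rule integrable_cylinder_continuous[of _ a b])
      (auto simp: case_prod_unfold z intro!: continuous_intros assms)
  show "integrable cylinder_measure (\<lambda>(t, \<theta>). emden u t \<theta> * emden_dt u t \<theta>)"
    by (rule integrable_cylinder_continuous[of _ a b])
      (auto simp: case_prod_unfold z intro!: continuous_intros assms)
  show "integrable cylinder_measure (\<lambda>(t, \<theta>). emden_ang u t \<theta>)"
    by (rule integrable_cylinder_continuous[of _ a b])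
      (auto simp: case_prod_unfold z intro!: continuous_intros assms)
qed

lemma integral_mult_derivative_eq_0:
  fixes f f' :: "real \<Rightarrow> real"
  assumes "\<And>t. (f has_real_derivative f' t) (at t)" "continuous_on UNIV f'"
    and "\<And>t. t \<notin> {a..b} \<Longrightarrow> f t = 0"
  shows "(LINT t|lborel. f t * f' t) = 0"
proof -
  define c d where "c = min a b - 1" and "d = max a b + 1"
  have f: "continuous_on UNIV f"
    using assms(1) by (auto intro!: continuous_at_imp_continuous_on DERIV_isCont)
  have z: "f c = 0" "f d = 0" by (auto intro!: assms(3) simp: c_def d_def)
  have "(LINT t|lborel. f t * f' t) = (LINT t|lborel. (f t * f' t) * indicator {c..d} t)"
  proof (intro Bochner_Integration.integral_cong refl)
    fix t
    show "f t * f' t = (f t * f' t) * indicator {c..d} t"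
    proof (cases "t \<in> {a..b}")
      case True
      then have "t \<in> {c..d}" by (auto simp: c_def d_def)
      then show ?thesis by simp
    qed (simp add: assms(3))
  qed
  also have "\<dots> = (f d)\<^sup>2 / 2 - (f c)\<^sup>2 / 2"
  proof (rule integral_FTC_Icc_real)
    show "((\<lambda>t. (f t)\<^sup>2 / 2) has_real_derivative f t * f' t) (at t)" for t
      using assms(1)[of t] by (auto intro!: derivative_eq_intros)
    show "isCont (\<lambda>t. f t * f' t) t" for t
      using continuous_on_mult[OF f assms(2)] by (simp add: continuous_on_eq_continuous_at)
  qed (simp add: c_def d_def)
  finally show ?thesis using z by simp
qed

text \<open>On each ray the integrand is the derivative of half the square of a function with compact support.\<close>

lemma integral_emden_mult_dt:
  fixes u :: "real^'n \<Rightarrow> real"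
  assumes "u \<in> test_functions (- {0})"
  shows "(LINT (t, \<theta>)|cylinder_measure. emden u t \<theta> * emden_dt u t \<theta>) = 0"
proof -
  from test_functions_annulus[OF assms] obtain a b where
    ab: "\<And>t \<theta>. norm \<theta> = 1 \<Longrightarrow> t \<notin> {a..b} \<Longrightarrow> exp t *\<^sub>R \<theta> \<notin> closure {x. u x \<noteq> 0}" by metis
  have "(LINT (t, \<theta>)|cylinder_measure. emden u t \<theta> * emden_dt u t \<theta>) =
      (LINT \<theta>|surface_measure. LINT t|lborel. emden u t \<theta> * emden_dt u t \<theta>)"
    by (rule cylinder.integral_snd[OF integrable_emden(3)[OF assms], symmetric])
  also have "\<dots> = (LINT \<theta>|(surface_measure :: (real^'n) measure). 0)"
  proof (rule integral_cong_AE)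
    show "AE \<theta> in surface_measure. (LINT t|lborel. emden u t \<theta> * emden_dt u t \<theta>) = 0"
      using AE_surface_measure_norm
    proof eventually_elim
      case (elim \<theta>)
      show ?case
      proof (rule integral_mult_derivative_eq_0[of _ _ a b])
        show "((\<lambda>t. emden u t \<theta>) has_real_derivative emden_dt u t \<theta>) (at t)" for t
          by (rule DERIV_emden[OF test_functions_differentiable[OF assms]])
        show "continuous_on UNIV (\<lambda>t. emden_dt u t \<theta>)"
          by (intro continuous_intros assms)
      qed (use emden_zero_outside[OF ab[OF elim]] in auto)
    qed
    show "(\<lambda>\<theta>. LINT t|lborel. emden u t \<theta> * emden_dt u t \<theta>) \<in> borel_measurable surface_measure"
      using cylinder.integrable_snd[OF integrable_emden(3)[OF assms]] by (rule borel_measurable_integrable)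
  qed simp
  finally show ?thesis by simp
qed

text \<open>Expanding the square in \<open>dirichlet_density_emden\<close> leaves a mixed term, which integrates to zero.
  The mass term on the right is exactly the one that Hardy's constant removes.\<close>

lemma dirichlet_integral_emden:
  fixes u :: "real^'n \<Rightarrow> real"
  assumes "u \<in> test_functions (- {0})"
  shows "(LINT x|lborel. (norm (grad u x))\<^sup>2) =
    (LINT (t, \<theta>)|cylinder_measure. (emden_dt u t \<theta>)\<^sup>2) +
    ((real CARD('n) - 2) / 2)\<^sup>2 * (LINT (t, \<theta>)|cylinder_measure. (emden u t \<theta>)\<^sup>2) +
    (LINT (t, \<theta>)|cylinder_measure. emden_ang u t \<theta>)"
proof -
  define a where "a = (real CARD('n) - 2) / 2"
  have "(\<lambda>x. (norm (grad u x))\<^sup>2) \<in> borel_measurable borel"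
    by (intro borel_measurable_continuous_onI continuous_intros test_functions_continuous_grad[OF assms])
  from polar_integral[OF this]
  have "(LINT x|lborel. (norm (grad u x))\<^sup>2) = (LINT z|cylinder_measure.
      (emden_dt u (fst z) (snd z))\<^sup>2 + a\<^sup>2 * (emden u (fst z) (snd z))\<^sup>2 +
      emden_ang u (fst z) (snd z) - 2 * a * (emden u (fst z) (snd z) * emden_dt u (fst z) (snd z)))"
    by (simp add: dirichlet_density_emden a_def[symmetric])
      (simp add: power2_diff power_mult_distrib algebra_simps)
  also have "\<dots> = (LINT z|cylinder_measure. (emden_dt u (fst z) (snd z))\<^sup>2) +
      a\<^sup>2 * (LINT z|cylinder_measure. (emden u (fst z) (snd z))\<^sup>2) +
      (LINT z|cylinder_measure. emden_ang u (fst z) (snd z)) -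
      2 * a * (LINT z|cylinder_measure. emden u (fst z) (snd z) * emden_dt u (fst z) (snd z))"
    using integrable_emden[OF assms] by (simp add: case_prod_unfold)
  also have "(LINT z|cylinder_measure. emden u (fst z) (snd z) * emden_dt u (fst z) (snd z)) = 0"
    using integral_emden_mult_dt[OF assms] by (simp add: case_prod_unfold)
  finally show ?thesis by (simp add: case_prod_unfold a_def)
qed

lemma hardy_integral_emden:
  fixes u :: "real^'n \<Rightarrow> real"
  assumes "u \<in> test_functions (- {0})"
  shows "(LINT x|lborel. (u x)\<^sup>2 / (norm x)\<^sup>2) = (LINT (t, \<theta>)|cylinder_measure. (emden u t \<theta>)\<^sup>2)"
proof -
  have [measurable]: "u \<in> borel_measurable borel"
    by (intro borel_measurable_continuous_onI test_functions_continuous[OF assms])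
  have "(LINT x|lborel. (u x)\<^sup>2 / (norm x)\<^sup>2) = (LINT z|cylinder_measure.
      exp (real CARD('n) * fst z) * ((u (exp (fst z) *\<^sub>R snd z))\<^sup>2 / (norm (exp (fst z) *\<^sub>R snd z))\<^sup>2))"
    by (rule polar_integral) measurable
  also have "\<dots> = (LINT z|cylinder_measure. (emden u (fst z) (snd z))\<^sup>2)"
  proof (rule integral_cong_AE)
    show "(\<lambda>z. (emden u (fst z) (snd z))\<^sup>2) \<in> borel_measurable cylinder_measure"
      using borel_measurable_integrable[OF integrable_emden(1)[OF assms]] by (simp add: case_prod_unfold)
    show "AE z in cylinder_measure. exp (real CARD('n) * fst z) *
        ((u (exp (fst z) *\<^sub>R snd z))\<^sup>2 / (norm (exp (fst z) *\<^sub>R snd z))\<^sup>2) = (emden u (fst z) (snd z))\<^sup>2"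
      using AE_cylinder_norm by eventually_elim (rule mass_density_emden)
  qed measurable
  finally show ?thesis by (simp add: case_prod_unfold)
qed

lemma power_integral_emden:
  fixes u :: "real^'n \<Rightarrow> real"
  assumes "CARD('n) \<ge> 3" "u \<in> test_functions (- {0})"
    and [measurable]: "w \<in> borel_measurable borel"
  shows "(LINT x|lborel. w (ln (norm x)) * \<bar>u x\<bar> powr (2 * real CARD('n) / (real CARD('n) - 2))) =
    (LINT (t, \<theta>)|cylinder_measure. w t * \<bar>emden u t \<theta>\<bar> powr (2 * real CARD('n) / (real CARD('n) - 2)))"
proof -
  let ?p = "2 * real CARD('n) / (real CARD('n) - 2)"
  have [measurable]: "u \<in> borel_measurable borel"
    by (intro borel_measurable_continuous_onI test_functions_continuous[OF assms(2)])
  have "(LINT x|lborel. w (ln (norm x)) * \<bar>u x\<bar> powr ?p) = (LINT z|cylinder_measure.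
      exp (real CARD('n) * fst z) * (w (ln (norm (exp (fst z) *\<^sub>R snd z))) * \<bar>u (exp (fst z) *\<^sub>R snd z)\<bar> powr ?p))"
    by (rule polar_integral) measurable
  also have "\<dots> = (LINT z|cylinder_measure. w (fst z) * \<bar>emden u (fst z) (snd z)\<bar> powr ?p)"
  proof (rule integral_cong_AE)
    show "AE z in cylinder_measure. exp (real CARD('n) * fst z) *
        (w (ln (norm (exp (fst z) *\<^sub>R snd z))) * \<bar>u (exp (fst z) *\<^sub>R snd z)\<bar> powr ?p) =
        w (fst z) * \<bar>emden u (fst z) (snd z)\<bar> powr ?p"
      using AE_cylinder_norm
      by eventually_elim (simp add: power_density_emden[OF assms(1), symmetric])
    show "(\<lambda>z. w (fst z) * \<bar>emden u (fst z) (snd z)\<bar> powr ?p) \<in> borel_measurable cylinder_measure"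
      unfolding emden_def by measurable
  qed measurable
  finally show ?thesis by (simp add: case_prod_unfold)
qed

subsection \<open>Truncated cones\<close>

lemma trunc_cone_eq: "trunc_cone \<Sigma> = {x. x \<noteq> 0 \<and> sgn x \<in> \<Sigma> \<and> norm x < 1}"
  by (simp add: trunc_cone_def sgn_div_norm)

lemma test_functions_trunc_cone: "u \<in> test_functions (trunc_cone \<Sigma>) \<Longrightarrow> u \<in> test_functions (- {0})"
  by (erule test_functions_mono) (auto simp: trunc_cone_def)

lemma set_integral_eq_integral_zero_outside:
  fixes f :: "'a \<Rightarrow> real"
  assumes "\<And>x. x \<notin> A \<Longrightarrow> f x = 0"
  shows "(LINT x:A|M. f x) = (LINT x|M. f x)"
  unfolding set_lebesgue_integral_def
  by (intro Bochner_Integration.integral_cong) (auto simp: indicator_def assms)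

lemma hardy_sobolev_emden:
  fixes \<Sigma> :: "(real^'n) set"
  assumes n: "CARD('n) \<ge> 3"
  shows "hardy_sobolev \<Sigma> q C \<longleftrightarrow> (\<forall>u \<in> test_functions (trunc_cone \<Sigma>).
      \<mu>\<^sub>1 \<Sigma> * (LINT (t, \<theta>)|cylinder_measure. (emden u t \<theta>)\<^sup>2) +
      C * (LINT (t, \<theta>)|cylinder_measure. (1 / (1 - t)) powr q *
             \<bar>emden u t \<theta>\<bar> powr (2 * real CARD('n) / (real CARD('n) - 2)))
          powr ((real CARD('n) - 2) / real CARD('n))
      \<le> (LINT (t, \<theta>)|cylinder_measure. (emden_dt u t \<theta>)\<^sup>2) +
         (LINT (t, \<theta>)|cylinder_measure. emden_ang u t \<theta>))"
  unfolding hardy_sobolev_def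
proof (rule ball_cong[OF refl])
  fix u :: "real^'n \<Rightarrow> real"
  assume u: "u \<in> test_functions (trunc_cone \<Sigma>)"
  note u' = test_functions_trunc_cone[OF u]
  have z: "u x = 0" "grad u x = 0" if "x \<notin> trunc_cone \<Sigma>" for x
  proof -
    have "x \<notin> closure {x. u x \<noteq> 0}" using u that by (auto simp: test_functions_def)
    then show "u x = 0" "grad u x = 0"
      using grad_zero_outside closure_subset[of "{x. u x \<noteq> 0}"] by auto
  qed
  have 1: "(LINT x:trunc_cone \<Sigma>|lborel. (norm (grad u x))\<^sup>2) = (LINT x|lborel. (norm (grad u x))\<^sup>2)"
    by (rule set_integral_eq_integral_zero_outside) (simp add: z)
  have 2: "(LINT x:trunc_cone \<Sigma>|lborel. (u x)\<^sup>2 / (norm x)\<^sup>2) = (LINT x|lborel. (u x)\<^sup>2 / (norm x)\<^sup>2)"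
    by (rule set_integral_eq_integral_zero_outside) (simp add: z)
  have 3: "(LINT x:trunc_cone \<Sigma>|lborel. X\<^sub>1 (norm x) powr q *
        \<bar>u x\<bar> powr (2 * real CARD('n) / (real CARD('n) - 2))) =
      (LINT x|lborel. X\<^sub>1 (norm x) powr q * \<bar>u x\<bar> powr (2 * real CARD('n) / (real CARD('n) - 2)))"
    by (rule set_integral_eq_integral_zero_outside) (simp add: z)
  show "(LINT x:trunc_cone \<Sigma>|lborel. (norm (grad u x))\<^sup>2) \<ge>
      ((real CARD('n) - 2)\<^sup>2 / 4 + \<mu>\<^sub>1 \<Sigma>) * (LINT x:trunc_cone \<Sigma>|lborel. (u x)\<^sup>2 / (norm x)\<^sup>2) +
      C * (LINT x:trunc_cone \<Sigma>|lborel. X\<^sub>1 (norm x) powr q *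
            \<bar>u x\<bar> powr (2 * real CARD('n) / (real CARD('n) - 2))) powr ((real CARD('n) - 2) / real CARD('n))
    \<longleftrightarrow> \<mu>\<^sub>1 \<Sigma> * (LINT (t, \<theta>)|cylinder_measure. (emden u t \<theta>)\<^sup>2) +
      C * (LINT (t, \<theta>)|cylinder_measure. (1 / (1 - t)) powr q *
             \<bar>emden u t \<theta>\<bar> powr (2 * real CARD('n) / (real CARD('n) - 2)))
          powr ((real CARD('n) - 2) / real CARD('n))
      \<le> (LINT (t, \<theta>)|cylinder_measure. (emden_dt u t \<theta>)\<^sup>2) +
         (LINT (t, \<theta>)|cylinder_measure. emden_ang u t \<theta>)"
    unfolding 1 2 3 dirichlet_integral_emden[OF u'] hardy_integral_emden[OF u']
    using power_integral_emden[OF n u', of "\<lambda>t. (1 / (1 - t)) powr q"]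
    by (simp add: X\<^sub>1_def power_divide algebra_simps)
qed

text \<open>It is through the slices that the first eigenvalue of $\Sigma$ acts on functions in the cone.\<close>

lemma emden_slice_sphere_test_functions:
  fixes u :: "real^'n \<Rightarrow> real"
  assumes "u \<in> test_functions (trunc_cone \<Sigma>)"
  shows "emden u t \<in> sphere_test_functions \<Sigma>"
proof -
  define K where "K = closure {x. u x \<noteq> 0}"
  have K: "closed K" "K \<subseteq> trunc_cone \<Sigma>" "smooth_on UNIV u"
    using assms by (auto simp: test_functions_def K_def)
  have "smooth_on (- {0}) (\<lambda>x. emden u t (sgn x))"
    unfolding emden_def
  proof (intro smooth_on_mult smooth_on_const smooth_on_compose[OF _ _ _ _ K(3)])
    show "smooth_on (- {0}) (\<lambda>x. (exp t *\<^sub>R sgn x) \<bullet> c)" for c :: "real^'n"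
      using smooth_on_mult[OF _ smooth_on_const smooth_on_sgn, of "exp t" c]
      by (simp add: open_Compl)
  qed auto
  moreover have "closure {\<theta> \<in> sphere 0 1. emden u t \<theta> \<noteq> 0} \<subseteq> \<Sigma>"
  proof
    fix \<theta> assume \<theta>: "\<theta> \<in> closure {\<theta> \<in> sphere 0 1. emden u t \<theta> \<noteq> 0}"
    have "closed (sphere 0 1 \<inter> (\<lambda>\<theta>. exp t *\<^sub>R \<theta>) -` K)"
      by (intro closed_Int closed_sphere closed_vimage K continuous_intros)
    moreover have "{\<theta> \<in> sphere 0 1. emden u t \<theta> \<noteq> 0} \<subseteq> sphere 0 1 \<inter> (\<lambda>\<theta>. exp t *\<^sub>R \<theta>) -` K"
      using closure_subset[of "{x. u x \<noteq> 0}"] by (auto simp: emden_def K_def)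
    ultimately have "\<theta> \<in> sphere 0 1 \<inter> (\<lambda>\<theta>. exp t *\<^sub>R \<theta>) -` K"
      using \<theta> closure_minimal by blast
    then have "norm \<theta> = 1" "exp t *\<^sub>R \<theta> \<in> trunc_cone \<Sigma>" using K(2) by auto
    then show "\<theta> \<in> \<Sigma>" by (simp add: trunc_cone_def)
  qed
  ultimately show ?thesis by (simp add: sphere_test_functions_def)
qed


section \<open>The Sobolev inequality\<close>

text \<open>The $m$-th root with the value $\infty$ at $\infty$, so that products of roots of integrals make sense
  for nonnegative functions that need not be integrable.\<close>

definition eroot :: "nat \<Rightarrow> ennreal \<Rightarrow> ennreal" where
  "eroot m x = (if x = top then top else ennreal (enn2real x powr (1 / real m)))"

lemma eroot_ennreal: "r \<ge> 0 \<Longrightarrow> eroot m (ennreal r) = ennreal (r powr (1 / real m))"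
  by (simp add: eroot_def)

lemma eroot_top [simp]: "eroot m top = top"
  by (simp add: eroot_def)

lemma eroot_0 [simp]: "eroot m 0 = 0"
  by (simp add: eroot_def)

lemma eroot_eq_0_iff: "eroot m x = 0 \<longleftrightarrow> x = 0"
  by (cases x) (auto simp: eroot_ennreal ennreal_eq_0_iff)

lemma eroot_mono:
  assumes "x \<le> y"
  shows "eroot m x \<le> eroot m y"
proof (cases y)
  case (real r)
  with assms obtain s where "x = ennreal s" "s \<ge> 0" "s \<le> r"
    by (cases x) (auto simp: top_unique)
  then show ?thesis using real by (auto simp: eroot_ennreal intro!: ennreal_leI powr_mono2)
qed simp

lemma measurable_eroot [measurable]: "eroot m \<in> borel_measurable borel"
  unfolding eroot_def by measurable

text \<open>The inequality between the arithmetic and the geometric mean of the quotients $a_i / G_i$. The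
  weights are free, so that they can later be taken to be the integrals of the factors.\<close>

lemma prod_eroot_le_weighted_sum:
  assumes J: "finite J" "card J = m" "m > 0" and G: "\<And>i. i \<in> J \<Longrightarrow> G i > 0"
  shows "(\<Prod>i\<in>J. eroot m (a i)) \<le>
    ennreal (\<Prod>i\<in>J. G i powr (1 / real m)) * (\<Sum>i\<in>J. ennreal (1 / (real m * G i)) * a i)"
proof (cases "\<exists>i\<in>J. a i = top")
  case True
  then obtain k where k: "k \<in> J" "a k = top" by blast
  have "ennreal (1 / (real m * G k)) * a k = top"
    using k G[of k] J by (simp add: ennreal_mult_eq_top_iff)
  then have "(\<Sum>i\<in>J. ennreal (1 / (real m * G i)) * a i) = top"
    using k J(1) by (subst sum.remove[of _ k]) auto
  moreover have "(\<Prod>i\<in>J. G i powr (1 / real m)) > 0"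
    using G by (intro prod_pos) fastforce
  ultimately have "ennreal (\<Prod>i\<in>J. G i powr (1 / real m)) *
      (\<Sum>i\<in>J. ennreal (1 / (real m * G i)) * a i) = top"
    by (simp add: ennreal_mult_eq_top_iff)
  then show ?thesis by simp
next
  case False
  define r where "r i = enn2real (a i)" for i
  have a: "a i = ennreal (r i)" "r i \<ge> 0" if "i \<in> J" for i
    using False that by (auto simp: r_def less_top)
  have "(\<Prod>i\<in>J. r i / G i) powr (1 / real m) \<le> (\<Sum>i\<in>J. r i / G i) / real m"
  proof -
    have "(\<Prod>i\<in>J. r i / G i) powr (1 / card J) \<le> (\<Sum>i\<in>J. (r i / G i) / card J)"
      using J G a by (intro arith_geom_mean) (auto intro: divide_nonneg_pos)
    then show ?thesis using J by (simp add: sum_divide_distrib)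
  qed
  moreover have "(\<Prod>i\<in>J. r i powr (1 / real m)) =
      (\<Prod>i\<in>J. G i powr (1 / real m)) * (\<Prod>i\<in>J. r i / G i) powr (1 / real m)"
  proof -
    have "(\<Prod>i\<in>J. r i powr (1 / real m)) = (\<Prod>i\<in>J. G i powr (1 / real m) * (r i / G i) powr (1 / real m))"
    proof (rule prod.cong[OF refl])
      fix i assume "i \<in> J"
      with G[of i] a(2)[of i] show "r i powr (1 / real m) = G i powr (1 / real m) * (r i / G i) powr (1 / real m)"
        by (simp add: powr_mult[symmetric])
    qed
    also have "\<dots> = (\<Prod>i\<in>J. G i powr (1 / real m)) * (\<Prod>i\<in>J. (r i / G i) powr (1 / real m))"
      by (rule prod.distrib)
    also have "(\<Prod>i\<in>J. (r i / G i) powr (1 / real m)) = (\<Prod>i\<in>J. r i / G i) powr (1 / real m)"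
      by (rule prod_powr_distrib[symmetric])
    finally show ?thesis .
  qed
  ultimately have le: "(\<Prod>i\<in>J. r i powr (1 / real m)) \<le>
      (\<Prod>i\<in>J. G i powr (1 / real m)) * (\<Sum>i\<in>J. 1 / (real m * G i) * r i)"
    by (auto intro!: mult_left_mono prod_nonneg simp: sum_divide_distrib mult.commute)
  have "(\<Prod>i\<in>J. eroot m (a i)) = ennreal (\<Prod>i\<in>J. r i powr (1 / real m))"
    using a by (subst prod_ennreal[symmetric]) (auto intro!: prod.cong simp: eroot_ennreal)
  also have "\<dots> \<le> ennreal ((\<Prod>i\<in>J. G i powr (1 / real m)) * (\<Sum>i\<in>J. 1 / (real m * G i) * r i))"
    using le by (rule ennreal_leI)
  also have "\<dots> = ennreal (\<Prod>i\<in>J. G i powr (1 / real m)) * ennreal (\<Sum>i\<in>J. 1 / (real m * G i) * r i)"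
    by (rule ennreal_mult') (auto intro: prod_nonneg)
  also have "ennreal (\<Sum>i\<in>J. 1 / (real m * G i) * r i) = (\<Sum>i\<in>J. ennreal (1 / (real m * G i) * r i))"
    using a(2) G by (intro sum_ennreal[symmetric]) (auto intro!: divide_nonneg_pos mult_nonneg_nonneg simp: less_imp_le)
  also have "\<dots> = (\<Sum>i\<in>J. ennreal (1 / (real m * G i)) * a i)"
  proof (rule sum.cong[OF refl])
    fix i assume i: "i \<in> J"
    have "0 \<le> 1 / (real m * G i)" using G[OF i] by (simp add: less_imp_le)
    from ennreal_mult[OF this a(2)[OF i]]
    show "ennreal (1 / (real m * G i) * r i) = ennreal (1 / (real m * G i)) * a i"
      by (simp only: a(1)[OF i])
  qed
  finally show ?thesis .
qed

text \<open>Integrate \<open>prod_eroot_le_weighted_sum\<close> with $G_i = \int g_i$: the sum on the right becomes $1$. The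
  cases in which some integral is $0$ or $\infty$ are those without admissible weights.\<close>

lemma nn_integral_Hoelder_prod:
  assumes J: "finite J" "card J = m" "m > 0"
    and [measurable]: "\<And>i. i \<in> J \<Longrightarrow> g i \<in> borel_measurable M"
  shows "(\<integral>\<^sup>+x. (\<Prod>i\<in>J. eroot m (g i x)) \<partial>M) \<le> (\<Prod>i\<in>J. eroot m (\<integral>\<^sup>+x. g i x \<partial>M))"
proof (cases "\<exists>i\<in>J. (\<integral>\<^sup>+x. g i x \<partial>M) = 0")
  case True
  then obtain k where k: "k \<in> J" "(\<integral>\<^sup>+x. g k x \<partial>M) = 0" by blast
  then have "AE x in M. g k x = 0" by (simp add: nn_integral_0_iff_AE)
  then have "AE x in M. (\<Prod>i\<in>J. eroot m (g i x)) = 0"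
  proof eventually_elim
    case (elim x)
    then show ?case using k J by (auto simp: prod_zero_iff eroot_eq_0_iff)
  qed
  then have "(\<integral>\<^sup>+x. (\<Prod>i\<in>J. eroot m (g i x)) \<partial>M) = 0"
    using nn_integral_cong_AE[of "\<lambda>x. \<Prod>i\<in>J. eroot m (g i x)" "\<lambda>x. 0" M] by simp
  then show ?thesis by simp
next
  case False
  show ?thesis
  proof (cases "\<exists>i\<in>J. (\<integral>\<^sup>+x. g i x \<partial>M) = top")
    case True
    then have "(\<Prod>i\<in>J. eroot m (\<integral>\<^sup>+x. g i x \<partial>M)) = top"
      using False J by (auto simp: ennreal_prod_eq_top eroot_eq_0_iff intro!: bexI)
    then show ?thesis by simp
  next
    case fin: False
    define G where "G i = enn2real (\<integral>\<^sup>+x. g i x \<partial>M)" for i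
    have G: "(\<integral>\<^sup>+x. g i x \<partial>M) = ennreal (G i)" "G i > 0" if "i \<in> J" for i
      using False fin that by (auto simp: G_def less_top enn2real_positive_iff zero_less_iff_neq_zero)
    let ?P = "ennreal (\<Prod>i\<in>J. G i powr (1 / real m))"
    have "(\<integral>\<^sup>+x. (\<Prod>i\<in>J. eroot m (g i x)) \<partial>M) \<le>
        (\<integral>\<^sup>+x. ?P * (\<Sum>i\<in>J. ennreal (1 / (real m * G i)) * g i x) \<partial>M)"
      by (intro nn_integral_mono prod_eroot_le_weighted_sum J G)
    also have "\<dots> = ?P * (\<Sum>i\<in>J. ennreal (1 / (real m * G i)) * (\<integral>\<^sup>+x. g i x \<partial>M))"
      by (simp add: nn_integral_cmult nn_integral_sum)
    also have "(\<Sum>i\<in>J. ennreal (1 / (real m * G i)) * (\<integral>\<^sup>+x. g i x \<partial>M)) = (\<Sum>i\<in>J. ennreal (1 / real m))"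
    proof (rule sum.cong[OF refl])
      fix i assume i: "i \<in> J"
      show "ennreal (1 / (real m * G i)) * (\<integral>\<^sup>+x. g i x \<partial>M) = ennreal (1 / real m)"
        using G[OF i] J by (simp add: ennreal_mult'[symmetric])
    qed
    also have "\<dots> = 1"
    proof -
      have "(\<Sum>i\<in>J. ennreal (1 / real m)) = ennreal (\<Sum>i\<in>J. 1 / real m)" by (rule sum_ennreal) simp
      also have "(\<Sum>i\<in>J. 1 / real m) = 1" using J by simp
      finally show ?thesis by simp
    qed
    also have "?P * 1 = (\<Prod>i\<in>J. eroot m (\<integral>\<^sup>+x. g i x \<partial>M))"
      using G by (simp add: prod_ennreal[symmetric] eroot_ennreal less_imp_le)
    finally show ?thesis .
  qed
qed

subsection \<open>Integration along coordinate lines\<close>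

text \<open>Iterated over a list of basis vectors, this integrates over the coordinate subspace through $x$ that
  they span. All functions stay functions on the whole space, which permits inductions over the
  coordinate directions.\<close>

definition lineint :: "'a::euclidean_space \<Rightarrow> ('a \<Rightarrow> ennreal) \<Rightarrow> 'a \<Rightarrow> ennreal" where
  "lineint j F x = (\<integral>\<^sup>+y. F (x + y *\<^sub>R j) \<partial>lborel)"

lemma measurable_lineint [measurable]:
  assumes [measurable]: "F \<in> borel_measurable borel"
  shows "lineint j F \<in> borel_measurable borel"
  unfolding lineint_def by measurable

lemma measurable_foldr_lineint [measurable]:
  "F \<in> borel_measurable borel \<Longrightarrow> foldr lineint js F \<in> borel_measurable borel"
  by (induction js) auto

lemma foldr_lineint_translate: "foldr lineint js F (x + v) = foldr lineint js (\<lambda>x. F (x + v)) x"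
proof (induction js arbitrary: x)
  case (Cons j js)
  have "foldr lineint js F (x + v + y *\<^sub>R j) = foldr lineint js (\<lambda>x. F (x + v)) (x + y *\<^sub>R j)" for y
    using Cons[of "x + y *\<^sub>R j"] by (simp add: algebra_simps)
  then show ?case by (simp add: lineint_def[of j])
qed simp

text \<open>A line integral does not depend on the coordinate along which it is taken; this is what makes the
  functions \<open>lineint i A\<close> admissible in \<open>Loomis_Whitney_step\<close>.\<close>

lemma lineint_invariant:
  assumes [measurable]: "F \<in> borel_measurable borel"
  shows "lineint j F (x + c *\<^sub>R j) = lineint j F x"
proof -
  have "(\<lambda>y. F (x + y *\<^sub>R j)) \<in> borel_measurable borel" by measurable
  from nn_integral_real_affine[OF this, of 1 c] show ?thesis
    by (simp add: lineint_def algebra_simps)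
qed

lemma foldr_lineint_eq_nn_integral:
  fixes F :: "'a::euclidean_space \<Rightarrow> ennreal"
  assumes [measurable]: "F \<in> borel_measurable borel" and "distinct js"
  shows "foldr lineint js F x =
    (\<integral>\<^sup>+z. F (x + (\<Sum>b\<in>set js. z b *\<^sub>R b)) \<partial>(\<Pi>\<^sub>M b\<in>set js. lborel))"
proof -
  interpret product_sigma_finite "\<lambda>_::'a. lborel :: real measure" by standard
  show ?thesis using assms(2)
  proof (induction js arbitrary: x)
    case Nil
    show ?case using nn_integral_empty[of "\<lambda>z. F x"] by simp
  next
    case (Cons j js)
    let ?f = "\<lambda>z. F (x + (\<Sum>b\<in>insert j (set js). z b *\<^sub>R b))"
    have j: "j \<notin> set js" using Cons.prems by simp
    have f: "?f \<in> borel_measurable (\<Pi>\<^sub>M b\<in>insert j (set js). lborel)" by measurable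
    have "foldr lineint (j # js) F x =
        (\<integral>\<^sup>+y. \<integral>\<^sup>+z. F (x + y *\<^sub>R j + (\<Sum>b\<in>set js. z b *\<^sub>R b)) \<partial>(\<Pi>\<^sub>M b\<in>set js. lborel) \<partial>lborel)"
      using Cons by (simp add: lineint_def[of j])
    also have "\<dots> = (\<integral>\<^sup>+y. \<integral>\<^sup>+z. ?f (z(j := y)) \<partial>(\<Pi>\<^sub>M b\<in>set js. lborel) \<partial>lborel)"
    proof -
      have "(\<Sum>b\<in>insert j (set js). (z(j := y)) b *\<^sub>R b) = y *\<^sub>R j + (\<Sum>b\<in>set js. z b *\<^sub>R b)" for z y
        using j by (simp add: sum.insert cong: sum.cong) (intro sum.cong, auto)
      then show ?thesis by (simp only: add.assoc)
    qed
    also have "\<dots> = (\<integral>\<^sup>+z. ?f z \<partial>(\<Pi>\<^sub>M b\<in>insert j (set js). lborel))"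
      by (rule product_nn_integral_insert_rev[OF _ j f, symmetric]) simp
    finally show ?case by simp
  qed
qed

lemma foldr_lineint_basis:
  fixes F :: "'a::euclidean_space \<Rightarrow> ennreal"
  assumes [measurable]: "F \<in> borel_measurable borel" and "distinct js" "set js = Basis"
  shows "foldr lineint js F 0 = (\<integral>\<^sup>+x. F x \<partial>lborel)"
proof -
  have "(\<integral>\<^sup>+x. F x \<partial>lborel) =
      (\<integral>\<^sup>+x. F x \<partial>distr (\<Pi>\<^sub>M b\<in>Basis. lborel) borel (\<lambda>f. \<Sum>b\<in>Basis. f b *\<^sub>R b))"
    by (simp only: lborel_eq[symmetric])
  also have "\<dots> = (\<integral>\<^sup>+z. F (\<Sum>b\<in>Basis. z b *\<^sub>R b) \<partial>(\<Pi>\<^sub>M b\<in>Basis. lborel))"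
    by (subst nn_integral_distr) auto
  finally show ?thesis
    using foldr_lineint_eq_nn_integral[OF assms(1,2), of 0] assms(3) by simp
qed

text \<open>When the direction $j$ is integrated, the factor with index $j$ is constant and can be taken out; the
  remaining $N$ factors are exactly as many as Hoelder's inequality for $N$-th roots admits. In the
  factor $i$ the direction $i$ is never integrated, whence the filter.\<close>

lemma Loomis_Whitney_step:
  fixes g :: "'a::euclidean_space \<Rightarrow> 'a \<Rightarrow> ennreal"
  assumes N: "DIM('a) = Suc N" "N > 0"
    and [measurable]: "\<And>i. i \<in> Basis \<Longrightarrow> g i \<in> borel_measurable borel"
    and inv: "\<And>i x c. i \<in> Basis \<Longrightarrow> g i (x + c *\<^sub>R i) = g i x"
    and "distinct js" "set js \<subseteq> Basis"
  shows "foldr lineint js (\<lambda>x. \<Prod>i\<in>Basis. eroot N (g i x)) x \<le>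
    (\<Prod>i\<in>Basis. eroot N (foldr lineint (filter (\<lambda>j. j \<noteq> i) js) (g i) x))"
  using assms(5,6)
proof (induction js arbitrary: x)
  case (Cons j js)
  let ?G = "\<lambda>i. foldr lineint (filter (\<lambda>j. j \<noteq> i) js) (g i)"
  have j: "j \<in> Basis" "j \<notin> set js" using Cons.prems by auto
  then have fj: "filter (\<lambda>i. i \<noteq> j) js = js" by (auto simp: filter_id_conv)
  have Gj: "?G j (x + y *\<^sub>R j) = ?G j x" for y
    by (simp add: fj foldr_lineint_translate inv[OF j(1)])
  have "foldr lineint (j # js) (\<lambda>x. \<Prod>i\<in>Basis. eroot N (g i x)) x \<le>
      (\<integral>\<^sup>+y. (\<Prod>i\<in>Basis. eroot N (?G i (x + y *\<^sub>R j))) \<partial>lborel)"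
    using Cons by (simp add: lineint_def[of j] nn_integral_mono)
  also have "\<dots> = (\<integral>\<^sup>+y. eroot N (?G j x) * (\<Prod>i\<in>Basis-{j}. eroot N (?G i (x + y *\<^sub>R j))) \<partial>lborel)"
    by (intro nn_integral_cong, subst prod.remove[OF finite_Basis j(1)]) (simp only: Gj)
  also have "\<dots> = eroot N (?G j x) * (\<integral>\<^sup>+y. (\<Prod>i\<in>Basis-{j}. eroot N (?G i (x + y *\<^sub>R j))) \<partial>lborel)"
    by (rule nn_integral_cmult) measurable
  also have "\<dots> \<le> eroot N (?G j x) * (\<Prod>i\<in>Basis-{j}. eroot N (\<integral>\<^sup>+y. ?G i (x + y *\<^sub>R j) \<partial>lborel))"
    using N j by (intro mult_left_mono nn_integral_Hoelder_prod) auto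
  also have "\<dots> = eroot N (foldr lineint (filter (\<lambda>i. i \<noteq> j) (j # js)) (g j) x) *
      (\<Prod>i\<in>Basis-{j}. eroot N (foldr lineint (filter (\<lambda>j. j \<noteq> i) (j # js)) (g i) x))"
    by (intro arg_cong2[where f="(*)"] prod.cong) (auto simp: lineint_def[of j])
  also have "\<dots> = (\<Prod>i\<in>Basis. eroot N (foldr lineint (filter (\<lambda>j. j \<noteq> i) (j # js)) (g i) x))"
    by (rule prod.remove[OF finite_Basis j(1), symmetric])
  finally show ?case .
qed simp

text \<open>In \<open>Loomis_Whitney_step\<close> for the line integrals of $A$, the one direction missing in each factor is
  the one already integrated.\<close>

lemma Gagliardo_Nirenberg_lines:
  fixes A :: "'a::euclidean_space \<Rightarrow> ennreal"
  assumes N: "DIM('a) = Suc N" "N > 0" and [measurable]: "A \<in> borel_measurable borel"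
  shows "(\<integral>\<^sup>+x. (\<Prod>i\<in>Basis. eroot N (lineint i A x)) \<partial>lborel) \<le>
    (\<Prod>i\<in>(Basis :: 'a set). eroot N (\<integral>\<^sup>+x. A x \<partial>lborel))"
proof -
  obtain js :: "'a list" where js: "set js = Basis" "distinct js"
    using finite_distinct_list[OF finite_Basis] by blast
  have "(\<integral>\<^sup>+x. (\<Prod>i\<in>Basis. eroot N (lineint i A x)) \<partial>lborel) =
      foldr lineint js (\<lambda>x. \<Prod>i\<in>Basis. eroot N (lineint i A x)) 0"
    by (rule foldr_lineint_basis[symmetric]) (use js in measurable)
  also have "\<dots> \<le> (\<Prod>i\<in>Basis. eroot N (foldr lineint (filter (\<lambda>j. j \<noteq> i) js) (lineint i A) 0))"
    using js by (intro Loomis_Whitney_step N lineint_invariant) auto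
  also have "\<dots> = (\<Prod>i\<in>(Basis :: 'a set). eroot N (\<integral>\<^sup>+x. A x \<partial>lborel))"
  proof (intro prod.cong refl arg_cong[where f="eroot N"])
    fix i :: 'a assume i: "i \<in> Basis"
    have "foldr lineint (filter (\<lambda>j. j \<noteq> i) js @ [i]) A 0 = (\<integral>\<^sup>+x. A x \<partial>lborel)"
      using js i by (intro foldr_lineint_basis) auto
    then show "foldr lineint (filter (\<lambda>j. j \<noteq> i) js) (lineint i A) 0 = (\<integral>\<^sup>+x. A x \<partial>lborel)"
      by simp
  qed
  finally show ?thesis .
qed

subsection \<open>From the $L^1$ to the $L^2$ inequality\<close>

lemma DERIV_abs_powr:
  assumes "\<gamma> > 2"
  shows "((\<lambda>s. \<bar>s\<bar> powr \<gamma>) has_real_derivative \<gamma> * s * \<bar>s\<bar> powr (\<gamma> - 2)) (at s)"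
proof -
  consider "s > 0" | "s < 0" | "s = 0" by linarith
  then show ?thesis
  proof cases
    case 1
    have "((\<lambda>s. s powr \<gamma>) has_real_derivative \<gamma> * s powr (\<gamma> - 1)) (at s)"
      using 1 by (auto intro!: derivative_eq_intros)
    moreover have "\<gamma> * s powr (\<gamma> - 1) = \<gamma> * s * \<bar>s\<bar> powr (\<gamma> - 2)"
      using 1 powr_mult_base[of s "\<gamma> - 2"] by simp
    ultimately have "((\<lambda>s. s powr \<gamma>) has_real_derivative \<gamma> * s * \<bar>s\<bar> powr (\<gamma> - 2)) (at s)" by simp
    then show ?thesis
      by (rule has_field_derivative_transform_within_open[of _ _ _ "{0<..}"]) (use 1 in auto)
  next
    case 2
    have "((\<lambda>s. (- s) powr \<gamma>) has_real_derivative - (\<gamma> * (- s) powr (\<gamma> - 1))) (at s)"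
      using 2 by (auto intro!: derivative_eq_intros)
    moreover have "- (\<gamma> * (- s) powr (\<gamma> - 1)) = \<gamma> * s * \<bar>s\<bar> powr (\<gamma> - 2)"
    proof -
      have "(- s) powr (\<gamma> - 1) = (- s) * \<bar>s\<bar> powr (\<gamma> - 2)"
        using 2 powr_mult_base[of "- s" "\<gamma> - 2"] by simp
      then show ?thesis by (simp only: mult.assoc mult_minus_left mult_minus_right minus_minus)
    qed
    ultimately have "((\<lambda>s. (- s) powr \<gamma>) has_real_derivative \<gamma> * s * \<bar>s\<bar> powr (\<gamma> - 2)) (at s)" by simp
    then show ?thesis
      by (rule has_field_derivative_transform_within_open[of _ _ _ "{..<0}"]) (use 2 in auto)
  next
    case 3
    have "((\<lambda>h. h * \<bar>h\<bar> powr (\<gamma> - 2)) \<longlongrightarrow> 0 * \<bar>0\<bar> powr (\<gamma> - 2)) (at 0)"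
      using assms by (intro tendsto_intros tendsto_powr') auto
    moreover have "h * \<bar>h\<bar> powr (\<gamma> - 2) = (\<bar>0 + h\<bar> powr \<gamma> - \<bar>0::real\<bar> powr \<gamma>) / h" if "h \<noteq> 0" for h
    proof -
      have "\<bar>h\<bar> powr \<gamma> = \<bar>h\<bar> powr 2 * \<bar>h\<bar> powr (\<gamma> - 2)"
        using powr_add[of "\<bar>h\<bar>" 2 "\<gamma> - 2"] by simp
      also have "\<bar>h\<bar> powr 2 = h * h" using that by (simp add: powr_numeral power2_eq_square)
      finally show ?thesis using that assms by simp
    qed
    ultimately have "((\<lambda>h. (\<bar>0 + h\<bar> powr \<gamma> - \<bar>0::real\<bar> powr \<gamma>) / h) \<longlongrightarrow> 0) (at 0)"
      by (auto intro: Lim_transform_eventually simp: eventually_at_filter)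
    then show ?thesis using 3 by (simp add: DERIV_def)
  qed
qed

text \<open>The fundamental theorem of calculus along the line in direction $i$, starting from a point beyond
  the support.\<close>

lemma abs_powr_le_lineint:
  fixes W :: "'a::euclidean_space \<Rightarrow> real"
  assumes W: "W \<in> test_functions UNIV" and \<gamma>: "\<gamma> > 2" and i: "i \<in> Basis"
  shows "ennreal (\<bar>W x\<bar> powr \<gamma>) \<le>
    lineint i (\<lambda>x. ennreal (\<gamma> * \<bar>W x\<bar> powr (\<gamma> - 1) * norm (grad W x))) x"
proof -
  have "bounded (closure {x. W x \<noteq> 0})"
    using W by (auto simp: test_functions_def intro: compact_imp_bounded)
  then obtain R where R: "\<And>y. W y \<noteq> 0 \<Longrightarrow> norm y \<le> R"
    using closure_subset[of "{x. W x \<noteq> 0}"] unfolding bounded_iff by blast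
  \<comment> \<open>far enough out for $x + y_0 i$ to have norm greater than $R$\<close>
  define y0 where "y0 = - (norm x + \<bar>R\<bar> + 1)"
  have "norm (y0 *\<^sub>R i) \<le> norm (x + y0 *\<^sub>R i) + norm x"
    using norm_triangle_ineq4[of "x + y0 *\<^sub>R i" x] by simp
  then have "norm (x + y0 *\<^sub>R i) > R" using i by (simp add: y0_def)
  then have W0: "W (x + y0 *\<^sub>R i) = 0" using R by force
  define f' where "f' y = \<gamma> * W (x + y *\<^sub>R i) * \<bar>W (x + y *\<^sub>R i)\<bar> powr (\<gamma> - 2) *
    (i \<bullet> grad W (x + y *\<^sub>R i))" for y
  have line: "continuous_on UNIV (\<lambda>y. x + y *\<^sub>R i)" by (intro continuous_intros)
  have cont: "continuous_on UNIV f'"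
    unfolding f'_def
    using continuous_on_compose2[OF test_functions_continuous[OF W] line]
      continuous_on_compose2[OF test_functions_continuous_grad[OF W] line] \<gamma>
    by (intro continuous_intros continuous_on_powr') auto
  have der: "((\<lambda>y. \<bar>W (x + y *\<^sub>R i)\<bar> powr \<gamma>) has_real_derivative f' y) (at y)" for y
  proof -
    have l: "((\<lambda>y. x + y *\<^sub>R i) has_derivative (\<lambda>h. h *\<^sub>R i)) (at y)"
      by (auto intro!: derivative_eq_intros)
    have "((\<lambda>y. W (x + y *\<^sub>R i)) has_derivative (\<lambda>h. h *\<^sub>R i \<bullet> grad W (x + y *\<^sub>R i))) (at y)"
      using diff_chain_at[OF l has_derivative_grad[OF test_functions_differentiable[OF W]]]
      by (simp only: o_def)
    then have "((\<lambda>y. W (x + y *\<^sub>R i)) has_real_derivative i \<bullet> grad W (x + y *\<^sub>R i)) (at y)"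
      by (simp add: has_field_derivative_def mult_commute_abs)
    from DERIV_chain2[OF DERIV_abs_powr[OF \<gamma>] this] show ?thesis
      by (simp add: f'_def)
  qed
  have "(LINT y|lborel. f' y * indicator {y0..0} y) =
      \<bar>W (x + 0 *\<^sub>R i)\<bar> powr \<gamma> - \<bar>W (x + y0 *\<^sub>R i)\<bar> powr \<gamma>"
  proof (rule integral_FTC_Icc_real)
    show "isCont f' y" for y using cont by (simp add: continuous_on_eq_continuous_at)
    show "y0 \<le> 0" using norm_ge_zero[of x] abs_ge_zero[of R] unfolding y0_def by linarith
  qed (rule der)
  also have "\<dots> = \<bar>W x\<bar> powr \<gamma>" using W0 \<gamma> by simp
  finally have eq: "\<bar>W x\<bar> powr \<gamma> = (LINT y|lborel. f' y * indicator {y0..0} y)" by simp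
  have int: "integrable lborel (\<lambda>y. f' y * indicator {y0..0} y)"
    using borel_integrable_compact[of "{y0..0}" f'] continuous_on_subset[OF cont]
    by (simp add: mult.commute indicator_def if_distrib cong: if_cong)
  have "ennreal (\<bar>W x\<bar> powr \<gamma>) = ennreal (norm (LINT y|lborel. f' y * indicator {y0..0} y))"
    unfolding eq[symmetric] by simp
  also have "\<dots> \<le> (\<integral>\<^sup>+y. norm (f' y * indicator {y0..0} y) \<partial>lborel)"
    by (rule integral_norm_bound_ennreal[OF int])
  also have "\<dots> \<le> (\<integral>\<^sup>+y. ennreal (\<gamma> * \<bar>W (x + y *\<^sub>R i)\<bar> powr (\<gamma> - 1) * norm (grad W (x + y *\<^sub>R i))) \<partial>lborel)"
  proof (intro nn_integral_mono ennreal_leI)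
    fix y :: real
    have "norm (f' y * indicator {y0..0} y) \<le> \<bar>f' y\<bar>" by (auto simp: indicator_def)
    also have "\<dots> = \<gamma> * (\<bar>W (x + y *\<^sub>R i)\<bar> * \<bar>W (x + y *\<^sub>R i)\<bar> powr (\<gamma> - 2)) * \<bar>i \<bullet> grad W (x + y *\<^sub>R i)\<bar>"
      using \<gamma> by (simp add: f'_def abs_mult)
    also have "\<bar>W (x + y *\<^sub>R i)\<bar> * \<bar>W (x + y *\<^sub>R i)\<bar> powr (\<gamma> - 2) = \<bar>W (x + y *\<^sub>R i)\<bar> powr (\<gamma> - 1)"
      using powr_mult_base[of "\<bar>W (x + y *\<^sub>R i)\<bar>" "\<gamma> - 2"] by simp
    also have "\<bar>i \<bullet> grad W (x + y *\<^sub>R i)\<bar> \<le> norm (grad W (x + y *\<^sub>R i))"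
      using Basis_le_norm[OF i, of "grad W (x + y *\<^sub>R i)"] by (simp add: inner_commute)
    finally show "norm (f' y * indicator {y0..0} y) \<le>
        \<gamma> * \<bar>W (x + y *\<^sub>R i)\<bar> powr (\<gamma> - 1) * norm (grad W (x + y *\<^sub>R i))"
      using \<gamma> by (simp add: mult_left_mono)
  qed
  finally show ?thesis by (simp add: lineint_def)
qed

lemma integrable_continuous_compact_support:
  fixes f :: "'a::euclidean_space \<Rightarrow> real"
  assumes "continuous_on UNIV f" "compact K" "\<And>x. x \<notin> K \<Longrightarrow> f x = 0"
  shows "integrable lborel f"
proof -
  have "integrable lborel (\<lambda>x. indicator K x *\<^sub>R f x)"
    using borel_integrable_compact[OF assms(2) continuous_on_subset[OF assms(1)]] by simp
  moreover have "(\<lambda>x. indicator K x *\<^sub>R f x) = f" by (rule ext) (auto simp: indicator_def assms(3))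
  ultimately show ?thesis by simp
qed

text \<open>The inequality of Gagliardo and Nirenberg is applied to $|W|^\gamma$ with
  $\gamma = 2(n-1)/(n-2)$. This power turns both the left-hand side, where $\gamma n/(n-1) = p$, and the
  factor $|W|^{\gamma-1}$ of the gradient, where $2(\gamma-1) = p$, into the critical power, so that
  Young's inequality separates it from the gradient and it can be absorbed.\<close>

theorem Sobolev_inequality:
  fixes W :: "real^'n \<Rightarrow> real"
  assumes n: "CARD('n) \<ge> 3" and W: "W \<in> test_functions UNIV"
  shows "(LINT x|lborel. \<bar>W x\<bar> powr (2 * real CARD('n) / (real CARD('n) - 2)))
      powr ((real CARD('n) - 2) / real CARD('n))
    \<le> (2 * (real CARD('n) - 1) / (real CARD('n) - 2))\<^sup>2 * (LINT x|lborel. (norm (grad W x))\<^sup>2)"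
proof -
  define n where "n = real CARD('n)"
  define N where "N = CARD('n) - 1"
  define p where "p = 2 * n / (n - 2)"
  define \<gamma> where "\<gamma> = 2 * (n - 1) / (n - 2)"
  have n3: "n \<ge> 3" using n by (simp add: n_def)
  have N: "DIM(real^'n) = Suc N" "N > 0" "real N = n - 1" using n by (auto simp: N_def n_def)
  have \<gamma>: "\<gamma> > 2" using n3 by (simp add: \<gamma>_def field_simps)
  have \<gamma>p: "\<gamma> / (n - 1) * n = p" "2 * (\<gamma> - 1) = p"
  proof -
    have "n - 1 \<noteq> 0" "n - 2 \<noteq> 0" using n3 by auto
    then show "\<gamma> / (n - 1) * n = p" by (simp add: \<gamma>_def p_def divide_simps)
    show "2 * (\<gamma> - 1) = p" using \<open>n - 2 \<noteq> 0\<close> by (simp add: \<gamma>_def p_def field_simps)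
  qed
  have p: "p > 0" using n3 by (simp add: p_def)
  define K where "K = closure {x. W x \<noteq> 0}"
  have K: "compact K" "\<And>x. x \<notin> K \<Longrightarrow> W x = 0"
    using W closure_subset[of "{x. W x \<noteq> 0}"] by (auto simp: test_functions_def K_def)
  note Wc = test_functions_continuous[OF W] test_functions_continuous_grad[OF W]
  define P where "P = (LINT x|lborel. \<bar>W x\<bar> powr p)"
  define D where "D = (LINT x|lborel. (norm (grad W x))\<^sup>2)"
  define A where "A x = \<gamma> * \<bar>W x\<bar> powr (\<gamma> - 1) * norm (grad W x)" for x
  define a where "a = (LINT x|lborel. A x)"
  have intP: "integrable lborel (\<lambda>x. \<bar>W x\<bar> powr p)"
  proof (rule integrable_continuous_compact_support[OF _ K(1)])
    show "continuous_on UNIV (\<lambda>x. \<bar>W x\<bar> powr p)"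
      using p by (intro continuous_on_powr' continuous_intros Wc) auto
  qed (simp add: K(2))
  have intD: "integrable lborel (\<lambda>x. (norm (grad W x))\<^sup>2)"
  proof (rule integrable_continuous_compact_support[OF _ K(1)])
    show "continuous_on UNIV (\<lambda>x. (norm (grad W x))\<^sup>2)" by (intro continuous_intros Wc)
  qed (simp add: K_def grad_zero_outside)
  have contA: "continuous_on UNIV A"
    unfolding A_def using \<gamma> by (intro continuous_intros continuous_on_powr' Wc) auto
  have intA: "integrable lborel A"
    by (rule integrable_continuous_compact_support[OF contA K(1)]) (use \<gamma> in \<open>simp add: A_def K(2)\<close>)
  have [measurable]: "A \<in> borel_measurable borel" "W \<in> borel_measurable borel"
    using contA Wc by (auto intro: borel_measurable_continuous_onI)
  have A0: "A x \<ge> 0" for x using \<gamma> by (simp add: A_def)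
  have a0: "a \<ge> 0" and P0: "P \<ge> 0" by (auto simp: a_def P_def A0)
  have "ennreal P = (\<integral>\<^sup>+x. ennreal (\<bar>W x\<bar> powr p) \<partial>lborel)"
    unfolding P_def by (rule nn_integral_eq_integral[symmetric, OF intP]) simp
  also have "\<dots> = (\<integral>\<^sup>+x. (\<Prod>i\<in>(Basis :: (real^'n) set). eroot N (ennreal (\<bar>W x\<bar> powr \<gamma>))) \<partial>lborel)"
  proof (rule nn_integral_cong)
    fix x
    have "((\<bar>W x\<bar> powr \<gamma>) powr (1 / real N)) ^ CARD('n) = (\<bar>W x\<bar> powr \<gamma>) powr (1 / real N * n)"
    proof (cases "W x = 0")
      case False
      then have "\<bar>W x\<bar> powr \<gamma> \<noteq> 0" by simp
      from powr_power[OF this, of "1 / real N" "CARD('n)"] show ?thesis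
        by (simp only: n_def mult.commute)
    qed simp
    also have "\<dots> = \<bar>W x\<bar> powr p" using \<gamma>p by (simp add: powr_powr N)
    finally have "ennreal (\<bar>W x\<bar> powr p) = ennreal ((\<bar>W x\<bar> powr \<gamma>) powr (1 / real N)) ^ CARD('n)"
      by (simp add: ennreal_power)
    then show "ennreal (\<bar>W x\<bar> powr p) =
        (\<Prod>i\<in>(Basis :: (real^'n) set). eroot N (ennreal (\<bar>W x\<bar> powr \<gamma>)))"
      by (simp add: eroot_ennreal)
  qed
  also have "\<dots> \<le> (\<integral>\<^sup>+x. (\<Prod>i\<in>(Basis :: (real^'n) set). eroot N (lineint i (\<lambda>x. ennreal (A x)) x)) \<partial>lborel)"
    unfolding A_def
    by (intro nn_integral_mono prod_mono_ennreal eroot_mono abs_powr_le_lineint[OF W \<gamma>])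
  also have "\<dots> \<le> (\<Prod>i\<in>(Basis :: (real^'n) set). eroot N (\<integral>\<^sup>+x. ennreal (A x) \<partial>lborel))"
    by (rule Gagliardo_Nirenberg_lines[OF N(1,2)]) measurable
  also have "(\<integral>\<^sup>+x. ennreal (A x) \<partial>lborel) = ennreal a"
    unfolding a_def by (rule nn_integral_eq_integral[OF intA]) (simp add: A0)
  also have "(\<Prod>i\<in>(Basis :: (real^'n) set). eroot N (ennreal a)) = ennreal (a powr (n / (n - 1)))"
  proof (cases "a = 0")
    case False
    from powr_power[OF this, of "1 / real N" "CARD('n)"]
    have "(a powr (1 / real N)) ^ CARD('n) = a powr (n / (n - 1))"
      by (simp only: n_def N(3) times_divide_eq_right mult_1_right)
    then show ?thesis using a0 by (simp add: eroot_ennreal ennreal_power del: power_Suc)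
  qed simp
  finally have Pa: "P \<le> a powr (n / (n - 1))" by simp
  have young: "a \<le> \<gamma> / 2 * (\<epsilon> * P + D / \<epsilon>)" if "\<epsilon> > 0" for \<epsilon>
  proof -
    have "a \<le> (LINT x|lborel. \<gamma> / 2 * (\<epsilon> * (\<bar>W x\<bar> powr p) + (norm (grad W x))\<^sup>2 / \<epsilon>))"
      unfolding a_def
    proof (rule integral_mono[OF intA])
      show "integrable lborel (\<lambda>x. \<gamma> / 2 * (\<epsilon> * (\<bar>W x\<bar> powr p) + (norm (grad W x))\<^sup>2 / \<epsilon>))"
        using intP intD by simp
      fix x
      define s t where "s = \<bar>W x\<bar> powr (\<gamma> - 1)" and "t = norm (grad W x)"
      have "s\<^sup>2 = \<bar>W x\<bar> powr p" using \<gamma>p(2) by (simp add: s_def power2_eq_square powr_add[symmetric])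
      moreover have "s * t \<le> (\<epsilon> * s\<^sup>2 + t\<^sup>2 / \<epsilon>) / 2"
      proof -
        have "0 \<le> (\<epsilon> * s - t)\<^sup>2 / \<epsilon>" using that by simp
        also have "\<dots> = \<epsilon> * s\<^sup>2 + t\<^sup>2 / \<epsilon> - 2 * (s * t)"
          using that by (simp add: power2_eq_square field_simps)
        finally show ?thesis by simp
      qed
      ultimately show "A x \<le> \<gamma> / 2 * (\<epsilon> * (\<bar>W x\<bar> powr p) + (norm (grad W x))\<^sup>2 / \<epsilon>)"
        using \<gamma> by (simp add: A_def s_def[symmetric] t_def[symmetric] mult.assoc)
    qed
    also have "\<dots> = \<gamma> / 2 * (\<epsilon> * P + D / \<epsilon>)"
      using intP intD by (simp add: P_def D_def)
    finally show ?thesis .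
  qed
  have "P powr ((n - 2) / n) \<le> \<gamma>\<^sup>2 * D"
  proof (cases "P = 0")
    case True
    then show ?thesis by (simp add: D_def)
  next
    case False
    with P0 have P: "P > 0" by simp
    \<comment> \<open>With this choice the term in $P$ is half of the left-hand side.\<close>
    define \<epsilon> where "\<epsilon> = P powr ((n - 1) / n - 1) / \<gamma>"
    have \<epsilon>: "\<epsilon> > 0" using P \<gamma> by (simp add: \<epsilon>_def)
    have \<epsilon>P: "\<gamma> * \<epsilon> * P = P powr ((n - 1) / n)"
      using P \<gamma> powr_mult_base[of P "(n - 1) / n - 1"] by (simp add: \<epsilon>_def mult.commute)
    have "P powr ((n - 1) / n) \<le> (a powr (n / (n - 1))) powr ((n - 1) / n)"
      using Pa P0 n3 by (intro powr_mono2) auto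
    also have "\<dots> = a" using a0 n3 by (simp add: powr_powr)
    also have "a \<le> \<gamma> / 2 * (\<epsilon> * P + D / \<epsilon>)" by (rule young[OF \<epsilon>])
    also have "\<dots> = P powr ((n - 1) / n) / 2 + \<gamma> * D / (2 * \<epsilon>)"
      using \<epsilon>P \<epsilon> by (simp add: field_simps)
    finally have "P powr ((n - 1) / n) \<le> \<gamma> * D / \<epsilon>" using \<epsilon> by (simp add: field_simps)
    then have "P powr ((n - 1) / n) * P powr ((n - 1) / n - 1) \<le> \<gamma>\<^sup>2 * D"
      using P \<gamma> by (simp add: \<epsilon>_def field_simps power2_eq_square)
    moreover have "P powr ((n - 1) / n) * P powr ((n - 1) / n - 1) = P powr ((n - 2) / n)"
    proof -
      have "(n - 1) / n + ((n - 1) / n - 1) = (n - 2) / n" using n3 by (simp add: divide_simps)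
      then show ?thesis by (simp only: powr_add[symmetric])
    qed
    ultimately show ?thesis by simp
  qed
  then show ?thesis by (simp add: P_def D_def p_def \<gamma>_def n_def)
qed


section \<open>Test functions on the sphere\<close>

lemma open_Compl_0 [simp]: "open (- {0::'a::{zero,t1_space}})"
  by (simp add: open_Compl)

lemma sgn_unit: "norm \<theta> = 1 \<Longrightarrow> sgn \<theta> = (\<theta> :: 'a::real_normed_vector)"
  by (simp add: sgn_div_norm)

lemma sphere_test_functions_smooth:
  "\<psi> \<in> sphere_test_functions \<Sigma> \<Longrightarrow> smooth_on (- {0}) (\<lambda>x. \<psi> (sgn x))"
  by (simp add: sphere_test_functions_def)

lemma sphere_test_functions_zero:
  "\<psi> \<in> sphere_test_functions \<Sigma> \<Longrightarrow> norm \<theta> = 1 \<Longrightarrow> \<theta> \<notin> \<Sigma> \<Longrightarrow> \<psi> \<theta> = 0"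
  using closure_subset[of "{\<theta> \<in> sphere 0 1. \<psi> \<theta> \<noteq> 0}"] by (auto simp: sphere_test_functions_def)

lemma GDERIV_sphere_grad:
  fixes \<psi> :: "real^'n \<Rightarrow> real"
  assumes "\<psi> \<in> sphere_test_functions \<Sigma>" "\<theta> \<noteq> 0"
  shows "GDERIV (\<lambda>x. \<psi> (sgn x)) \<theta> :> sphere_grad \<psi> \<theta>"
  unfolding sphere_grad_def
  using smooth_on_differentiable[OF sphere_test_functions_smooth[OF assms(1)], of \<theta>] assms(2)
  by (intro GDERIV_grad) auto

lemma continuous_on_sphere_grad:
  fixes \<psi> :: "real^'n \<Rightarrow> real"
  assumes "\<psi> \<in> sphere_test_functions \<Sigma>"
  shows "continuous_on (- {0}) (sphere_grad \<psi>)"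
  using smooth_on_continuous_grad[OF sphere_test_functions_smooth[OF assms]]
  by (simp add: sphere_grad_def[abs_def])

lemma sphere_test_functions_lincomb:
  assumes "\<psi> \<in> sphere_test_functions \<Sigma>" "\<phi> \<in> sphere_test_functions \<Sigma>"
  shows "(\<lambda>\<theta>. a * \<psi> \<theta> + b * \<phi> \<theta>) \<in> sphere_test_functions \<Sigma>"
proof -
  have "smooth_on (- {0}) (\<lambda>x. a * \<psi> (sgn x) + b * \<phi> (sgn x))"
    using assms by (intro smooth_on_add smooth_on_mult smooth_on_const sphere_test_functions_smooth) auto
  moreover have "closure {\<theta> \<in> sphere 0 1. a * \<psi> \<theta> + b * \<phi> \<theta> \<noteq> 0} \<subseteq>
      closure ({\<theta> \<in> sphere 0 1. \<psi> \<theta> \<noteq> 0} \<union> {\<theta> \<in> sphere 0 1. \<phi> \<theta> \<noteq> 0})"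
    by (intro closure_mono) auto
  ultimately show ?thesis
    using assms by (auto simp: sphere_test_functions_def closure_Un)
qed

lemma sphere_grad_lincomb:
  assumes "\<psi> \<in> sphere_test_functions \<Sigma>" "\<phi> \<in> sphere_test_functions \<Sigma>" "\<theta> \<noteq> 0"
  shows "sphere_grad (\<lambda>\<theta>. a * \<psi> \<theta> + b * \<phi> \<theta>) \<theta> = a *\<^sub>R sphere_grad \<psi> \<theta> + b *\<^sub>R sphere_grad \<phi> \<theta>"
proof -
  have "GDERIV (\<lambda>x. a * \<psi> (sgn x)) \<theta> :> a *\<^sub>R sphere_grad \<psi> \<theta> + \<psi> (sgn \<theta>) *\<^sub>R 0"
    by (rule GDERIV_mult[OF GDERIV_const GDERIV_sphere_grad[OF assms(1,3)]])
  moreover have "GDERIV (\<lambda>x. b * \<phi> (sgn x)) \<theta> :> b *\<^sub>R sphere_grad \<phi> \<theta> + \<phi> (sgn \<theta>) *\<^sub>R 0"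
    by (rule GDERIV_mult[OF GDERIV_const GDERIV_sphere_grad[OF assms(2,3)]])
  ultimately have "GDERIV (\<lambda>x. a * \<psi> (sgn x) + b * \<phi> (sgn x)) \<theta> :>
      (a *\<^sub>R sphere_grad \<psi> \<theta> + \<psi> (sgn \<theta>) *\<^sub>R 0) + (b *\<^sub>R sphere_grad \<phi> \<theta> + \<phi> (sgn \<theta>) *\<^sub>R 0)"
    by (rule GDERIV_add)
  from grad_eqI[OF this] show ?thesis by (simp add: sphere_grad_def)
qed

lemma sphere_grad_cong:
  assumes "\<And>\<omega>. norm \<omega> = 1 \<Longrightarrow> \<psi> \<omega> = \<phi> \<omega>" "\<theta> \<noteq> 0"
  shows "sphere_grad \<psi> \<theta> = sphere_grad \<phi> \<theta>"
  unfolding sphere_grad_def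
  by (rule grad_cong_open[of "- {0}"]) (use assms in \<open>auto simp: norm_sgn\<close>)

lemma sphere_grad_zero:
  fixes \<psi> :: "real^'n \<Rightarrow> real"
  assumes "\<psi> \<in> sphere_test_functions \<Sigma>" "norm \<theta> = 1" "\<theta> \<notin> \<Sigma>"
  shows "sphere_grad \<psi> \<theta> = 0"
proof -
  let ?C = "closure {\<theta> \<in> sphere 0 1. \<psi> \<theta> \<noteq> 0}"
  have [simp]: "\<theta> \<noteq> 0" using assms(2) by auto
  have cont: "continuous_on (- {0}) (sgn :: real^'n \<Rightarrow> real^'n)"
    unfolding sgn_div_norm[abs_def] by (intro continuous_intros) auto
  have "open (- {0} \<inter> sgn -` (- ?C))"
    using continuous_open_preimage[OF cont open_Compl_0 open_Compl[OF closed_closure]] .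
  moreover have "\<theta> \<in> - {0} \<inter> sgn -` (- ?C)"
    using assms unfolding sphere_test_functions_def by (simp add: sgn_unit subset_iff) blast
  moreover have "\<psi> (sgn x) = 0" if "x \<in> - {0} \<inter> sgn -` (- ?C)" for x
  proof (rule ccontr)
    assume "\<psi> (sgn x) \<noteq> 0"
    then have "sgn x \<in> {\<theta> \<in> sphere 0 1. \<psi> \<theta> \<noteq> 0}" using that by (simp add: norm_sgn)
    then have "sgn x \<in> ?C" by (rule subsetD[OF closure_subset])
    then show False using that by simp
  qed
  ultimately have "sphere_grad \<psi> \<theta> = grad (\<lambda>x. 0) \<theta>"
    unfolding sphere_grad_def by (rule grad_cong_open)
  also have "\<dots> = 0" by (rule grad_eqI[OF GDERIV_const])
  finally show ?thesis .
qed

lemma measurable_sphere_test_function: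
  assumes "\<psi> \<in> sphere_test_functions \<Sigma>"
  shows "(\<lambda>x. \<psi> (sgn x)) \<in> borel_measurable borel" and "sphere_grad \<psi> \<in> borel_measurable borel"
  using smooth_on_continuous[OF sphere_test_functions_smooth[OF assms]] continuous_on_sphere_grad[OF assms]
  by (auto intro: borel_measurable_continuous_countable_exceptions[of "{0}"])

lemma integrable_surface_continuous:
  fixes f :: "real^'n \<Rightarrow> real"
  assumes "continuous_on (- {0}) f"
  shows "integrable surface_measure f"
proof -
  have "compact (f ` sphere 0 1)"
    by (rule compact_continuous_image[OF continuous_on_subset[OF assms]]) auto
  then have "bounded (f ` sphere 0 1)" by (rule compact_imp_bounded)
  then obtain B where "\<forall>y\<in>f ` sphere 0 1. norm y \<le> B"
    unfolding bounded_iff by blast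
  then have B: "\<bar>f \<theta>\<bar> \<le> B" if "norm \<theta> = 1" for \<theta> using that by simp
  have "AE \<theta> in surface_measure. norm (f \<theta>) \<le> B"
    using AE_surface_measure_norm by eventually_elim (simp add: B)
  moreover have "f \<in> borel_measurable surface_measure"
    using borel_measurable_continuous_countable_exceptions[of "{0}" f] assms by simp
  ultimately show ?thesis by (rule surface.integrable_const_bound)
qed

text \<open>The argument is normalised because the values of $\psi$ off the sphere are arbitrary, possibly not even
  measurable.\<close>

definition sphere_mass :: "(real^'n \<Rightarrow> real) \<Rightarrow> real" where
  "sphere_mass \<psi> = (LINT \<theta>|surface_measure. (\<psi> (sgn \<theta>))\<^sup>2)"

definition sphere_energy :: "(real^'n \<Rightarrow> real) \<Rightarrow> real" where
  "sphere_energy \<psi> = (LINT \<theta>|surface_measure. (norm (sphere_grad \<psi> \<theta>))\<^sup>2)"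

lemma integrable_sphere_test_functions:
  assumes "\<psi> \<in> sphere_test_functions \<Sigma>" "\<phi> \<in> sphere_test_functions \<Sigma>"
  shows "integrable surface_measure (\<lambda>\<theta>. (\<psi> (sgn \<theta>))\<^sup>2)"
    and "integrable surface_measure (\<lambda>\<theta>. \<psi> (sgn \<theta>) * \<phi> (sgn \<theta>))"
    and "integrable surface_measure (\<lambda>\<theta>. (norm (sphere_grad \<psi> \<theta>))\<^sup>2)"
    and "integrable surface_measure (\<lambda>\<theta>. sphere_grad \<psi> \<theta> \<bullet> sphere_grad \<phi> \<theta>)"
    and "p > 0 \<Longrightarrow> integrable surface_measure (\<lambda>\<theta>. \<bar>\<psi> (sgn \<theta>)\<bar> powr p)"
  using assms[THEN sphere_test_functions_smooth, THEN smooth_on_continuous]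
    assms[THEN continuous_on_sphere_grad]
  by (auto intro!: integrable_surface_continuous continuous_intros continuous_on_powr')

lemma sphere_mass_nonneg: "sphere_mass \<psi> \<ge> 0"
  by (simp add: sphere_mass_def)

lemma sphere_energy_nonneg: "sphere_energy \<psi> \<ge> 0"
  by (simp add: sphere_energy_def)

lemma sphere_mass_lincomb:
  assumes "\<psi> \<in> sphere_test_functions \<Sigma>" "\<phi> \<in> sphere_test_functions \<Sigma>"
  shows "sphere_mass (\<lambda>\<theta>. a * \<psi> \<theta> + b * \<phi> \<theta>) = a\<^sup>2 * sphere_mass \<psi> + b\<^sup>2 * sphere_mass \<phi> +
    2 * a * b * (LINT \<theta>|surface_measure. \<psi> (sgn \<theta>) * \<phi> (sgn \<theta>))"
proof -
  note i = integrable_sphere_test_functions[OF assms] integrable_sphere_test_functions[OF assms(2,1)]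
  have "sphere_mass (\<lambda>\<theta>. a * \<psi> \<theta> + b * \<phi> \<theta>) = (LINT \<theta>|surface_measure.
      a\<^sup>2 * (\<psi> (sgn \<theta>))\<^sup>2 + b\<^sup>2 * (\<phi> (sgn \<theta>))\<^sup>2 + 2 * a * b * (\<psi> (sgn \<theta>) * \<phi> (sgn \<theta>)))"
    unfolding sphere_mass_def
    by (intro Bochner_Integration.integral_cong) (auto simp: power2_eq_square algebra_simps)
  also have "\<dots> = a\<^sup>2 * sphere_mass \<psi> + b\<^sup>2 * sphere_mass \<phi> +
      2 * a * b * (LINT \<theta>|surface_measure. \<psi> (sgn \<theta>) * \<phi> (sgn \<theta>))"
    using i by (simp add: sphere_mass_def)
  finally show ?thesis .
qed

lemma AE_surface_nonzero: "AE \<theta> in (surface_measure :: (real^'n) measure). \<theta> \<noteq> 0"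
  using AE_surface_measure_norm by eventually_elim auto

lemma sphere_energy_lincomb:
  assumes "\<psi> \<in> sphere_test_functions \<Sigma>" "\<phi> \<in> sphere_test_functions \<Sigma>"
  shows "sphere_energy (\<lambda>\<theta>. a * \<psi> \<theta> + b * \<phi> \<theta>) = a\<^sup>2 * sphere_energy \<psi> + b\<^sup>2 * sphere_energy \<phi> +
    2 * a * b * (LINT \<theta>|surface_measure. sphere_grad \<psi> \<theta> \<bullet> sphere_grad \<phi> \<theta>)"
proof -
  note i = integrable_sphere_test_functions[OF assms] integrable_sphere_test_functions[OF assms(2,1)]
  note [measurable] = measurable_sphere_test_function(2)[OF assms(1)] measurable_sphere_test_function(2)[OF assms(2)]
    measurable_sphere_test_function(2)[OF sphere_test_functions_lincomb[OF assms, of a b]]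
  have "sphere_energy (\<lambda>\<theta>. a * \<psi> \<theta> + b * \<phi> \<theta>) = (LINT \<theta>|surface_measure.
      a\<^sup>2 * (norm (sphere_grad \<psi> \<theta>))\<^sup>2 + b\<^sup>2 * (norm (sphere_grad \<phi> \<theta>))\<^sup>2 +
      2 * a * b * (sphere_grad \<psi> \<theta> \<bullet> sphere_grad \<phi> \<theta>))"
    unfolding sphere_energy_def
  proof (rule integral_cong_AE)
    show "AE \<theta> in surface_measure. (norm (sphere_grad (\<lambda>\<theta>. a * \<psi> \<theta> + b * \<phi> \<theta>) \<theta>))\<^sup>2 =
        a\<^sup>2 * (norm (sphere_grad \<psi> \<theta>))\<^sup>2 + b\<^sup>2 * (norm (sphere_grad \<phi> \<theta>))\<^sup>2 +
        2 * a * b * (sphere_grad \<psi> \<theta> \<bullet> sphere_grad \<phi> \<theta>)"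
      using AE_surface_nonzero
    proof eventually_elim
      case (elim \<theta>)
      show ?case unfolding sphere_grad_lincomb[OF assms elim] power2_norm_eq_inner
        by (simp add: inner_add_left inner_add_right inner_commute power2_eq_square algebra_simps)
    qed
  qed measurable
  also have "\<dots> = a\<^sup>2 * sphere_energy \<psi> + b\<^sup>2 * sphere_energy \<phi> +
      2 * a * b * (LINT \<theta>|surface_measure. sphere_grad \<psi> \<theta> \<bullet> sphere_grad \<phi> \<theta>)"
    using i by (simp add: sphere_energy_def)
  finally show ?thesis .
qed

lemma sphere_domain_subset: "sphere_domain \<Sigma> \<Longrightarrow> \<Sigma> \<subseteq> sphere 0 1"
  using openin_imp_subset by (auto simp: sphere_domain_def)

lemma sphere_domain_borel: "sphere_domain \<Sigma> \<Longrightarrow> \<Sigma> \<in> sets borel"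
proof -
  assume "sphere_domain \<Sigma>"
  then obtain T where "open T" "\<Sigma> = sphere 0 1 \<inter> T"
    unfolding sphere_domain_def openin_open by blast
  then show ?thesis by (simp add: borel_closed)
qed

text \<open>Test functions vanish on the sphere outside $\Sigma$, so that all set integrals over $\Sigma$ can be
  traded for integrals over the sphere. Here $g$ is the given integrand, arbitrary off the sphere, and
  $h$ a measurable version of it.\<close>

lemma set_integral_sphere:
  fixes h :: "real^'n \<Rightarrow> 'b::{banach, second_countable_topology}"
  assumes \<Sigma>: "sphere_domain \<Sigma>" and [measurable]: "h \<in> borel_measurable borel"
    and "\<And>\<theta>. norm \<theta> = 1 \<Longrightarrow> \<theta> \<in> \<Sigma> \<Longrightarrow> g \<theta> = h \<theta>" "\<And>\<theta>. norm \<theta> = 1 \<Longrightarrow> \<theta> \<notin> \<Sigma> \<Longrightarrow> h \<theta> = 0"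
  shows "(LINT \<theta>:\<Sigma>|surface_measure. g \<theta>) = (LINT \<theta>|surface_measure. h \<theta>)"
proof -
  note [measurable] = sphere_domain_borel[OF \<Sigma>]
  have eq: "(\<lambda>\<theta>. indicator \<Sigma> \<theta> *\<^sub>R g \<theta>) = (\<lambda>\<theta>. indicator \<Sigma> \<theta> *\<^sub>R h \<theta>)"
  proof (rule ext)
    fix \<theta> show "indicator \<Sigma> \<theta> *\<^sub>R g \<theta> = indicator \<Sigma> \<theta> *\<^sub>R h \<theta>"
      using assms(3)[of \<theta>] sphere_domain_subset[OF \<Sigma>] by (cases "\<theta> \<in> \<Sigma>") auto
  qed
  have ae: "AE \<theta> in surface_measure. indicator \<Sigma> \<theta> *\<^sub>R h \<theta> = h \<theta>"
    using AE_surface_measure_norm by eventually_elim (auto simp: indicator_def assms(4))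
  show "(LINT \<theta>:\<Sigma>|surface_measure. g \<theta>) = (LINT \<theta>|surface_measure. h \<theta>)"
    unfolding set_lebesgue_integral_def eq by (intro integral_cong_AE ae) measurable
qed

text \<open>A smooth bump on a small spherical cap: the cone over the cap contains a nonempty open set, so that
  the cap is not a null set.\<close>

lemma exists_sphere_test_function:
  fixes \<Sigma> :: "(real^'n) set"
  assumes "sphere_domain \<Sigma>"
  shows "\<exists>\<psi> \<in> sphere_test_functions \<Sigma>. sphere_mass \<psi> > 0"
proof -
  obtain p U where p: "p \<in> \<Sigma>" and U: "open U" "\<Sigma> = sphere 0 1 \<inter> U"
    using assms unfolding sphere_domain_def openin_open by blast
  then have np: "norm p = 1" by auto
  obtain \<epsilon> where \<epsilon>: "\<epsilon> > 0" "ball p \<epsilon> \<subseteq> U" using U p open_contains_ball by blast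
  \<comment> \<open>For unit vectors $|\theta - p|^2 = 2 - 2 \theta \cdot p$, so the cap $\theta \cdot p \ge c$ lies within $\epsilon$ of $p$.\<close>
  define c where "c = 1 - \<epsilon>\<^sup>2 / 4"
  define \<psi> where "\<psi> \<theta> = flat_exp 0 (\<theta> \<bullet> p - c)" for \<theta>
  have near: "\<theta> \<in> \<Sigma>" if "norm \<theta> = 1" "\<theta> \<bullet> p \<ge> c" for \<theta>
  proof -
    have "(norm (\<theta> - p))\<^sup>2 = 2 - 2 * (\<theta> \<bullet> p)"
      using that(1) np by (simp add: power2_norm_eq_inner inner_diff_left inner_diff_right inner_commute norm_eq_1)
    also have "\<dots> \<le> \<epsilon>\<^sup>2 / 2" using that(2) by (simp add: c_def)
    also have "\<dots> < \<epsilon>\<^sup>2" using \<epsilon> by simp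
    finally have "norm (\<theta> - p) < \<epsilon>" using \<epsilon> by (simp add: power2_less_imp_less)
    then show ?thesis using \<epsilon>(2) U(2) that(1) by (auto simp: dist_norm norm_minus_commute)
  qed
  have "smooth_on (- {0}) (\<lambda>x. \<psi> (sgn x))"
    unfolding \<psi>_def
    by (intro smooth_on_compose_real[OF smooth_on_flat_exp] smooth_on_diff smooth_on_const smooth_on_sgn) auto
  moreover have "closure {\<theta> \<in> sphere 0 1. \<psi> \<theta> \<noteq> 0} \<subseteq> \<Sigma>"
  proof -
    have "closed (sphere 0 1 \<inter> {\<theta>. \<theta> \<bullet> p \<ge> c})"
      by (intro closed_Int closed_sphere closed_Collect_le continuous_intros)
    then have "closure {\<theta> \<in> sphere 0 1. \<psi> \<theta> \<noteq> 0} \<subseteq> sphere 0 1 \<inter> {\<theta>. \<theta> \<bullet> p \<ge> c}"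
      by (rule closure_minimal[rotated]) (auto simp: \<psi>_def flat_exp_def split: if_splits)
    also have "\<dots> \<subseteq> \<Sigma>" using near by (simp add: subset_iff)
    finally show ?thesis .
  qed
  ultimately have \<psi>: "\<psi> \<in> sphere_test_functions \<Sigma>" by (simp add: sphere_test_functions_def)
  have "sphere_mass \<psi> \<noteq> 0"
  proof
    assume "sphere_mass \<psi> = 0"
    then have "AE \<theta> in surface_measure. (\<psi> (sgn \<theta>))\<^sup>2 = 0"
      using integrable_sphere_test_functions(1)[OF \<psi> \<psi>]
      by (subst (asm) sphere_mass_def) (simp add: integral_nonneg_eq_0_iff_AE)
    then have "AE \<theta> in surface_measure. \<theta> \<notin> {\<theta>. norm \<theta> = 1 \<and> \<theta> \<bullet> p > c}"
      using AE_surface_measure_norm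
      by eventually_elim (auto simp: \<psi>_def flat_exp_def sgn_unit split: if_splits)
    then have "emeasure surface_measure {\<theta>::real^'n. norm \<theta> = 1 \<and> \<theta> \<bullet> p > c} = 0"
      by (subst (asm) AE_iff_measurable[OF _ refl]) auto
    then have "emeasure lborel {x \<in> ball 0 1. sgn x \<in> {\<theta>::real^'n. norm \<theta> = 1 \<and> \<theta> \<bullet> p > c}} = 0"
      by (subst (asm) emeasure_surface_measure) auto
    moreover have "{x \<in> ball 0 1. sgn x \<in> {\<theta>::real^'n. norm \<theta> = 1 \<and> \<theta> \<bullet> p > c}} =
        (ball 0 1 - {0}) \<inter> {x. x \<bullet> p > c * norm x}"
      by (auto simp: sgn_div_norm field_simps)
    moreover have "open ((ball 0 1 - {0}) \<inter> {x::real^'n. x \<bullet> p > c * norm x})"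
      by (intro open_Int open_delete open_ball open_Collect_less continuous_intros)
    moreover have "(1/2) *\<^sub>R p \<in> (ball 0 1 - {0}) \<inter> {x::real^'n. x \<bullet> p > c * norm x}"
    proof -
      have "p \<bullet> p = 1" using np by (simp add: norm_eq_1)
      moreover have "p \<noteq> 0" using np by auto
      moreover have "c < 1" using \<epsilon>(1) by (simp add: c_def)
      ultimately show ?thesis using np by simp
    qed
    ultimately have "(ball 0 1 - {0}) \<inter> {x::real^'n. x \<bullet> p > c * norm x} \<in> null_sets lborel"
      and O: "open ((ball 0 1 - {0}) \<inter> {x::real^'n. x \<bullet> p > c * norm x})"
        "(1/2) *\<^sub>R p \<in> (ball 0 1 - {0}) \<inter> {x::real^'n. x \<bullet> p > c * norm x}"
      by (simp_all add: null_sets_def)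
    then have "negligible ((ball 0 1 - {0}) \<inter> {x::real^'n. x \<bullet> p > c * norm x})"
      by (simp only: negligible_iff_null_sets null_sets_completionI)
    then show False using O open_not_negligible by blast
  qed
  then show ?thesis using \<psi> sphere_mass_nonneg[of \<psi>] by force
qed

section \<open>Functions in separated variables\<close>

text \<open>The function with Emden--Fowler transform $f(t) \psi(\theta)$; see \<open>emden_separated\<close>.\<close>

definition separated :: "(real \<Rightarrow> real) \<Rightarrow> (real^'n \<Rightarrow> real) \<Rightarrow> real^'n \<Rightarrow> real" where
  "separated f \<psi> x = norm x powr (- ((real CARD('n) - 2) / 2)) * f (ln (norm x)) * \<psi> (sgn x)"

lemma separated_test_function:
  fixes \<psi> :: "real^'n \<Rightarrow> real"
  assumes f: "smooth_on UNIV f" "\<And>t. t \<notin> {a..b} \<Longrightarrow> f t = 0"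
    and \<psi>: "\<psi> \<in> sphere_test_functions \<Sigma>" and \<Sigma>: "\<Sigma> \<subseteq> sphere 0 1"
  shows "separated f \<psi> \<in> test_functions {x. x \<noteq> 0 \<and> sgn x \<in> \<Sigma> \<and> ln (norm x) \<in> {a..b}}"
proof -
  let ?u = "separated f \<psi>"
  define C where "C = closure {\<theta> \<in> sphere 0 1. \<psi> \<theta> \<noteq> 0}"
  have C: "compact C" "C \<subseteq> \<Sigma>" "\<And>\<theta>. norm \<theta> = 1 \<Longrightarrow> \<psi> \<theta> \<noteq> 0 \<Longrightarrow> \<theta> \<in> C"
  proof -
    show CS: "C \<subseteq> \<Sigma>" using \<psi> by (simp add: C_def sphere_test_functions_def)
    then have "bounded C" using \<Sigma> bounded_subset[OF bounded_sphere, of C 0 1] by blast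
    then show "compact C" by (simp add: C_def compact_eq_bounded_closed)
    show "\<theta> \<in> C" if "norm \<theta> = 1" "\<psi> \<theta> \<noteq> 0" for \<theta>
      using that closure_subset[of "{\<theta> \<in> sphere 0 1. \<psi> \<theta> \<noteq> 0}"] by (auto simp: C_def)
  qed
  define K where "K = (\<lambda>(t, \<theta>). exp t *\<^sub>R \<theta>) ` ({a..b} \<times> C)"
  have K: "compact K"
    unfolding K_def case_prod_unfold
    by (intro compact_continuous_image compact_Times compact_Icc C continuous_intros)
  have supp: "{x. ?u x \<noteq> 0} \<subseteq> K"
  proof
    fix x assume "x \<in> {x. ?u x \<noteq> 0}"
    then have x: "x \<noteq> 0" "f (ln (norm x)) \<noteq> 0" "\<psi> (sgn x) \<noteq> 0" by (auto simp: separated_def)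
    then have "ln (norm x) \<in> {a..b}" "sgn x \<in> C" using f(2) C(3)[of "sgn x"] by (auto simp: norm_sgn)
    moreover have "x = exp (ln (norm x)) *\<^sub>R sgn x" using x by (simp add: sgn_div_norm)
    ultimately show "x \<in> K" unfolding K_def by (intro image_eqI[of _ _ "(ln (norm x), sgn x)"]) auto
  qed
  have K_sub: "K \<subseteq> {x. x \<noteq> 0 \<and> sgn x \<in> \<Sigma> \<and> ln (norm x) \<in> {a..b}}"
  proof -
    have "exp t *\<^sub>R \<theta> \<noteq> 0 \<and> sgn (exp t *\<^sub>R \<theta>) \<in> \<Sigma> \<and> ln (norm (exp t *\<^sub>R \<theta>)) \<in> {a..b}"
      if "t \<in> {a..b}" "\<theta> \<in> C" for t :: real and \<theta>
    proof -
      have "norm \<theta> = 1" "\<theta> \<in> \<Sigma>" using that C(2) \<Sigma> by auto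
      then show ?thesis using that(1) by (auto simp: sgn_scaleR sgn_unit)
    qed
    then show ?thesis by (auto simp: K_def)
  qed
  have closure_supp: "closure {x. ?u x \<noteq> 0} \<subseteq> K"
    using supp K by (simp add: closure_minimal compact_imp_closed)
  have "smooth_on (- {0} \<union> - K) ?u"
  proof (rule smooth_on_Un)
    have lnn: "smooth_on (- {0}) (\<lambda>x::real^'n. ln (norm x))"
      by (intro smooth_on_compose_real[OF smooth_on_ln] smooth_on_norm) auto
    show "smooth_on (- {0}) ?u"
      unfolding separated_def
      by (intro smooth_on_mult smooth_on_compose_real[OF smooth_on_powr] smooth_on_norm
          smooth_on_compose_real[OF f(1)] lnn sphere_test_functions_smooth[OF \<psi>]) auto
    show "smooth_on (- K) ?u"
      by (rule smooth_on_cong[OF _ smooth_on_const[of _ 0]])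
        (use supp K in \<open>auto simp: compact_imp_closed open_Compl\<close>)
  qed (use K in \<open>auto simp: compact_imp_closed open_Compl\<close>)
  moreover have "- {0} \<union> - K = UNIV" using K_sub by auto
  moreover have "compact (closure {x. ?u x \<noteq> 0})"
    using closure_supp K by (metis closed_closure compact_Int_closed inf.absorb_iff2)
  ultimately show ?thesis
    using closure_supp K_sub by (auto simp: test_functions_def)
qed

lemma emden_separated:
  fixes \<psi> :: "real^'n \<Rightarrow> real"
  assumes "norm \<theta> = 1"
  shows "emden (separated f \<psi>) t \<theta> = f t * \<psi> \<theta>"
proof -
  have "exp ((real CARD('n) - 2) / 2 * t) * exp t powr (- ((real CARD('n) - 2) / 2)) = 1"
    by (simp add: powr_def exp_add[symmetric])
  then show ?thesis using assms
    by (simp add: emden_def separated_def sgn_scaleR sgn_unit mult.assoc[symmetric])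
qed

lemma cylinder_integral_product:
  fixes F :: "real \<Rightarrow> real^'n \<Rightarrow> real"
  assumes F: "case_prod F \<in> borel_measurable cylinder_measure" "integrable cylinder_measure (case_prod F)"
    and eq: "\<And>t \<theta>. norm \<theta> = 1 \<Longrightarrow> F t \<theta> = g t * h \<theta>" and [measurable]: "h \<in> borel_measurable borel"
  shows "(LINT (t, \<theta>)|cylinder_measure. F t \<theta>) = (LINT t|lborel. g t) * (LINT \<theta>|surface_measure. h \<theta>)"
proof -
  have "(LINT (t, \<theta>)|cylinder_measure. F t \<theta>) = (LINT t|lborel. LINT \<theta>|surface_measure. F t \<theta>)"
    by (rule cylinder.integral_fst'[OF F(2), symmetric, simplified])
  also have "\<dots> = (LINT t|lborel. g t * (LINT \<theta>|surface_measure. h \<theta>))"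
  proof (rule Bochner_Integration.integral_cong[OF refl])
    fix t
    have "(LINT \<theta>|surface_measure. F t \<theta>) = (LINT \<theta>|surface_measure. g t * h \<theta>)"
    proof (rule integral_cong_AE)
      have "(\<lambda>\<theta>. case_prod F (t, \<theta>)) \<in> borel_measurable surface_measure"
        by (rule measurable_compose[OF measurable_Pair1' F(1)]) simp
      then show "F t \<in> borel_measurable surface_measure" by simp
      show "AE \<theta> in surface_measure. F t \<theta> = g t * h \<theta>"
        using AE_surface_measure_norm by eventually_elim (rule eq)
    qed measurable
    then show "(LINT \<theta>|surface_measure. F t \<theta>) = g t * (LINT \<theta>|surface_measure. h \<theta>)" by simp
  qed
  finally show ?thesis by simp
qed

context
  fixes \<psi> :: "real^'n \<Rightarrow> real" and f f' :: "real \<Rightarrow> real" and a b :: real and \<Sigma> :: "(real^'n) set"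
  assumes f: "smooth_on UNIV f" "\<And>t. t \<notin> {a..b} \<Longrightarrow> f t = 0"
    and f': "\<And>t. (f has_real_derivative f' t) (at t)"
    and \<psi>: "\<psi> \<in> sphere_test_functions \<Sigma>" and \<Sigma>: "\<Sigma> \<subseteq> sphere 0 1"
begin

lemma separated_test: "separated f \<psi> \<in> test_functions (- {0})"
  by (rule test_functions_mono[OF separated_test_function[OF f \<psi> \<Sigma>]]) auto

lemma emden_dt_separated:
  assumes "norm \<theta> = 1"
  shows "emden_dt (separated f \<psi>) t \<theta> = f' t * \<psi> \<theta>"
proof -
  have "((\<lambda>t. f t * \<psi> \<theta>) has_real_derivative emden_dt (separated f \<psi>) t \<theta>) (at t)"
    using DERIV_emden[OF test_functions_differentiable[OF separated_test], of \<theta> t]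
    by (simp add: emden_separated[OF assms])
  moreover have "((\<lambda>t. f t * \<psi> \<theta>) has_real_derivative f' t * \<psi> \<theta>) (at t)"
    using DERIV_cmult_right[OF f'] by simp
  ultimately show ?thesis by (rule DERIV_unique)
qed

lemma emden_ang_separated:
  assumes "norm \<theta> = 1"
  shows "emden_ang (separated f \<psi>) t \<theta> = (f t)\<^sup>2 * (norm (sphere_grad \<psi> \<theta>))\<^sup>2"
proof -
  have \<theta>: "\<theta> \<noteq> 0" using assms by auto
  have "sphere_grad (emden (separated f \<psi>) t) \<theta> = sphere_grad (\<lambda>\<theta>. f t * \<psi> \<theta> + 0 * \<psi> \<theta>) \<theta>"
    by (rule sphere_grad_cong[OF _ \<theta>]) (simp add: emden_separated)
  also have "\<dots> = f t *\<^sub>R sphere_grad \<psi> \<theta>"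
    by (subst sphere_grad_lincomb[OF \<psi> \<psi> \<theta>]) simp
  finally show ?thesis
    using norm_sphere_grad_emden[OF test_functions_differentiable[OF separated_test] assms, of t]
    by (simp add: power_mult_distrib)
qed

lemma integrals_separated:
  shows mass_separated: "(LINT (t, \<theta>)|cylinder_measure. (emden (separated f \<psi>) t \<theta>)\<^sup>2) =
      (LINT t|lborel. (f t)\<^sup>2) * sphere_mass \<psi>"
    and dt_separated: "(LINT (t, \<theta>)|cylinder_measure. (emden_dt (separated f \<psi>) t \<theta>)\<^sup>2) =
      (LINT t|lborel. (f' t)\<^sup>2) * sphere_mass \<psi>"
    and ang_separated: "(LINT (t, \<theta>)|cylinder_measure. emden_ang (separated f \<psi>) t \<theta>) =
      (LINT t|lborel. (f t)\<^sup>2) * sphere_energy \<psi>"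
proof -
  note [measurable] = measurable_sphere_test_function[OF \<psi>]
  note i = integrable_emden[OF separated_test]
  show "(LINT (t, \<theta>)|cylinder_measure. (emden (separated f \<psi>) t \<theta>)\<^sup>2) =
      (LINT t|lborel. (f t)\<^sup>2) * sphere_mass \<psi>"
    unfolding sphere_mass_def
    by (rule cylinder_integral_product[OF borel_measurable_integrable[OF i(1)] i(1)])
      (auto simp: emden_separated power_mult_distrib sgn_unit)
  show "(LINT (t, \<theta>)|cylinder_measure. (emden_dt (separated f \<psi>) t \<theta>)\<^sup>2) =
      (LINT t|lborel. (f' t)\<^sup>2) * sphere_mass \<psi>"
    unfolding sphere_mass_def
    by (rule cylinder_integral_product[OF borel_measurable_integrable[OF i(2)] i(2)])
      (auto simp: emden_dt_separated power_mult_distrib sgn_unit)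
  show "(LINT (t, \<theta>)|cylinder_measure. emden_ang (separated f \<psi>) t \<theta>) =
      (LINT t|lborel. (f t)\<^sup>2) * sphere_energy \<psi>"
    unfolding sphere_energy_def
    by (rule cylinder_integral_product[OF borel_measurable_integrable[OF i(4)] i(4)])
      (auto simp: emden_ang_separated)
qed

end


section \<open>Completeness of $L^2$\<close>

lemma L2_integrable_inner:
  fixes f g :: "'a \<Rightarrow> 'b::euclidean_space"
  assumes [measurable]: "f \<in> borel_measurable M" "g \<in> borel_measurable M"
    and "integrable M (\<lambda>x. (norm (f x))\<^sup>2)" "integrable M (\<lambda>x. (norm (g x))\<^sup>2)"
  shows "integrable M (\<lambda>x. f x \<bullet> g x)"
proof (rule Bochner_Integration.integrable_bound)
  show "integrable M (\<lambda>x. (norm (f x))\<^sup>2 + (norm (g x))\<^sup>2)" using assms by simp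
  have "norm (f x \<bullet> g x) \<le> norm ((norm (f x))\<^sup>2 + (norm (g x))\<^sup>2)" for x
  proof -
    have "\<bar>f x \<bullet> g x\<bar> \<le> norm (f x) * norm (g x)" by (rule Cauchy_Schwarz_ineq2)
    moreover have "2 * (norm (f x) * norm (g x)) \<le> (norm (f x))\<^sup>2 + (norm (g x))\<^sup>2"
      using sum_squares_bound[of "norm (f x)" "norm (g x)"] by simp
    moreover have "0 \<le> norm (f x) * norm (g x)" by simp
    ultimately show ?thesis by simp
  qed
  then show "AE x in M. norm (f x \<bullet> g x) \<le> norm ((norm (f x))\<^sup>2 + (norm (g x))\<^sup>2)" by simp
qed measurable

lemma L2_lincomb:
  fixes f g :: "'a \<Rightarrow> 'b::euclidean_space"
  assumes "f \<in> borel_measurable M" "g \<in> borel_measurable M"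
    and "integrable M (\<lambda>x. (norm (f x))\<^sup>2)" "integrable M (\<lambda>x. (norm (g x))\<^sup>2)"
  shows "integrable M (\<lambda>x. (norm (a *\<^sub>R f x + b *\<^sub>R g x))\<^sup>2)"
    and "(LINT x|M. (norm (a *\<^sub>R f x + b *\<^sub>R g x))\<^sup>2) = a\<^sup>2 * (LINT x|M. (norm (f x))\<^sup>2) +
      b\<^sup>2 * (LINT x|M. (norm (g x))\<^sup>2) + 2 * a * b * (LINT x|M. f x \<bullet> g x)"
proof -
  have eq: "(norm (a *\<^sub>R f x + b *\<^sub>R g x))\<^sup>2 =
      a\<^sup>2 * (norm (f x))\<^sup>2 + b\<^sup>2 * (norm (g x))\<^sup>2 + 2 * a * b * (f x \<bullet> g x)" for x
    unfolding power2_norm_eq_inner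
    by (simp add: inner_add_left inner_add_right inner_commute power2_eq_square algebra_simps)
  note i = assms(3,4) L2_integrable_inner[OF assms]
  show "integrable M (\<lambda>x. (norm (a *\<^sub>R f x + b *\<^sub>R g x))\<^sup>2)"
    unfolding eq using i by simp
  show "(LINT x|M. (norm (a *\<^sub>R f x + b *\<^sub>R g x))\<^sup>2) = a\<^sup>2 * (LINT x|M. (norm (f x))\<^sup>2) +
      b\<^sup>2 * (LINT x|M. (norm (g x))\<^sup>2) + 2 * a * b * (LINT x|M. f x \<bullet> g x)"
    unfolding eq using i by simp
qed

lemma L2_integrable_diff:
  fixes f g :: "'a \<Rightarrow> 'b::euclidean_space"
  assumes "f \<in> borel_measurable M" "g \<in> borel_measurable M"
    and "integrable M (\<lambda>x. (norm (f x))\<^sup>2)" "integrable M (\<lambda>x. (norm (g x))\<^sup>2)"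
  shows "integrable M (\<lambda>x. (norm (f x - g x))\<^sup>2)"
  using L2_lincomb(1)[OF assms, of 1 "-1"] by simp

text \<open>The argument of Riesz and Fischer. A subsequence with rapidly decreasing increments converges almost
  everywhere, since on a finite measure space the increments are summable in $L^1$; Fatou's lemma then
  identifies the limit in $L^2$.\<close>

lemma L2_complete:
  fixes f :: "nat \<Rightarrow> 'a \<Rightarrow> 'b::euclidean_space"
  assumes fin: "finite_measure M"
    and [measurable]: "\<And>k. f k \<in> borel_measurable M"
    and int: "\<And>k. integrable M (\<lambda>x. (norm (f k x))\<^sup>2)"
    and cauchy: "\<And>e. e > 0 \<Longrightarrow> \<exists>N. \<forall>m\<ge>N. \<forall>k\<ge>N. (LINT x|M. (norm (f m x - f k x))\<^sup>2) < e"
  obtains g where "g \<in> borel_measurable M" "integrable M (\<lambda>x. (norm (g x))\<^sup>2)"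
    "(\<lambda>k. LINT x|M. (norm (f k x - g x))\<^sup>2) \<longlonglongrightarrow> 0"
proof -
  interpret finite_measure M by (rule fin)
  have idiff: "integrable M (\<lambda>x. (norm (f m x - f k x))\<^sup>2)" for m k
    by (rule L2_integrable_diff) (use int in auto)
  have "\<exists>N. \<forall>j. \<forall>m\<ge>N j. \<forall>k\<ge>N j. (LINT x|M. (norm (f m x - f k x))\<^sup>2) < (1/4) ^ j"
    using cauchy[of "(1/4) ^ j" for j] by (intro choice) auto
  then obtain N where N: "\<And>j m k. m \<ge> N j \<Longrightarrow> k \<ge> N j \<Longrightarrow> (LINT x|M. (norm (f m x - f k x))\<^sup>2) < (1/4) ^ j"
    by metis
  \<comment> \<open>The summand $j$ makes the subsequence tend to infinity, the sum puts it beyond every threshold.\<close>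
  define r where "r j = j + (\<Sum>i\<le>j. N i)" for j
  have r: "r j \<ge> N j" "r (Suc j) \<ge> N j" "r j \<ge> j" for j
  proof -
    have "N j \<le> (\<Sum>i\<le>j. N i)" by (rule member_le_sum) auto
    then show "r j \<ge> N j" "r (Suc j) \<ge> N j" "r j \<ge> j" by (auto simp: r_def)
  qed
  define d where "d j x = f (r (Suc j)) x - f (r j) x" for j x
  have [measurable]: "d j \<in> borel_measurable M" for j unfolding d_def by measurable
  define C where "C = (measure M (space M) + 1) / 2"
  have d1: "(\<integral>\<^sup>+x. ennreal (norm (d j x)) \<partial>M) \<le> ennreal (C * (1/2) ^ j)" for j
  proof -
    define \<epsilon> :: real where "\<epsilon> = (1/2) ^ j"
    have \<epsilon>: "\<epsilon> > 0" "(1/4) ^ j = \<epsilon> * \<epsilon>" by (auto simp: \<epsilon>_def power_mult_distrib[symmetric])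
    have i: "integrable M (\<lambda>x. (\<epsilon> + (norm (d j x))\<^sup>2 / \<epsilon>) / 2)"
      using idiff by (simp add: d_def)
    have "norm (d j x) \<le> (\<epsilon> + (norm (d j x))\<^sup>2 / \<epsilon>) / 2" for x
    proof -
      have "0 \<le> (\<epsilon> - norm (d j x))\<^sup>2 / \<epsilon>" using \<epsilon> by simp
      also have "\<dots> = \<epsilon> + (norm (d j x))\<^sup>2 / \<epsilon> - 2 * norm (d j x)"
        using \<epsilon> by (simp add: power2_eq_square field_simps)
      finally show ?thesis by simp
    qed
    then have "(\<integral>\<^sup>+x. ennreal (norm (d j x)) \<partial>M) \<le> (\<integral>\<^sup>+x. ennreal ((\<epsilon> + (norm (d j x))\<^sup>2 / \<epsilon>) / 2) \<partial>M)"
      by (intro nn_integral_mono ennreal_leI)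
    also have "\<dots> = ennreal (LINT x|M. (\<epsilon> + (norm (d j x))\<^sup>2 / \<epsilon>) / 2)"
      using \<epsilon> by (intro nn_integral_eq_integral[OF i]) auto
    also have "(LINT x|M. (\<epsilon> + (norm (d j x))\<^sup>2 / \<epsilon>) / 2) =
        (\<epsilon> * measure M (space M) + (LINT x|M. (norm (d j x))\<^sup>2) / \<epsilon>) / 2"
      using idiff by (simp add: d_def)
    also have "\<dots> \<le> (\<epsilon> * measure M (space M) + (\<epsilon> * \<epsilon>) / \<epsilon>) / 2"
    proof -
      have "(LINT x|M. (norm (d j x))\<^sup>2) \<le> \<epsilon> * \<epsilon>"
        using N[of j "r (Suc j)" "r j"] r \<epsilon> by (simp add: d_def less_imp_le)
      then show ?thesis using \<epsilon> by (intro divide_right_mono add_left_mono) auto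
    qed
    also have "\<dots> = C * (1/2) ^ j" using \<epsilon>(1) unfolding C_def \<epsilon>_def[symmetric] by (simp add: field_simps)
    finally show ?thesis by (simp add: ennreal_leI)
  qed
  have "(\<integral>\<^sup>+x. (\<Sum>j. ennreal (norm (d j x))) \<partial>M) = (\<Sum>j. \<integral>\<^sup>+x. ennreal (norm (d j x)) \<partial>M)"
    by (rule nn_integral_suminf) measurable
  also have "\<dots> \<le> (\<Sum>j. ennreal (C * (1/2) ^ j))"
    by (intro suminf_le d1 summableI)
  also have "\<dots> = ennreal (\<Sum>j. C * (1/2) ^ j)"
    by (intro suminf_ennreal2) (auto simp: C_def intro!: summable_mult summable_geometric)
  also have "\<dots> < top" by simp
  finally have "AE x in M. (\<Sum>j. ennreal (norm (d j x))) \<noteq> \<infinity>"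
    by (intro nn_integral_PInf_AE) auto
  then have lim: "AE x in M. (\<lambda>j. f (r j) x) \<longlonglongrightarrow> lim (\<lambda>j. f (r j) x)"
  proof eventually_elim
    case (elim x)
    then have "summable (\<lambda>j. norm (d j x))"
      by (intro summable_suminf_not_top) auto
    then have "summable (\<lambda>j. f (r (Suc j)) x - f (r j) x)"
      unfolding d_def by (rule summable_norm_cancel)
    then have "convergent (\<lambda>k. \<Sum>j<k. f (r (Suc j)) x - f (r j) x)"
      by (simp add: summable_iff_convergent)
    then have "convergent (\<lambda>k. (f (r k) x - f (r 0) x) + f (r 0) x)"
      by (intro convergent_add convergent_const) (simp add: sum_lessThan_telescope[of "\<lambda>j. f (r j) x"])
    then show ?case by (simp add: convergent_LIMSEQ_iff)
  qed
  define g where "g x = lim (\<lambda>j. f (r j) x)" for x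
  have [measurable]: "g \<in> borel_measurable M"
    unfolding g_def by (rule borel_measurable_lim_metric) measurable
  have close: "integrable M (\<lambda>x. (norm (f k x - g x))\<^sup>2) \<and> (LINT x|M. (norm (f k x - g x))\<^sup>2) \<le> e"
    if e: "e > 0" and K: "\<forall>m\<ge>K. \<forall>k\<ge>K. (LINT x|M. (norm (f m x - f k x))\<^sup>2) < e" and k: "k \<ge> K" for e K k
  proof -
    have "(\<integral>\<^sup>+x. ennreal ((norm (f k x - g x))\<^sup>2) \<partial>M) =
        (\<integral>\<^sup>+x. liminf (\<lambda>j. ennreal ((norm (f k x - f (r j) x))\<^sup>2)) \<partial>M)"
    proof (rule nn_integral_cong_AE)
      show "AE x in M. ennreal ((norm (f k x - g x))\<^sup>2) = liminf (\<lambda>j. ennreal ((norm (f k x - f (r j) x))\<^sup>2))"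
        using lim
      proof eventually_elim
        case (elim x)
        then have "(\<lambda>j. ennreal ((norm (f k x - f (r j) x))\<^sup>2)) \<longlonglongrightarrow> ennreal ((norm (f k x - g x))\<^sup>2)"
          unfolding g_def by (intro tendsto_ennrealI tendsto_intros)
        then show ?case by (rule lim_imp_Liminf[OF sequentially_bot, symmetric])
      qed
    qed
    also have "\<dots> \<le> liminf (\<lambda>j. \<integral>\<^sup>+x. ennreal ((norm (f k x - f (r j) x))\<^sup>2) \<partial>M)"
      by (rule nn_integral_liminf) measurable
    also have "\<dots> \<le> ennreal e"
    proof (rule Liminf_le[OF sequentially_bot])
      have "(\<integral>\<^sup>+x. ennreal ((norm (f k x - f (r j) x))\<^sup>2) \<partial>M) \<le> ennreal e" if "j \<ge> K" for j
      proof -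
        have "r j \<ge> K" using r(3)[of j] that by simp
        then have "(LINT x|M. (norm (f k x - f (r j) x))\<^sup>2) \<le> e" using K k by (simp add: less_imp_le)
        moreover have "(\<integral>\<^sup>+x. ennreal ((norm (f k x - f (r j) x))\<^sup>2) \<partial>M) =
            ennreal (LINT x|M. (norm (f k x - f (r j) x))\<^sup>2)"
          by (rule nn_integral_eq_integral[OF idiff]) simp
        ultimately show ?thesis by (simp add: ennreal_leI)
      qed
      then show "\<forall>\<^sub>F j in sequentially. (\<integral>\<^sup>+x. ennreal ((norm (f k x - f (r j) x))\<^sup>2) \<partial>M) \<le> ennreal e"
        by (auto simp: eventually_sequentially)
    qed
    finally have le: "(\<integral>\<^sup>+x. ennreal ((norm (f k x - g x))\<^sup>2) \<partial>M) \<le> ennreal e" .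
    have i: "integrable M (\<lambda>x. (norm (f k x - g x))\<^sup>2)"
      by (rule integrableI_bounded) (use le in \<open>auto simp: le_less_trans\<close>)
    have "ennreal (LINT x|M. (norm (f k x - g x))\<^sup>2) \<le> ennreal e"
      using le nn_integral_eq_integral[OF i] by simp
    with i e show ?thesis by simp
  qed
  show thesis
  proof (rule that[of g])
    obtain K where K: "\<forall>m\<ge>K. \<forall>k\<ge>K. (LINT x|M. (norm (f m x - f k x))\<^sup>2) < 1"
      using cauchy[of 1] by auto
    have "integrable M (\<lambda>x. (norm (f K x - (f K x - g x)))\<^sup>2)"
      by (rule L2_integrable_diff) (use int close[OF _ K order_refl] in auto)
    then show "integrable M (\<lambda>x. (norm (g x))\<^sup>2)" by simp
    show "(\<lambda>k. LINT x|M. (norm (f k x - g x))\<^sup>2) \<longlonglongrightarrow> 0"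
    proof (rule LIMSEQ_I)
      fix e :: real assume "e > 0"
      then obtain K where K: "\<forall>m\<ge>K. \<forall>k\<ge>K. (LINT x|M. (norm (f m x - f k x))\<^sup>2) < e / 2"
        using cauchy[of "e / 2"] by auto
      have "norm ((LINT x|M. (norm (f k x - g x))\<^sup>2) - 0) < e" if "k \<ge> K" for k
        using close[OF _ K that] \<open>e > 0\<close> by simp
      then show "\<exists>no. \<forall>n\<ge>no. norm ((LINT x|M. (norm (f n x - g x))\<^sup>2) - 0) < e" by blast
    qed
  qed measurable
qed

text \<open>The inner products differ by at most $\epsilon \|h\|^2 + \|f_k - g\|^2 / \epsilon$ for every
  $\epsilon > 0$. Convergence of the norms follows by expanding $\|f_k - g\|^2$.\<close>

lemma L2_tendsto:
  fixes f :: "nat \<Rightarrow> 'a \<Rightarrow> 'b::euclidean_space"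
  assumes meas: "\<And>k. f k \<in> borel_measurable M" "g \<in> borel_measurable M" "h \<in> borel_measurable M"
    and int: "\<And>k. integrable M (\<lambda>x. (norm (f k x))\<^sup>2)" "integrable M (\<lambda>x. (norm (g x))\<^sup>2)"
      "integrable M (\<lambda>x. (norm (h x))\<^sup>2)"
    and lim: "(\<lambda>k. LINT x|M. (norm (f k x - g x))\<^sup>2) \<longlonglongrightarrow> 0"
  shows L2_tendsto_inner: "(\<lambda>k. LINT x|M. f k x \<bullet> h x) \<longlonglongrightarrow> (LINT x|M. g x \<bullet> h x)"
    and L2_tendsto_norm: "(\<lambda>k. LINT x|M. (norm (f k x))\<^sup>2) \<longlonglongrightarrow> (LINT x|M. (norm (g x))\<^sup>2)"
proof -
  have d: "(\<lambda>x. f k x - g x) \<in> borel_measurable M" "integrable M (\<lambda>x. (norm (f k x - g x))\<^sup>2)" for k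
    using meas int by (auto intro: L2_integrable_diff)
  have inner: "(\<lambda>k. LINT x|M. f k x \<bullet> h x) \<longlonglongrightarrow> (LINT x|M. g x \<bullet> h x)"
    if h: "h \<in> borel_measurable M" "integrable M (\<lambda>x. (norm (h x))\<^sup>2)" for h
  proof -
    define H where "H = (LINT x|M. (norm (h x))\<^sup>2)"
    define D where "D k = (LINT x|M. (norm (f k x - g x))\<^sup>2)" for k
    have H: "H \<ge> 0" by (simp add: H_def)
    have bound: "\<bar>(LINT x|M. f k x \<bullet> h x) - (LINT x|M. g x \<bullet> h x)\<bar> \<le> \<epsilon> * H + D k / \<epsilon>" if "\<epsilon> > 0" for k \<epsilon>
    proof -
      have "(LINT x|M. f k x \<bullet> h x) - (LINT x|M. g x \<bullet> h x) = (LINT x|M. (f k x - g x) \<bullet> h x)"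
        using L2_integrable_inner[OF meas(1) h(1) int(1) h(2)] L2_integrable_inner[OF meas(2) h(1) int(2) h(2)]
        by (simp add: inner_diff_left)
      also have "\<bar>\<dots>\<bar> \<le> (LINT x|M. \<bar>(f k x - g x) \<bullet> h x\<bar>)"
        by (rule integral_abs_bound)
      also have "\<dots> \<le> (LINT x|M. \<epsilon> * (norm (h x))\<^sup>2 + (norm (f k x - g x))\<^sup>2 / \<epsilon>)"
      proof (rule integral_mono)
        show "integrable M (\<lambda>x. \<bar>(f k x - g x) \<bullet> h x\<bar>)"
          using L2_integrable_inner[OF d(1) h(1) d(2) h(2)] by simp
        show "integrable M (\<lambda>x. \<epsilon> * (norm (h x))\<^sup>2 + (norm (f k x - g x))\<^sup>2 / \<epsilon>)"
          using d h by simp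
        fix x
        define s t where "s = norm (f k x - g x)" and "t = norm (h x)"
        have "\<bar>(f k x - g x) \<bullet> h x\<bar> \<le> s * t" unfolding s_def t_def by (rule Cauchy_Schwarz_ineq2)
        moreover have "2 * (s * t) \<le> \<epsilon> * t\<^sup>2 + s\<^sup>2 / \<epsilon>"
        proof -
          have "0 \<le> (\<epsilon> * t - s)\<^sup>2 / \<epsilon>" using that by simp
          also have "\<dots> = \<epsilon> * t\<^sup>2 + s\<^sup>2 / \<epsilon> - 2 * (s * t)" using that by (simp add: power2_eq_square field_simps)
          finally show ?thesis by simp
        qed
        moreover have "0 \<le> s * t" by (simp add: s_def t_def)
        ultimately show "\<bar>(f k x - g x) \<bullet> h x\<bar> \<le> \<epsilon> * (norm (h x))\<^sup>2 + (norm (f k x - g x))\<^sup>2 / \<epsilon>"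
          by (simp add: s_def t_def)
      qed
      also have "\<dots> = \<epsilon> * H + D k / \<epsilon>" using d h by (simp add: H_def D_def)
      finally show ?thesis .
    qed
    show ?thesis
    proof (rule LIMSEQ_I)
      fix e :: real assume e: "e > 0"
      define \<epsilon> where "\<epsilon> = e / (2 * (H + 1))"
      have \<epsilon>: "\<epsilon> > 0" "\<epsilon> * H \<le> e / 2" using e H by (auto simp: \<epsilon>_def field_simps)
      have "\<exists>no. \<forall>k\<ge>no. norm (D k - 0) < \<epsilon> * (e / 2)"
        using LIMSEQ_D[OF lim, of "\<epsilon> * (e / 2)"] e \<epsilon> by (simp add: D_def)
      then obtain no where no: "\<And>k. k \<ge> no \<Longrightarrow> \<bar>D k\<bar> < \<epsilon> * (e / 2)" by auto
      have "norm ((LINT x|M. f k x \<bullet> h x) - (LINT x|M. g x \<bullet> h x)) < e" if "k \<ge> no" for k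
      proof -
        have "D k / \<epsilon> < e / 2" using no[OF that] \<epsilon>(1) by (simp add: field_simps)
        then show ?thesis using bound[OF \<epsilon>(1), of k] \<epsilon>(2) unfolding real_norm_def by linarith
      qed
      then show "\<exists>no. \<forall>k\<ge>no. norm ((LINT x|M. f k x \<bullet> h x) - (LINT x|M. g x \<bullet> h x)) < e" by blast
    qed
  qed
  show "(\<lambda>k. LINT x|M. f k x \<bullet> h x) \<longlonglongrightarrow> (LINT x|M. g x \<bullet> h x)" by (rule inner[OF meas(3) int(3)])
  have "(LINT x|M. (norm (f k x))\<^sup>2) = (LINT x|M. (norm (f k x - g x))\<^sup>2) -
      (LINT x|M. (norm (g x))\<^sup>2) + 2 * (LINT x|M. f k x \<bullet> g x)" for k
    using L2_lincomb(2)[OF meas(1)[of k] meas(2) int(1)[of k] int(2), of 1 "-1"] by simp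
  moreover have "(\<lambda>k. (LINT x|M. (norm (f k x - g x))\<^sup>2) - (LINT x|M. (norm (g x))\<^sup>2) +
      2 * (LINT x|M. f k x \<bullet> g x)) \<longlonglongrightarrow> 0 - (LINT x|M. (norm (g x))\<^sup>2) + 2 * (LINT x|M. g x \<bullet> g x)"
    by (intro tendsto_intros lim inner meas int)
  ultimately show "(\<lambda>k. LINT x|M. (norm (f k x))\<^sup>2) \<longlonglongrightarrow> (LINT x|M. (norm (g x))\<^sup>2)"
    by (simp add: power2_norm_eq_inner)
qed


section \<open>Rellich compactness\<close>

lemma nn_integral_lborel_translate:
  fixes F :: "'a::euclidean_space \<Rightarrow> ennreal"
  assumes "F \<in> borel_measurable borel"
  shows "(\<integral>\<^sup>+x. F (x + v) \<partial>lborel) = (\<integral>\<^sup>+x. F x \<partial>lborel)"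
proof -
  have "(\<integral>\<^sup>+x. F x \<partial>lborel) = (\<integral>\<^sup>+x. F x \<partial>distr lborel borel ((+) v))"
    by (simp only: lborel_distr_plus)
  also have "\<dots> = (\<integral>\<^sup>+x. F (v + x) \<partial>lborel)"
    using assms by (intro nn_integral_distr) auto
  finally show ?thesis by (simp add: add.commute)
qed

context
  fixes D :: "'a::euclidean_space \<Rightarrow> real"
  assumes D: "D \<in> test_functions UNIV"
begin

lemma measurable_test_grad [measurable]: "D \<in> borel_measurable borel" "grad D \<in> borel_measurable borel"
  using test_functions_continuous[OF D] test_functions_continuous_grad[OF D]
  by (auto intro: borel_measurable_continuous_onI)

text \<open>Jensen's inequality for the mean of the directional derivative over the segment from $x$ to $x + h$,
  in the form that its variance is nonnegative.\<close>

lemma diff_square_le_line: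
  "ennreal ((D (x + h) - D x)\<^sup>2) \<le>
    (\<integral>\<^sup>+s. indicator {0..1} s * ennreal ((norm h)\<^sup>2 * (norm (grad D (x + s *\<^sub>R h)))\<^sup>2) \<partial>lborel)"
proof -
  define g where "g s = h \<bullet> grad D (x + s *\<^sub>R h)" for s
  have line: "continuous_on UNIV (\<lambda>s. x + s *\<^sub>R h)" by (intro continuous_intros)
  have g: "continuous_on UNIV g"
    unfolding g_def by (intro continuous_intros continuous_on_compose2[OF test_functions_continuous_grad[OF D] line]) auto
  have ig: "integrable lborel (\<lambda>s. g s * indicator {0..1} s)" "integrable lborel (\<lambda>s. (g s)\<^sup>2 * indicator {0..1} s)"
    using borel_integrable_compact[of "{0..1}" g] borel_integrable_compact[of "{0..1}" "\<lambda>s. (g s)\<^sup>2"]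
      continuous_on_subset[OF g] continuous_on_power[OF continuous_on_subset[OF g]]
    by (simp_all add: mult.commute)
  define c where "c = D (x + h) - D x"
  have "(LINT s|lborel. g s * indicator {0..1} s) = D (x + 1 *\<^sub>R h) - D (x + 0 *\<^sub>R h)"
  proof (rule integral_FTC_Icc_real)
    fix s :: real
    have l: "((\<lambda>s. x + s *\<^sub>R h) has_derivative (\<lambda>k. k *\<^sub>R h)) (at s)"
      by (auto intro!: derivative_eq_intros)
    have "((\<lambda>s. D (x + s *\<^sub>R h)) has_derivative (\<lambda>k. k *\<^sub>R h \<bullet> grad D (x + s *\<^sub>R h))) (at s)"
      using diff_chain_at[OF l has_derivative_grad[OF test_functions_differentiable[OF D]]]
      by (simp only: o_def)
    then show "((\<lambda>s. D (x + s *\<^sub>R h)) has_real_derivative g s) (at s)"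
      by (simp add: has_field_derivative_def mult_commute_abs g_def)
    show "isCont g s" using g by (simp add: continuous_on_eq_continuous_at)
  qed simp
  then have c: "(LINT s|lborel. g s * indicator {0..1} s) = c" by (simp add: c_def)
  have "0 \<le> (LINT s|lborel. (g s - c)\<^sup>2 * indicator {0..1} s)" by simp
  also have "\<dots> = (LINT s|lborel. (g s)\<^sup>2 * indicator {0..1} s - 2 * c * (g s * indicator {0..1} s) +
      c\<^sup>2 * indicator {0..1} s)"
    by (intro Bochner_Integration.integral_cong) (auto simp: power2_eq_square algebra_simps)
  also have "\<dots> = (LINT s|lborel. (g s)\<^sup>2 * indicator {0..1} s) - c\<^sup>2"
    using ig by (simp add: c power2_eq_square)
  finally have "c\<^sup>2 \<le> (LINT s|lborel. (g s)\<^sup>2 * indicator {0..1} s)" by simp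
  then have "ennreal (c\<^sup>2) \<le> ennreal (LINT s|lborel. (g s)\<^sup>2 * indicator {0..1} s)" by (rule ennreal_leI)
  also have "\<dots> = (\<integral>\<^sup>+s. ennreal ((g s)\<^sup>2 * indicator {0..1} s) \<partial>lborel)"
    by (rule nn_integral_eq_integral[OF ig(2), symmetric]) simp
  also have "\<dots> \<le> (\<integral>\<^sup>+s. indicator {0..1} s * ennreal ((norm h)\<^sup>2 * (norm (grad D (x + s *\<^sub>R h)))\<^sup>2) \<partial>lborel)"
  proof (rule nn_integral_mono)
    fix s :: real
    have "\<bar>g s\<bar> \<le> norm h * norm (grad D (x + s *\<^sub>R h))" unfolding g_def by (rule Cauchy_Schwarz_ineq2)
    then have "\<bar>g s\<bar>\<^sup>2 \<le> (norm h * norm (grad D (x + s *\<^sub>R h)))\<^sup>2" by (rule power_mono) simp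
    then show "ennreal ((g s)\<^sup>2 * indicator {0..1} s) \<le>
        indicator {0..1} s * ennreal ((norm h)\<^sup>2 * (norm (grad D (x + s *\<^sub>R h)))\<^sup>2)"
      by (auto simp: indicator_def power_mult_distrib intro!: ennreal_leI)
  qed
  finally show ?thesis by (simp add: c_def)
qed

lemma translation_L2:
  "(\<integral>\<^sup>+x. ennreal ((D (x + h) - D x)\<^sup>2) \<partial>lborel) \<le>
    ennreal ((norm h)\<^sup>2) * (\<integral>\<^sup>+x. ennreal ((norm (grad D x))\<^sup>2) \<partial>lborel)"
proof -
  let ?E = "\<integral>\<^sup>+x. ennreal ((norm (grad D x))\<^sup>2) \<partial>lborel"
  have "(\<integral>\<^sup>+x. ennreal ((D (x + h) - D x)\<^sup>2) \<partial>lborel) \<le> (\<integral>\<^sup>+x. \<integral>\<^sup>+s. indicator {0..1::real} s *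
      ennreal ((norm h)\<^sup>2 * (norm (grad D (x + s *\<^sub>R h)))\<^sup>2) \<partial>lborel \<partial>lborel)"
    by (intro nn_integral_mono diff_square_le_line)
  also have "\<dots> = (\<integral>\<^sup>+s. \<integral>\<^sup>+x. indicator {0..1::real} s *
      ennreal ((norm h)\<^sup>2 * (norm (grad D (x + s *\<^sub>R h)))\<^sup>2) \<partial>lborel \<partial>lborel)"
    by (rule lborel_pair.Fubini') measurable
  also have "\<dots> = (\<integral>\<^sup>+s. indicator {0..1::real} s * (ennreal ((norm h)\<^sup>2) * ?E) \<partial>lborel)"
  proof (rule nn_integral_cong)
    fix s :: real
    have "(\<integral>\<^sup>+x. indicator {0..1::real} s * ennreal ((norm h)\<^sup>2 * (norm (grad D (x + s *\<^sub>R h)))\<^sup>2) \<partial>lborel) =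
        indicator {0..1::real} s * (ennreal ((norm h)\<^sup>2) * (\<integral>\<^sup>+x. ennreal ((norm (grad D (x + s *\<^sub>R h)))\<^sup>2) \<partial>lborel))"
      by (simp add: nn_integral_cmult ennreal_mult)
    also have "(\<integral>\<^sup>+x. ennreal ((norm (grad D (x + s *\<^sub>R h)))\<^sup>2) \<partial>lborel) = ?E"
      by (rule nn_integral_lborel_translate) measurable
    finally show "(\<integral>\<^sup>+x. indicator {0..1::real} s * ennreal ((norm h)\<^sup>2 * (norm (grad D (x + s *\<^sub>R h)))\<^sup>2) \<partial>lborel) =
        indicator {0..1::real} s * (ennreal ((norm h)\<^sup>2) * ?E)" .
  qed
  also have "\<dots> = ennreal ((norm h)\<^sup>2) * ?E"
    by (subst nn_integral_multc) auto
  finally show ?thesis .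
qed

text \<open>\<open>translation_L2\<close> integrated over all translations of length at most $\rho$.\<close>

lemma near_diagonal_L2:
  "(\<integral>\<^sup>+x. \<integral>\<^sup>+y. indicator (cball 0 \<rho>) (y - x) * ennreal ((D y - D x)\<^sup>2) \<partial>lborel \<partial>lborel) \<le>
    emeasure lborel (cball (0::'a) \<rho>) * (ennreal (\<rho>\<^sup>2) * (\<integral>\<^sup>+x. ennreal ((norm (grad D x))\<^sup>2) \<partial>lborel))"
proof -
  have [measurable]: "cball (0::'a) \<rho> \<in> sets borel" by (intro borel_closed closed_cball)
  let ?E = "\<integral>\<^sup>+x. ennreal ((norm (grad D x))\<^sup>2) \<partial>lborel"
  have "(\<integral>\<^sup>+x. \<integral>\<^sup>+y. indicator (cball 0 \<rho>) (y - x) * ennreal ((D y - D x)\<^sup>2) \<partial>lborel \<partial>lborel) =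
      (\<integral>\<^sup>+x. \<integral>\<^sup>+h. indicator (cball 0 \<rho>) h * ennreal ((D (x + h) - D x)\<^sup>2) \<partial>lborel \<partial>lborel)"
  proof (rule nn_integral_cong)
    fix x :: 'a
    have [measurable]: "(\<lambda>y. indicator (cball 0 \<rho>) (y - x) :: ennreal) \<in> borel_measurable borel"
      by (rule measurable_compose[of "\<lambda>y. y - x" borel borel "indicator (cball 0 \<rho>)"]) auto
    have "(\<lambda>y. indicator (cball 0 \<rho>) (y - x) * ennreal ((D y - D x)\<^sup>2)) \<in> borel_measurable borel"
      by measurable
    from nn_integral_lborel_translate[OF this, of x]
    show "(\<integral>\<^sup>+y. indicator (cball 0 \<rho>) (y - x) * ennreal ((D y - D x)\<^sup>2) \<partial>lborel) =
        (\<integral>\<^sup>+h. indicator (cball 0 \<rho>) h * ennreal ((D (x + h) - D x)\<^sup>2) \<partial>lborel)"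
      by (simp add: add.commute)
  qed
  also have "\<dots> = (\<integral>\<^sup>+h. \<integral>\<^sup>+x. indicator (cball 0 \<rho>) h * ennreal ((D (x + h) - D x)\<^sup>2) \<partial>lborel \<partial>lborel)"
    by (rule lborel_pair.Fubini') measurable
  also have "\<dots> \<le> (\<integral>\<^sup>+h. indicator (cball (0::'a) \<rho>) h * (ennreal (\<rho>\<^sup>2) * ?E) \<partial>lborel)"
  proof (rule nn_integral_mono)
    fix h :: 'a
    have "(\<integral>\<^sup>+x. indicator (cball 0 \<rho>) h * ennreal ((D (x + h) - D x)\<^sup>2) \<partial>lborel) =
        indicator (cball 0 \<rho>) h * (\<integral>\<^sup>+x. ennreal ((D (x + h) - D x)\<^sup>2) \<partial>lborel)"
      by (rule nn_integral_cmult) measurable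
    also have "\<dots> \<le> indicator (cball 0 \<rho>) h * (ennreal (\<rho>\<^sup>2) * ?E)"
    proof (cases "h \<in> cball 0 \<rho>")
      case True
      then have "(norm h)\<^sup>2 \<le> \<rho>\<^sup>2" by (intro power_mono) auto
      then have "ennreal ((norm h)\<^sup>2) * ?E \<le> ennreal (\<rho>\<^sup>2) * ?E" by (intro mult_right_mono ennreal_leI) auto
      then show ?thesis using translation_L2[of h] by (auto intro: order_trans simp: indicator_def)
    qed simp
    finally show "(\<integral>\<^sup>+x. indicator (cball 0 \<rho>) h * ennreal ((D (x + h) - D x)\<^sup>2) \<partial>lborel) \<le>
        indicator (cball 0 \<rho>) h * (ennreal (\<rho>\<^sup>2) * ?E)" .
  qed
  also have "\<dots> = emeasure lborel (cball (0::'a) \<rho>) * (ennreal (\<rho>\<^sup>2) * ?E)"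
    by (subst nn_integral_multc) auto
  finally show ?thesis .
qed

lemma integrable_test: "integrable lborel D" "integrable lborel (\<lambda>x. (D x)\<^sup>2)"
  "integrable lborel (\<lambda>x. (norm (grad D x))\<^sup>2)"
proof -
  have K: "compact (closure {x. D x \<noteq> 0})" using D by (auto simp: test_functions_def)
  have z: "D x = 0" if "x \<notin> closure {x. D x \<noteq> 0}" for x
  proof (rule ccontr)
    assume "D x \<noteq> 0"
    then have "x \<in> closure {x. D x \<noteq> 0}" by (intro subsetD[OF closure_subset]) simp
    with that show False ..
  qed
  note c = test_functions_continuous[OF D] test_functions_continuous_grad[OF D]
  show "integrable lborel D"
    by (rule integrable_continuous_compact_support[OF c(1) K z])
  show "integrable lborel (\<lambda>x. (D x)\<^sup>2)"
  proof (rule integrable_continuous_compact_support[OF continuous_on_power[OF c(1)] K])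
    fix x assume "x \<notin> closure {x. D x \<noteq> 0}"
    from z[OF this] show "(D x)\<^sup>2 = 0" by simp
  qed
  show "integrable lborel (\<lambda>x. (norm (grad D x))\<^sup>2)"
    by (rule integrable_continuous_compact_support[OF continuous_on_power[OF continuous_on_norm[OF c(2)]] K])
      (simp add: grad_zero_outside)
qed

text \<open>Expand the square on the right: the variance of $D$ over $Q$ is half the mean square difference of its
  values at two independent points.\<close>

lemma cell_variance:
  assumes [measurable]: "Q \<in> sets borel" and v: "emeasure lborel Q = ennreal v" "v > 0"
  shows "ennreal (2 * v * (LINT x|lborel. indicator Q x * (D x)\<^sup>2) - 2 * (LINT x|lborel. indicator Q x * D x)\<^sup>2) =
    (\<integral>\<^sup>+x. \<integral>\<^sup>+y. indicator Q x * indicator Q y * ennreal ((D y - D x)\<^sup>2) \<partial>lborel \<partial>lborel)"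
proof -
  define I where "I = (LINT x|lborel. indicator Q x * D x)"
  define J where "J = (LINT x|lborel. indicator Q x * (D x)\<^sup>2)"
  have i: "integrable lborel (\<lambda>x. indicator Q x * D x)" "integrable lborel (\<lambda>x. indicator Q x * (D x)\<^sup>2)"
    "integrable lborel (\<lambda>x. indicator Q x :: real)"
    using integrable_mult_indicator[of Q lborel D] integrable_mult_indicator[of Q lborel "\<lambda>x. (D x)\<^sup>2"]
      integrable_test v by auto
  have mv: "measure lborel Q = v" using v by (simp add: measure_def)
  have eq1: "indicator Q y * (D y - c)\<^sup>2 =
      indicator Q y * (D y)\<^sup>2 - 2 * c * (indicator Q y * D y) + c\<^sup>2 * indicator Q y" for c y
    by (simp add: power2_eq_square algebra_simps)
  have inner: "(\<integral>\<^sup>+y. indicator Q x * indicator Q y * ennreal ((D y - D x)\<^sup>2) \<partial>lborel) =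
      ennreal (indicator Q x * (J - 2 * D x * I + v * (D x)\<^sup>2))" for x
  proof -
    have "(\<integral>\<^sup>+y. indicator Q x * indicator Q y * ennreal ((D y - D x)\<^sup>2) \<partial>lborel) =
        indicator Q x * (\<integral>\<^sup>+y. ennreal (indicator Q y * (D y - D x)\<^sup>2) \<partial>lborel)"
      by (subst nn_integral_cmult[symmetric], measurable)
        (intro nn_integral_cong, auto simp: indicator_def)
    also have "(\<integral>\<^sup>+y. ennreal (indicator Q y * (D y - D x)\<^sup>2) \<partial>lborel) =
        ennreal (LINT y|lborel. indicator Q y * (D y - D x)\<^sup>2)"
    proof (rule nn_integral_eq_integral)
      show "integrable lborel (\<lambda>y. indicator Q y * (D y - D x)\<^sup>2)" unfolding eq1 using i by simp
    qed simp
    also have "(LINT y|lborel. indicator Q y * (D y - D x)\<^sup>2) = J - 2 * D x * I + v * (D x)\<^sup>2"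
      unfolding eq1 using i by (simp add: I_def J_def mv)
    finally show ?thesis by (auto simp: indicator_def)
  qed
  have eq2: "indicator Q x * (J - 2 * D x * I + v * (D x)\<^sup>2) =
      J * indicator Q x - 2 * I * (indicator Q x * D x) + v * (indicator Q x * (D x)\<^sup>2)" for x
    by (simp add: algebra_simps)
  have nn: "0 \<le> indicator Q x * (J - 2 * D x * I + v * (D x)\<^sup>2)" for x
  proof -
    have "J - 2 * D x * I + v * (D x)\<^sup>2 = (LINT y|lborel. indicator Q y * (D y - D x)\<^sup>2)"
      unfolding eq1 using i by (simp add: I_def J_def mv)
    then show ?thesis by (simp add: mult_nonneg_nonneg)
  qed
  have "(\<integral>\<^sup>+x. \<integral>\<^sup>+y. indicator Q x * indicator Q y * ennreal ((D y - D x)\<^sup>2) \<partial>lborel \<partial>lborel) =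
      (\<integral>\<^sup>+x. ennreal (indicator Q x * (J - 2 * D x * I + v * (D x)\<^sup>2)) \<partial>lborel)"
    by (simp only: inner)
  also have "\<dots> = ennreal (LINT x|lborel. indicator Q x * (J - 2 * D x * I + v * (D x)\<^sup>2))"
  proof (rule nn_integral_eq_integral)
    show "integrable lborel (\<lambda>x. indicator Q x * (J - 2 * D x * I + v * (D x)\<^sup>2))" unfolding eq2 using i by simp
  qed (simp add: nn)
  also have "(LINT x|lborel. indicator Q x * (J - 2 * D x * I + v * (D x)\<^sup>2)) = J * v - 2 * I * I + v * J"
    unfolding eq2 using i by (simp add: I_def[symmetric] J_def[symmetric] mv)
  also have "\<dots> = 2 * v * J - 2 * I\<^sup>2" by (simp add: power2_eq_square)
  finally show ?thesis by (simp add: I_def J_def)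
qed

end

text \<open>The function \<open>grid \<delta>\<close> names the half-open cube of side $\delta$ that contains a given point. Names are
  restricted to the basis, so that a cube has only one name and there are only countably many.\<close>

definition grid :: "real \<Rightarrow> 'a::euclidean_space \<Rightarrow> 'a \<Rightarrow> int" where
  "grid \<delta> x = (\<lambda>b\<in>Basis. \<lfloor>(x \<bullet> b) / \<delta>\<rfloor>)"

definition cell :: "real \<Rightarrow> ('a::euclidean_space \<Rightarrow> int) \<Rightarrow> 'a set" where
  "cell \<delta> z = {x. \<forall>b\<in>Basis. \<lfloor>(x \<bullet> b) / \<delta>\<rfloor> = z b}"

lemma mem_cell_iff: "z \<in> extensional Basis \<Longrightarrow> x \<in> cell \<delta> z \<longleftrightarrow> grid \<delta> x = z"
  by (auto simp: cell_def grid_def extensional_def fun_eq_iff restrict_def)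

lemma measurable_cell [measurable]: "cell \<delta> z \<in> sets borel"
  unfolding cell_def by measurable

lemma emeasure_cell:
  fixes z :: "'a::euclidean_space \<Rightarrow> int"
  assumes "\<delta> > 0"
  shows "emeasure lborel (cell \<delta> z) = ennreal (\<delta> ^ DIM('a))"
proof (rule antisym)
  define a where "a = (\<Sum>b\<in>Basis. (\<delta> * of_int (z b)) *\<^sub>R b :: 'a)"
  define e where "e = a + \<delta> *\<^sub>R One"
  have a: "a \<bullet> b = \<delta> * of_int (z b)" "e \<bullet> b = \<delta> * of_int (z b) + \<delta>" if "b \<in> Basis" for b
    using that by (auto simp: a_def e_def inner_add_left)
  have floor: "\<lfloor>y / \<delta>\<rfloor> = k \<longleftrightarrow> \<delta> * of_int k \<le> y \<and> y < \<delta> * of_int k + \<delta>" for y and k :: int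
    using assms by (simp add: floor_eq_iff field_simps)
  have sub: "box a e \<subseteq> cell \<delta> z" "cell \<delta> z \<subseteq> cbox a e"
    by (auto simp: cell_def mem_box a floor less_imp_le)
  have prod: "(\<Prod>b\<in>Basis. (e - a) \<bullet> b) = \<delta> ^ DIM('a)" by (simp add: inner_diff_left a)
  have le: "\<forall>b\<in>Basis. a \<bullet> b \<le> e \<bullet> b" using assms by (simp add: a)
  have "emeasure lborel (cell \<delta> z) \<le> emeasure lborel (cbox a e)" using sub by (intro emeasure_mono) auto
  then show "emeasure lborel (cell \<delta> z) \<le> ennreal (\<delta> ^ DIM('a))"
    using le by (simp add: emeasure_lborel_cbox_eq prod)
  have "emeasure lborel (box a e) \<le> emeasure lborel (cell \<delta> z)" using sub by (intro emeasure_mono) auto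
  then show "ennreal (\<delta> ^ DIM('a)) \<le> emeasure lborel (cell \<delta> z)"
    using le by (simp add: emeasure_lborel_box_eq prod)
qed

lemma grid_eq_imp_near:
  fixes x y :: "'a::euclidean_space"
  assumes "\<delta> > 0" "grid \<delta> x = grid \<delta> y"
  shows "norm (y - x) \<le> real DIM('a) * \<delta>"
proof -
  have "\<bar>(y - x) \<bullet> b\<bar> \<le> \<delta>" if b: "b \<in> Basis" for b
  proof -
    have "\<lfloor>(x \<bullet> b) / \<delta>\<rfloor> = \<lfloor>(y \<bullet> b) / \<delta>\<rfloor>"
      using fun_cong[OF assms(2), of b] b by (simp add: grid_def)
    then have "\<bar>(y \<bullet> b) / \<delta> - (x \<bullet> b) / \<delta>\<bar> < 1"
      using floor_correct[of "(x \<bullet> b) / \<delta>"] floor_correct[of "(y \<bullet> b) / \<delta>"] by linarith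
    moreover have "(y \<bullet> b) / \<delta> - (x \<bullet> b) / \<delta> = ((y - x) \<bullet> b) / \<delta>"
      by (simp add: inner_diff_left diff_divide_distrib)
    ultimately show ?thesis using assms(1) by (simp add: abs_divide divide_less_eq)
  qed
  then have "(\<Sum>b\<in>Basis. \<bar>(y - x) \<bullet> b\<bar>) \<le> real DIM('a) * \<delta>"
    by (rule sum_bounded_above)
  then show ?thesis using norm_le_l1[of "y - x"] by simp
qed

lemma finite_grid:
  assumes "\<delta> > 0" "bounded B"
  shows "finite (grid \<delta> ` B)"
proof -
  obtain R where R: "\<And>x. x \<in> B \<Longrightarrow> norm x \<le> R" using assms(2) by (auto simp: bounded_iff)
  define M where "M = \<lceil>\<bar>R\<bar> / \<delta>\<rceil> + 1"
  have "grid \<delta> ` B \<subseteq> (\<Pi>\<^sub>E b\<in>Basis. {-M..M})"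
  proof (clarsimp simp: grid_def PiE_iff)
    fix x b :: 'a assume x: "x \<in> B" and b: "b \<in> Basis"
    have "\<bar>x \<bullet> b\<bar> \<le> \<bar>R\<bar>" using R[OF x] Basis_le_norm[OF b, of x] by linarith
    then have "\<bar>(x \<bullet> b) / \<delta>\<bar> \<le> \<bar>R\<bar> / \<delta>" using assms(1) by (simp add: abs_divide divide_right_mono)
    then show "- M \<le> \<lfloor>(x \<bullet> b) / \<delta>\<rfloor> \<and> \<lfloor>(x \<bullet> b) / \<delta>\<rfloor> \<le> M"
      unfolding M_def by linarith
  qed
  then show ?thesis by (rule finite_subset) (intro finite_PiE, auto)
qed

text \<open>Two points of the same cell are at distance at most $n \delta$, so the sum of the variances over the
  cells is bounded by the integral of $(D(y) - D(x))^2$ over the strip $|y - x| \le n \delta$, hence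
  by \<open>near_diagonal_L2\<close>. What is not variance is the square of the mean.\<close>

lemma Poincare_cells:
  fixes D :: "'a::euclidean_space \<Rightarrow> real"
  assumes D: "D \<in> test_functions UNIV" and \<delta>: "\<delta> > 0"
    and Z: "finite Z" "Z \<subseteq> extensional Basis" "\<And>x. D x \<noteq> 0 \<Longrightarrow> grid \<delta> x \<in> Z"
  shows "(LINT x|lborel. (D x)\<^sup>2) \<le> (\<Sum>z\<in>Z. (LINT x|lborel. indicator (cell \<delta> z) x * D x)\<^sup>2) / \<delta> ^ DIM('a) +
    real DIM('a) ^ (DIM('a) + 2) * measure lborel (cball (0::'a) 1) / 2 * \<delta>\<^sup>2 * (LINT x|lborel. (norm (grad D x))\<^sup>2)"
proof -
  let ?n = "DIM('a)"
  define v where "v = \<delta> ^ ?n"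
  define \<rho> where "\<rho> = real ?n * \<delta>"
  define E where "E = (LINT x|lborel. (norm (grad D x))\<^sup>2)"
  define I where "I z = (LINT x|lborel. indicator (cell \<delta> z) x * D x)" for z
  define J where "J z = (LINT x|lborel. indicator (cell \<delta> z) x * (D x)\<^sup>2)" for z
  define \<beta> where "\<beta> = measure lborel (cball (0::'a) 1)"
  have v: "v > 0" using \<delta> by (simp add: v_def)
  have \<rho>: "\<rho> > 0" using \<delta> by (simp add: \<rho>_def)
  have E: "E \<ge> 0" "(\<integral>\<^sup>+x. ennreal ((norm (grad D x))\<^sup>2) \<partial>lborel) = ennreal E"
    unfolding E_def using nn_integral_eq_integral[OF integrable_test(3)[OF D]] by auto
  note [measurable] = measurable_test_grad[OF D]
  have ball: "emeasure lborel (cball (0::'a) \<rho>) = ennreal (\<rho> ^ ?n * \<beta>)"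
  proof -
    have "emeasure lborel (cball (0::'a) \<rho>) = ennreal (\<rho> ^ ?n) * emeasure lborel {x. \<rho> *\<^sub>R x \<in> cball (0::'a) \<rho>}"
      by (rule emeasure_lborel_scaled[OF _ \<rho>]) auto
    also have "{x. \<rho> *\<^sub>R x \<in> cball (0::'a) \<rho>} = cball 0 1" using \<rho> by (auto simp: mult_le_cancel_left)
    also have "emeasure lborel (cball (0::'a) 1) = ennreal \<beta>"
      unfolding \<beta>_def by (rule emeasure_eq_ennreal_measure) (use emeasure_lborel_cball_finite[of "0::'a" 1] in auto)
    finally show ?thesis using \<rho> by (simp add: ennreal_mult'' \<beta>_def)
  qed
  have "(\<Sum>z\<in>Z. ennreal (2 * v * J z - 2 * (I z)\<^sup>2)) = (\<Sum>z\<in>Z. \<integral>\<^sup>+x. \<integral>\<^sup>+y.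
      indicator (cell \<delta> z) x * indicator (cell \<delta> z) y * ennreal ((D y - D x)\<^sup>2) \<partial>lborel \<partial>lborel)"
    unfolding I_def J_def
    using cell_variance[OF D measurable_cell emeasure_cell[OF \<delta>]] v by (simp add: v_def)
  also have "\<dots> = (\<integral>\<^sup>+x. \<integral>\<^sup>+y. (\<Sum>z\<in>Z. indicator (cell \<delta> z) x * indicator (cell \<delta> z) y) *
      ennreal ((D y - D x)\<^sup>2) \<partial>lborel \<partial>lborel)"
    by (simp add: nn_integral_sum sum_distrib_right)
  also have "\<dots> \<le> (\<integral>\<^sup>+x. \<integral>\<^sup>+y. indicator (cball 0 \<rho>) (y - x) * ennreal ((D y - D x)\<^sup>2) \<partial>lborel \<partial>lborel)"
  proof (intro nn_integral_mono mult_right_mono)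
    fix x y :: 'a
    have eq: "indicator (cell \<delta> z) x * indicator (cell \<delta> z) y =
        (if z = grid \<delta> x then if grid \<delta> x = grid \<delta> y then 1 else 0 else (0::ennreal))" if "z \<in> Z" for z
      using mem_cell_iff[of z x \<delta>] mem_cell_iff[of z y \<delta>] that Z(2) by (auto simp: indicator_def)
    have "(\<Sum>z\<in>Z. indicator (cell \<delta> z) x * indicator (cell \<delta> z) y) \<le>
        (if grid \<delta> x = grid \<delta> y then 1 else (0::ennreal))"
      using Z(1) by (subst sum.cong[OF refl eq]) (auto simp: sum.delta)
    also have "\<dots> \<le> indicator (cball 0 \<rho>) (y - x)"
      using grid_eq_imp_near[OF \<delta>, of x y] by (auto simp: indicator_def \<rho>_def)
    finally show "(\<Sum>z\<in>Z. indicator (cell \<delta> z) x * indicator (cell \<delta> z) y) \<le> (indicator (cball 0 \<rho>) (y - x) :: ennreal)" .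
  qed auto
  also have "\<dots> \<le> ennreal (\<rho> ^ ?n * \<beta>) * (ennreal (\<rho>\<^sup>2) * ennreal E)"
    using near_diagonal_L2[OF D, of \<rho>] by (simp only: ball E(2))
  also have "\<dots> = ennreal (\<rho> ^ ?n * \<beta> * (\<rho>\<^sup>2 * E))"
    using E \<rho> by (simp add: ennreal_mult'' \<beta>_def ennreal_mult)
  finally have enn: "(\<Sum>z\<in>Z. ennreal (2 * v * J z - 2 * (I z)\<^sup>2)) \<le> ennreal (\<rho> ^ ?n * \<beta> * (\<rho>\<^sup>2 * E))" .
  have "(\<Sum>z\<in>Z. 2 * v * J z - 2 * (I z)\<^sup>2) \<le> (\<Sum>z\<in>Z. max 0 (2 * v * J z - 2 * (I z)\<^sup>2))"
    by (intro sum_mono) simp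
  also have "ennreal \<dots> = (\<Sum>z\<in>Z. ennreal (2 * v * J z - 2 * (I z)\<^sup>2))"
  proof -
    have "ennreal (max 0 r) = ennreal r" for r by (cases "r \<ge> 0") (auto simp: ennreal_neg)
    then show ?thesis using sum_ennreal[of Z "\<lambda>z. max 0 (2 * v * J z - 2 * (I z)\<^sup>2)"] by simp
  qed
  then have "(\<Sum>z\<in>Z. max 0 (2 * v * J z - 2 * (I z)\<^sup>2)) \<le> \<rho> ^ ?n * \<beta> * (\<rho>\<^sup>2 * E)"
  proof -
    assume eq: "ennreal (\<Sum>z\<in>Z. max 0 (2 * v * J z - 2 * (I z)\<^sup>2)) =
      (\<Sum>z\<in>Z. ennreal (2 * v * J z - 2 * (I z)\<^sup>2))"
    have "0 \<le> \<rho> ^ ?n * \<beta> * (\<rho>\<^sup>2 * E)" using E \<rho> by (simp add: \<beta>_def)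
    from enn[folded eq, unfolded ennreal_le_iff[OF this]] show ?thesis .
  qed
  finally have "2 * v * (\<Sum>z\<in>Z. J z) - 2 * (\<Sum>z\<in>Z. (I z)\<^sup>2) \<le> \<rho> ^ ?n * \<beta> * (\<rho>\<^sup>2 * E)"
    by (simp add: sum_subtractf sum_distrib_left)
  also have "\<rho> ^ ?n * \<beta> * (\<rho>\<^sup>2 * E) = 2 * v * (real ?n ^ (?n + 2) * \<beta> / 2 * \<delta>\<^sup>2 * E)"
    by (simp add: \<rho>_def v_def power_mult_distrib power_add power2_eq_square)
  finally have "v * ((\<Sum>z\<in>Z. J z)) \<le> v * ((\<Sum>z\<in>Z. (I z)\<^sup>2) / v + real ?n ^ (?n + 2) * \<beta> / 2 * \<delta>\<^sup>2 * E)"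
    using v by (simp add: distrib_left)
  then have "(\<Sum>z\<in>Z. J z) \<le> (\<Sum>z\<in>Z. (I z)\<^sup>2) / v + real ?n ^ (?n + 2) * \<beta> / 2 * \<delta>\<^sup>2 * E"
    using v by (simp only: mult_le_cancel_left_pos)
  moreover have "(\<Sum>z\<in>Z. J z) = (LINT x|lborel. (D x)\<^sup>2)"
  proof -
    have "integrable lborel (\<lambda>x. indicator (cell \<delta> z) x * (D x)\<^sup>2)" for z
      using integrable_mult_indicator[of "cell \<delta> z" lborel "\<lambda>x. (D x)\<^sup>2"] integrable_test(2)[OF D] by auto
    then have "(\<Sum>z\<in>Z. J z) = (LINT x|lborel. (\<Sum>z\<in>Z. indicator (cell \<delta> z) x * (D x)\<^sup>2))"
      by (simp add: J_def)
    also have "\<dots> = (LINT x|lborel. (D x)\<^sup>2)"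
    proof (rule Bochner_Integration.integral_cong[OF refl])
      fix x
      have eq: "indicator (cell \<delta> z) x * (D x)\<^sup>2 = (if z = grid \<delta> x then (D x)\<^sup>2 else 0)" if "z \<in> Z" for z
        using mem_cell_iff[of z x \<delta>] that Z(2) by (auto simp: indicator_def)
      show "(\<Sum>z\<in>Z. indicator (cell \<delta> z) x * (D x)\<^sup>2) = (D x)\<^sup>2"
        using Z(1) Z(3)[of x] by (subst sum.cong[OF refl eq]) (auto simp: sum.delta)
    qed
    finally show ?thesis .
  qed
  ultimately show ?thesis by (simp add: I_def E_def v_def \<beta>_def)
qed

subsection \<open>Spreading a function on the sphere over a shell\<close>

lemma DERIV_bump: "(bump has_real_derivative grad bump t) (at t)"
  using GDERIV_grad[OF smooth_on_differentiable[OF smooth_on_bump UNIV_I]] by simp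

lemma bump_support: "t \<notin> {1..2} \<Longrightarrow> bump t = 0"
  by (auto simp: bump_zero_iff)

lemma rescaled_bump_support: "R > 0 \<Longrightarrow> t \<notin> {- 2 * R..- R} \<Longrightarrow> bump (- (t / R)) = 0"
  by (intro bump_support) (auto simp: field_simps)

lemma smooth_on_rescaled_bump: "smooth_on UNIV (\<lambda>t. bump (- (t / R)))"
proof -
  have "smooth_on UNIV (\<lambda>t::real. (- (1 / R)) * t)" by (intro smooth_on_mult smooth_on_const smooth_on_ident) auto
  from smooth_on_compose_real[OF smooth_on_bump open_UNIV open_UNIV this] show ?thesis by simp
qed

lemma integrable_bump: "integrable lborel (\<lambda>t. (bump t)\<^sup>2)"
proof (rule integrable_continuous_compact_support[of _ "{1..2}"])
  show "continuous_on UNIV (\<lambda>t. (bump t)\<^sup>2)"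
    by (intro continuous_intros smooth_on_continuous[OF smooth_on_bump])
  fix t :: real assume "t \<notin> {1..2}"
  then show "(bump t)\<^sup>2 = 0" using bump_support[of t] by simp
qed simp

lemma integral_bump_pos: "(LINT t|lborel. (bump t)\<^sup>2) > 0"
proof -
  have "(LINT t|lborel. (bump t)\<^sup>2) \<noteq> 0"
  proof
    assume "(LINT t|lborel. (bump t)\<^sup>2) = 0"
    then have "AE t in lborel. (bump t)\<^sup>2 = 0"
      using integral_nonneg_eq_0_iff_AE[OF integrable_bump] by simp
    then have "AE t in lborel. t \<notin> {1<..<2::real}"
      by eventually_elim (auto simp: bump_zero_iff)
    then have "{1<..<2::real} \<in> null_sets lborel"
      by (subst AE_iff_null_sets) auto
    then have "emeasure lborel {1<..<2::real} = 0" by (rule null_setsD1)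
    moreover have "emeasure lborel {1<..<2::real} = ennreal (2 - 1)"
      by (rule emeasure_lborel_Ioo) simp
    ultimately have "ennreal (2 - 1) = 0" by (simp only:)
    then show False by simp
  qed
  moreover have "(LINT t|lborel. (bump t)\<^sup>2) \<ge> 0" by simp
  ultimately show ?thesis by linarith
qed

lemma sphere_diff_le:
  assumes "\<psi> \<in> sphere_test_functions \<Sigma>" "\<phi> \<in> sphere_test_functions \<Sigma>"
  shows "sphere_mass (\<lambda>\<theta>. \<psi> \<theta> - \<phi> \<theta>) \<le> 2 * sphere_mass \<psi> + 2 * sphere_mass \<phi>"
    and "sphere_energy (\<lambda>\<theta>. \<psi> \<theta> - \<phi> \<theta>) \<le> 2 * sphere_energy \<psi> + 2 * sphere_energy \<phi>"
  using sphere_mass_lincomb[OF assms, of 1 1] sphere_mass_lincomb[OF assms, of 1 "-1"]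
    sphere_energy_lincomb[OF assms, of 1 1] sphere_energy_lincomb[OF assms, of 1 "-1"]
    sphere_mass_nonneg[of "\<lambda>\<theta>. \<psi> \<theta> + \<phi> \<theta>"] sphere_energy_nonneg[of "\<lambda>\<theta>. \<psi> \<theta> + \<phi> \<theta>"]
  by simp_all

lemma sphere_test_functions_diff:
  assumes "\<psi> \<in> sphere_test_functions \<Sigma>" "\<phi> \<in> sphere_test_functions \<Sigma>"
  shows "(\<lambda>\<theta>. \<psi> \<theta> - \<phi> \<theta>) \<in> sphere_test_functions \<Sigma>"
  using sphere_test_functions_lincomb[OF assms, of 1 "-1"] by simp

text \<open>A function on the sphere is spread over the shell $e < |x| < e^2$ by a fixed radial profile. In $L^2$
  and in energy the two functions are comparable, which transfers compactness from Euclidean space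
  to the sphere without charts.\<close>

context
  fixes \<psi> :: "real^'n \<Rightarrow> real" and \<Sigma> :: "(real^'n) set"
  assumes \<psi>: "\<psi> \<in> sphere_test_functions \<Sigma>" and \<Sigma>: "\<Sigma> \<subseteq> sphere 0 1"
begin

lemma shell_test: "separated bump \<psi> \<in> test_functions (- {0})"
  by (rule separated_test[OF smooth_on_bump bump_support DERIV_bump \<psi> \<Sigma>])

lemma shell_support: "separated bump \<psi> x \<noteq> 0 \<Longrightarrow> 1 \<le> norm x \<and> norm x \<le> exp 2"
proof -
  assume "separated bump \<psi> x \<noteq> 0"
  then have "norm x \<noteq> 0" "bump (ln (norm x)) \<noteq> 0" by (auto simp: separated_def)
  then have "norm x > 0" "1 < ln (norm x)" "ln (norm x) < 2" by (auto simp: bump_zero_iff)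
  moreover from this have "exp (ln (norm x)) > exp 0" "exp (ln (norm x)) < exp 2"
    by (simp_all only: exp_less_cancel_iff)
  ultimately show ?thesis by simp
qed

lemma shell_hardy: "(LINT x|lborel. (separated bump \<psi> x)\<^sup>2 / (norm x)\<^sup>2) =
    (LINT t|lborel. (bump t)\<^sup>2) * sphere_mass \<psi>"
  using hardy_integral_emden[OF shell_test]
    mass_separated[OF smooth_on_bump bump_support DERIV_bump \<psi> \<Sigma>] by simp

lemma shell_hardy_integrable: "integrable lborel (\<lambda>x. (separated bump \<psi> x)\<^sup>2 / (norm x)\<^sup>2)"
proof (rule Bochner_Integration.integrable_bound)
  have t: "separated bump \<psi> \<in> test_functions UNIV" by (rule test_functions_mono[OF shell_test]) auto
  show "integrable lborel (\<lambda>x. (separated bump \<psi> x)\<^sup>2)" by (rule integrable_test(2)[OF t])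
  note [measurable] = measurable_test_grad(1)[OF t]
  show "(\<lambda>x. (separated bump \<psi> x)\<^sup>2 / (norm x)\<^sup>2) \<in> borel_measurable lborel" by measurable
  have "norm ((separated bump \<psi> x)\<^sup>2 / (norm x)\<^sup>2) \<le> norm ((separated bump \<psi> x)\<^sup>2)" for x
  proof (cases "separated bump \<psi> x = 0")
    case False
    then have "1 \<le> (norm x)\<^sup>2" using shell_support[of x] by (simp add: one_le_power)
    then show ?thesis by (simp add: divide_le_eq mult_le_cancel_left1)
  qed simp
  then show "AE x in lborel. norm ((separated bump \<psi> x)\<^sup>2 / (norm x)\<^sup>2) \<le> norm ((separated bump \<psi> x)\<^sup>2)" by simp
qed

lemma shell_mass:
  "(LINT t|lborel. (bump t)\<^sup>2) * sphere_mass \<psi> \<le> (LINT x|lborel. (separated bump \<psi> x)\<^sup>2)"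
  "(LINT x|lborel. (separated bump \<psi> x)\<^sup>2) \<le> (exp 2)\<^sup>2 * ((LINT t|lborel. (bump t)\<^sup>2) * sphere_mass \<psi>)"
proof -
  have i: "integrable lborel (\<lambda>x. (separated bump \<psi> x)\<^sup>2)"
    by (rule integrable_test(2)[OF test_functions_mono[OF shell_test]]) auto
  show "(LINT t|lborel. (bump t)\<^sup>2) * sphere_mass \<psi> \<le> (LINT x|lborel. (separated bump \<psi> x)\<^sup>2)"
    unfolding shell_hardy[symmetric]
  proof (rule integral_mono[OF shell_hardy_integrable i])
    fix x
    show "(separated bump \<psi> x)\<^sup>2 / (norm x)\<^sup>2 \<le> (separated bump \<psi> x)\<^sup>2"
    proof (cases "separated bump \<psi> x = 0")
      case False
      then have "1 \<le> (norm x)\<^sup>2" using shell_support[of x] by (simp add: one_le_power)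
      then show ?thesis by (simp add: divide_le_eq mult_le_cancel_left1)
    qed simp
  qed
  have "(LINT x|lborel. (separated bump \<psi> x)\<^sup>2) \<le> (LINT x|lborel. (exp 2)\<^sup>2 * ((separated bump \<psi> x)\<^sup>2 / (norm x)\<^sup>2))"
  proof (rule integral_mono[OF i])
    show "integrable lborel (\<lambda>x. (exp 2)\<^sup>2 * ((separated bump \<psi> x)\<^sup>2 / (norm x)\<^sup>2))"
      by (intro integrable_mult_right shell_hardy_integrable)
    fix x
    show "(separated bump \<psi> x)\<^sup>2 \<le> (exp 2)\<^sup>2 * ((separated bump \<psi> x)\<^sup>2 / (norm x)\<^sup>2)"
    proof (cases "separated bump \<psi> x = 0")
      case False
      then have "1 \<le> norm x" "norm x \<le> exp 2" using shell_support[of x] by auto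
      then have "(norm x)\<^sup>2 \<le> (exp 2)\<^sup>2" "(norm x)\<^sup>2 > 0" by (auto intro: power_mono)
      then have "(separated bump \<psi> x)\<^sup>2 * (norm x)\<^sup>2 \<le> (separated bump \<psi> x)\<^sup>2 * (exp 2)\<^sup>2"
        by (intro mult_left_mono) auto
      then show ?thesis using \<open>(norm x)\<^sup>2 > 0\<close> by (simp add: le_divide_eq mult.commute)
    qed simp
  qed
  also have "\<dots> = (exp 2)\<^sup>2 * (LINT x|lborel. (separated bump \<psi> x)\<^sup>2 / (norm x)\<^sup>2)"
    by (rule integral_mult_right_zero)
  finally show "(LINT x|lborel. (separated bump \<psi> x)\<^sup>2) \<le> (exp 2)\<^sup>2 * ((LINT t|lborel. (bump t)\<^sup>2) * sphere_mass \<psi>)"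
    by (simp only: shell_hardy)
qed

lemma shell_energy:
  "(LINT x|lborel. (norm (grad (separated bump \<psi>) x))\<^sup>2) =
    ((LINT t|lborel. (grad bump t)\<^sup>2) + ((real CARD('n) - 2) / 2)\<^sup>2 * (LINT t|lborel. (bump t)\<^sup>2)) * sphere_mass \<psi> +
    (LINT t|lborel. (bump t)\<^sup>2) * sphere_energy \<psi>"
  using dirichlet_integral_emden[OF shell_test]
    mass_separated[OF smooth_on_bump bump_support DERIV_bump \<psi> \<Sigma>]
    dt_separated[OF smooth_on_bump bump_support DERIV_bump \<psi> \<Sigma>]
    ang_separated[OF smooth_on_bump bump_support DERIV_bump \<psi> \<Sigma>]
  by (simp add: algebra_simps)

end

lemma separated_diff: "separated f (\<lambda>\<theta>. \<psi> \<theta> - \<phi> \<theta>) x = separated f \<psi> x - separated f \<phi> x"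
  by (simp add: separated_def algebra_simps)

text \<open>There are countably many cells of all side lengths $1/(j+1)$, and the integrals of the spread functions
  over each of them are bounded, so a diagonal subsequence makes all of them converge. By
  \<open>Poincare_cells\<close> the $L^2$ distance of two functions is bounded by the differences of these integrals
  over the finitely many cells that meet the shell, up to an error of order $\delta^2$.\<close>

theorem Rellich_sphere:
  fixes \<psi> :: "nat \<Rightarrow> real^'n \<Rightarrow> real"
  assumes \<psi>: "\<And>k. \<psi> k \<in> sphere_test_functions \<Sigma>" and \<Sigma>: "\<Sigma> \<subseteq> sphere 0 1"
    and mass: "\<And>k. sphere_mass (\<psi> k) \<le> B" and energy: "\<And>k. sphere_energy (\<psi> k) \<le> B"
  obtains r :: "nat \<Rightarrow> nat" where "strict_mono r"
    "\<And>e. e > 0 \<Longrightarrow> \<exists>N. \<forall>m\<ge>N. \<forall>k\<ge>N. sphere_mass (\<lambda>\<theta>. \<psi> (r m) \<theta> - \<psi> (r k) \<theta>) < e"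
proof -
  define c0 where "c0 = (LINT t|lborel. (bump t)\<^sup>2)"
  define c1 where "c1 = (LINT t|lborel. (grad bump t)\<^sup>2) + ((real CARD('n) - 2) / 2)\<^sup>2 * c0"
  have c: "c0 > 0" "c1 \<ge> 0" using integral_bump_pos by (auto simp: c0_def c1_def)
  define F where "F k = separated bump (\<psi> k)" for k
  have F: "F k \<in> test_functions UNIV" for k
    unfolding F_def by (rule test_functions_mono[OF shell_test[OF \<psi> \<Sigma>]]) auto
  have d: "(\<lambda>\<theta>. \<psi> m \<theta> - \<psi> k \<theta>) \<in> sphere_test_functions \<Sigma>" for m k
    by (rule sphere_test_functions_diff[OF \<psi> \<psi>])
  define D where "D m k = separated bump (\<lambda>\<theta>. \<psi> m \<theta> - \<psi> k \<theta>)" for m k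
  have D: "D m k \<in> test_functions UNIV" for m k
    unfolding D_def by (rule test_functions_mono[OF shell_test[OF d \<Sigma>]]) auto
  have DF: "D m k x = F m x - F k x" for m k x by (simp add: D_def F_def separated_diff)
  have D_mass: "c0 * sphere_mass (\<lambda>\<theta>. \<psi> m \<theta> - \<psi> k \<theta>) \<le> (LINT x|lborel. (D m k x)\<^sup>2)" for m k
    unfolding D_def c0_def by (rule shell_mass(1)[OF d \<Sigma>])
  have D_energy: "(LINT x|lborel. (norm (grad (D m k) x))\<^sup>2) \<le> (c1 + c0) * (4 * B)" for m k
  proof -
    have "sphere_mass (\<lambda>\<theta>. \<psi> m \<theta> - \<psi> k \<theta>) \<le> 4 * B" "sphere_energy (\<lambda>\<theta>. \<psi> m \<theta> - \<psi> k \<theta>) \<le> 4 * B"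
      using sphere_diff_le[OF \<psi>[of m] \<psi>[of k]] mass[of m] mass[of k] energy[of m] energy[of k] by auto
    then have "c1 * sphere_mass (\<lambda>\<theta>. \<psi> m \<theta> - \<psi> k \<theta>) + c0 * sphere_energy (\<lambda>\<theta>. \<psi> m \<theta> - \<psi> k \<theta>) \<le>
        c1 * (4 * B) + c0 * (4 * B)"
      using c by (intro add_mono mult_left_mono) auto
    then show ?thesis
      unfolding D_def shell_energy[OF d \<Sigma>] by (simp add: c0_def[symmetric] c1_def algebra_simps)
  qed
  define I where "I k p = (LINT x|lborel. indicator (cell (1 / real (Suc (fst p))) (snd p)) x * F k x)"
    for k and p :: "nat \<times> (real^'n \<Rightarrow> int)"
  \<comment> \<open>from $|F| \le 1 + F^2$ on the ball that contains the shell\<close>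
  define M where "M = measure lborel (cball (0::real^'n) (exp 2)) + (exp 2)\<^sup>2 * (c0 * B)"
  have I_bound: "norm (I k p) \<le> M" for k p
  proof -
    let ?Q = "cell (1 / real (Suc (fst p))) (snd p)"
    have i: "integrable lborel (\<lambda>x. indicator (cball (0::real^'n) (exp 2)) x + (F k x)\<^sup>2)"
      using integrable_test(2)[OF F] emeasure_lborel_cball_finite[of "0::real^'n" "exp 2"] by auto
    have "norm (I k p) \<le> (LINT x|lborel. norm (indicator ?Q x * F k x))"
      unfolding I_def by (rule integral_norm_bound)
    also have "\<dots> \<le> (LINT x|lborel. indicator (cball (0::real^'n) (exp 2)) x + (F k x)\<^sup>2)"
    proof (rule integral_mono[OF _ i])
      show "integrable lborel (\<lambda>x. norm (indicator ?Q x * F k x))"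
        using integrable_mult_indicator[of ?Q lborel "F k"] integrable_test(1)[OF F] by auto
      fix x
      show "norm (indicator ?Q x * F k x) \<le> indicator (cball (0::real^'n) (exp 2)) x + (F k x)\<^sup>2"
      proof (cases "F k x = 0")
        case False
        then have "x \<in> cball 0 (exp 2)" using shell_support[OF \<psi> \<Sigma>, of k x] by (simp add: F_def)
        moreover have "\<bar>F k x\<bar> \<le> 1 + (F k x)\<^sup>2"
          using sum_squares_bound[of 1 "\<bar>F k x\<bar>"] by simp
        moreover have "norm (indicator ?Q x * F k x) \<le> \<bar>F k x\<bar>" by (auto simp: indicator_def)
        ultimately show ?thesis by simp
      qed simp
    qed
    also have "\<dots> = measure lborel (cball (0::real^'n) (exp 2)) + (LINT x|lborel. (F k x)\<^sup>2)"
      using integrable_test(2)[OF F] emeasure_lborel_cball_finite[of "0::real^'n" "exp 2"] by simp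
    also have "(LINT x|lborel. (F k x)\<^sup>2) \<le> (exp 2)\<^sup>2 * (c0 * B)"
    proof -
      have "(LINT x|lborel. (F k x)\<^sup>2) \<le> (exp 2)\<^sup>2 * (c0 * sphere_mass (\<psi> k))"
        unfolding F_def c0_def by (rule shell_mass(2)[OF \<psi> \<Sigma>])
      also have "\<dots> \<le> (exp 2)\<^sup>2 * (c0 * B)"
        using mass[of k] c by (intro mult_left_mono) auto
      finally show ?thesis .
    qed
    finally show ?thesis by (simp add: M_def)
  qed
  define S where "S = (UNIV :: nat set) \<times> (\<Pi>\<^sub>E b\<in>(Basis :: (real^'n) set). (UNIV :: int set))"
  have "countable S" unfolding S_def by (intro countable_SIGMA countable_PiE) auto
  then obtain r
    where r: "strict_mono r" and conv: "\<And>p. p \<in> S \<Longrightarrow> \<exists>l. (\<lambda>k. I (r k) p) \<longlonglongrightarrow> l"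
    by (rule function_convergent_subsequence[where f=I and M=M and S=S, OF _ I_bound]) (erule that, blast)
  define l where "l p = lim (\<lambda>k. I (r k) p)" for p
  have l: "(\<lambda>k. I (r k) p) \<longlonglongrightarrow> l p" if "p \<in> S" for p
    using conv[OF that] unfolding l_def by (metis limI)
  show thesis
  proof (rule that[OF r])
    fix e :: real assume e: "e > 0"
    \<comment> \<open>the coefficient of $\delta^2$ in \<open>Poincare_cells\<close> for a difference of two of the functions\<close>
    define K where "K = real CARD('n) ^ (CARD('n) + 2) * measure lborel (cball (0::real^'n) 1) / 2 * ((c1 + c0) * (4 * B))"
    obtain j :: nat where j: "\<bar>K\<bar> / (c0 * e / 2) < real j" using reals_Archimedean2 by blast
    define \<delta> where "\<delta> = 1 / real (Suc j)"
    have \<delta>: "\<delta> > 0" "\<delta> \<le> 1" by (auto simp: \<delta>_def)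
    have K\<delta>: "K * \<delta>\<^sup>2 < c0 * e / 2"
    proof -
      have "K * \<delta>\<^sup>2 \<le> \<bar>K\<bar> * \<delta>"
        using \<delta> by (intro mult_mono) (auto simp: power2_eq_square mult_left_le_one_le)
      also have "\<dots> < c0 * e / 2"
      proof -
        have "\<bar>K\<bar> < (c0 * e / 2) * real j" using j c e by (simp add: divide_less_eq mult.commute)
        also have "\<dots> \<le> (c0 * e / 2) * real (Suc j)" using c e by (intro mult_left_mono) auto
        finally show ?thesis by (simp add: \<delta>_def divide_less_eq mult.commute)
      qed
      finally show ?thesis .
    qed
    define Z where "Z = grid \<delta> ` cball (0::real^'n) (exp 2)"
    have Z: "finite Z" "Z \<subseteq> extensional Basis"
      unfolding Z_def using finite_grid[OF \<delta>(1)] by (auto simp: grid_def)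
    have ZS: "(j, z) \<in> S" if "z \<in> Z" for z
      using Z(2) that by (auto simp: S_def PiE_def)
    define s where "s k = (\<Sum>z\<in>Z. (I (r k) (j, z) - l (j, z))\<^sup>2)" for k
    have "s \<longlonglongrightarrow> (\<Sum>z\<in>Z. (l (j, z) - l (j, z))\<^sup>2)"
      unfolding s_def by (intro tendsto_intros l ZS)
    then have "s \<longlonglongrightarrow> 0" by simp
    then obtain N where N: "\<And>k. k \<ge> N \<Longrightarrow> \<bar>s k\<bar> < \<delta> ^ CARD('n) * (c0 * e / 8)"
      using LIMSEQ_D[of s 0 "\<delta> ^ CARD('n) * (c0 * e / 8)"] \<delta> c e by auto
    have "sphere_mass (\<lambda>\<theta>. \<psi> (r m) \<theta> - \<psi> (r k) \<theta>) < e" if m: "m \<ge> N" and k: "k \<ge> N" for m k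
    proof -
      let ?D = "D (r m) (r k)"
      have "?D x = 0 \<or> grid \<delta> x \<in> Z" for x
      proof (cases "?D x = 0")
        case False
        then have "x \<in> cball 0 (exp 2)" using shell_support[OF d \<Sigma>, of "r m" "r k" x] by (simp add: D_def)
        then show ?thesis by (simp add: Z_def)
      qed simp
      then have "(LINT x|lborel. (?D x)\<^sup>2) \<le> (\<Sum>z\<in>Z. (LINT x|lborel. indicator (cell \<delta> z) x * ?D x)\<^sup>2) / \<delta> ^ CARD('n) +
          real CARD('n) ^ (CARD('n) + 2) * measure lborel (cball (0::real^'n) 1) / 2 * \<delta>\<^sup>2 *
          (LINT x|lborel. (norm (grad ?D x))\<^sup>2)"
        using Poincare_cells[OF D[of "r m" "r k"] \<delta>(1) Z] by auto
      also have "\<dots> \<le> (\<Sum>z\<in>Z. (LINT x|lborel. indicator (cell \<delta> z) x * ?D x)\<^sup>2) / \<delta> ^ CARD('n) + K * \<delta>\<^sup>2"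
      proof -
        have "real CARD('n) ^ (CARD('n) + 2) * measure lborel (cball (0::real^'n) 1) / 2 * \<delta>\<^sup>2 *
            (LINT x|lborel. (norm (grad ?D x))\<^sup>2) \<le>
            real CARD('n) ^ (CARD('n) + 2) * measure lborel (cball (0::real^'n) 1) / 2 * \<delta>\<^sup>2 * ((c1 + c0) * (4 * B))"
          by (intro mult_left_mono D_energy) auto
        then show ?thesis by (simp add: K_def mult.commute mult.left_commute)
      qed
      also have "(\<Sum>z\<in>Z. (LINT x|lborel. indicator (cell \<delta> z) x * ?D x)\<^sup>2) \<le> 2 * s m + 2 * s k"
      proof -
        have "(LINT x|lborel. indicator (cell \<delta> z) x * ?D x) = I (r m) (j, z) - I (r k) (j, z)" for z
        proof -
          have i: "integrable lborel (\<lambda>x. indicator (cell \<delta> z) x * F k x)" for k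
            using integrable_mult_indicator[of "cell \<delta> z" lborel "F k"] integrable_test(1)[OF F] by auto
          show ?thesis using i by (simp add: DF I_def \<delta>_def right_diff_distrib)
        qed
        then have "(\<Sum>z\<in>Z. (LINT x|lborel. indicator (cell \<delta> z) x * ?D x)\<^sup>2) =
            (\<Sum>z\<in>Z. (I (r m) (j, z) - I (r k) (j, z))\<^sup>2)" by simp
        also have "\<dots> \<le> (\<Sum>z\<in>Z. 2 * (I (r m) (j, z) - l (j, z))\<^sup>2 + 2 * (I (r k) (j, z) - l (j, z))\<^sup>2)"
        proof (rule sum_mono)
          fix z
          define a b where "a = I (r m) (j, z) - l (j, z)" and "b = I (r k) (j, z) - l (j, z)"
          have "(a - b)\<^sup>2 \<le> 2 * a\<^sup>2 + 2 * b\<^sup>2"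
            using zero_le_power2[of "a + b"] by (simp add: power2_eq_square algebra_simps)
          then show "(I (r m) (j, z) - I (r k) (j, z))\<^sup>2 \<le>
              2 * (I (r m) (j, z) - l (j, z))\<^sup>2 + 2 * (I (r k) (j, z) - l (j, z))\<^sup>2"
            by (simp add: a_def b_def)
        qed
        also have "\<dots> = 2 * s m + 2 * s k" by (simp add: s_def sum.distrib sum_distrib_left)
        finally show ?thesis .
      qed
      also have "2 * s m + 2 * s k \<le> \<delta> ^ CARD('n) * (c0 * e / 2)"
        using N[OF m] N[OF k] by (simp add: field_simps)
      finally have "(LINT x|lborel. (?D x)\<^sup>2) \<le> \<delta> ^ CARD('n) * (c0 * e / 2) / \<delta> ^ CARD('n) + K * \<delta>\<^sup>2"
        using \<delta> by (simp add: divide_right_mono)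
      also have "\<dots> < c0 * e" using \<delta> K\<delta> by simp
      finally have "c0 * sphere_mass (\<lambda>\<theta>. \<psi> (r m) \<theta> - \<psi> (r k) \<theta>) < c0 * e"
        using D_mass[of "r m" "r k"] by linarith
      then show ?thesis using c by simp
    qed
    then show "\<exists>N. \<forall>m\<ge>N. \<forall>k\<ge>N. sphere_mass (\<lambda>\<theta>. \<psi> (r m) \<theta> - \<psi> (r k) \<theta>) < e" by blast
  qed
qed

section \<open>The first Dirichlet eigenvalue\<close>

definition rayleigh :: "(real^'n) set \<Rightarrow> real" where
  "rayleigh \<Sigma> = (INF \<psi> \<in> {\<psi> \<in> sphere_test_functions \<Sigma>. sphere_mass \<psi> > 0}. sphere_energy \<psi> / sphere_mass \<psi>)"

lemma rayleigh_le:
  assumes "\<psi> \<in> sphere_test_functions \<Sigma>"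
  shows "rayleigh \<Sigma> * sphere_mass \<psi> \<le> sphere_energy \<psi>"
proof (cases "sphere_mass \<psi> > 0")
  case True
  have "bdd_below ((\<lambda>\<psi>. sphere_energy \<psi> / sphere_mass \<psi>) ` {\<psi> \<in> sphere_test_functions \<Sigma>. sphere_mass \<psi> > 0})"
    by (rule bdd_belowI[of _ 0]) (auto intro!: divide_nonneg_pos sphere_energy_nonneg)
  then have "rayleigh \<Sigma> \<le> sphere_energy \<psi> / sphere_mass \<psi>"
    unfolding rayleigh_def using assms True by (intro cINF_lower) auto
  then show ?thesis using True by (simp add: le_divide_eq)
next
  case False
  then show ?thesis using sphere_mass_nonneg[of \<psi>] sphere_energy_nonneg[of \<psi>] by simp
qed

lemma sphere_test_functions_cmult:
  "\<psi> \<in> sphere_test_functions \<Sigma> \<Longrightarrow> (\<lambda>\<theta>. a * \<psi> \<theta>) \<in> sphere_test_functions \<Sigma>"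
  "\<psi> \<in> sphere_test_functions \<Sigma> \<Longrightarrow> sphere_mass (\<lambda>\<theta>. a * \<psi> \<theta>) = a\<^sup>2 * sphere_mass \<psi>"
  "\<psi> \<in> sphere_test_functions \<Sigma> \<Longrightarrow> sphere_energy (\<lambda>\<theta>. a * \<psi> \<theta>) = a\<^sup>2 * sphere_energy \<psi>"
  using sphere_test_functions_lincomb[of \<psi> \<Sigma> \<psi> a 0] sphere_mass_lincomb[of \<psi> \<Sigma> \<psi> a 0]
    sphere_energy_lincomb[of \<psi> \<Sigma> \<psi> a 0] by auto

lemma rayleigh_approx:
  assumes "sphere_domain \<Sigma>" "\<epsilon> > 0"
  shows "\<exists>\<psi> \<in> sphere_test_functions \<Sigma>. sphere_mass \<psi> = 1 \<and> sphere_energy \<psi> < rayleigh \<Sigma> + \<epsilon>"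
proof -
  have "{\<psi> \<in> sphere_test_functions \<Sigma>. sphere_mass \<psi> > 0} \<noteq> {}"
    using exists_sphere_test_function[OF assms(1)] by blast
  moreover have "bdd_below ((\<lambda>\<psi>. sphere_energy \<psi> / sphere_mass \<psi>) ` {\<psi> \<in> sphere_test_functions \<Sigma>. sphere_mass \<psi> > 0})"
    by (rule bdd_belowI[of _ 0]) (auto intro!: divide_nonneg_pos sphere_energy_nonneg)
  ultimately obtain \<psi> where \<psi>: "\<psi> \<in> sphere_test_functions \<Sigma>" "sphere_mass \<psi> > 0"
    "sphere_energy \<psi> / sphere_mass \<psi> < rayleigh \<Sigma> + \<epsilon>"
    using cINF_less_iff[of "{\<psi> \<in> sphere_test_functions \<Sigma>. sphere_mass \<psi> > 0}"
        "\<lambda>\<psi>. sphere_energy \<psi> / sphere_mass \<psi>" "rayleigh \<Sigma> + \<epsilon>"] assms(2)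
    by (auto simp: rayleigh_def)
  define a where "a = 1 / sqrt (sphere_mass \<psi>)"
  have a2: "a\<^sup>2 = 1 / sphere_mass \<psi>" using \<psi>(2) by (simp add: a_def power_divide)
  show ?thesis
    by (rule bexI[of _ "\<lambda>\<theta>. a * \<psi> \<theta>"]) (use \<psi> a2 in \<open>auto simp: sphere_test_functions_cmult\<close>)
qed

lemma rayleigh_nonneg: "sphere_domain \<Sigma> \<Longrightarrow> rayleigh \<Sigma> \<ge> 0"
proof (rule ccontr)
  assume "sphere_domain \<Sigma>" "\<not> rayleigh \<Sigma> \<ge> 0"
  then obtain \<psi> where "\<psi> \<in> sphere_test_functions \<Sigma>" "sphere_energy \<psi> < rayleigh \<Sigma> + (- rayleigh \<Sigma>)"
    using rayleigh_approx[of \<Sigma> "- rayleigh \<Sigma>"] by auto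
  then show False using sphere_energy_nonneg[of \<psi>] by simp
qed

text \<open>The first-order condition at the minimum $t = 0$ of a quadratic function.\<close>

lemma quadratic_nonneg_imp_zero:
  fixes K c :: real
  assumes "\<And>t. 0 \<le> t\<^sup>2 * K + 2 * t * c"
  shows "c = 0"
proof (rule ccontr)
  assume c: "c \<noteq> 0"
  have K: "K \<ge> 0" using assms[of 1] assms[of "-1"] by simp
  define t where "t = - c / (K + 1)"
  have ct: "c = - t * (K + 1)" using K by (simp add: t_def field_simps)
  have "t\<^sup>2 * K + 2 * t * c = - (t\<^sup>2 * (K + 2))"
    unfolding ct by (simp add: power2_eq_square algebra_simps)
  moreover have "t \<noteq> 0" using c K by (simp add: t_def)
  then have "t\<^sup>2 * (K + 2) > 0" using K by simp
  ultimately show False using assms[of t] by simp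
qed

lemma sphere_mass_set_integral:
  assumes "sphere_domain \<Sigma>" "\<psi> \<in> sphere_test_functions \<Sigma>"
    and that: "\<phi>' \<in> borel_measurable borel" "\<And>\<theta>. \<theta> \<in> \<Sigma> \<Longrightarrow> \<phi>' \<theta> = \<phi> \<theta>" "\<And>\<theta>. \<theta> \<notin> \<Sigma> \<Longrightarrow> \<phi>' \<theta> = 0"
  shows "(LINT \<theta>:\<Sigma>|surface_measure. (\<psi> \<theta> - \<phi> \<theta>)\<^sup>2) =
    (LINT \<theta>|surface_measure. (norm (\<psi> (sgn \<theta>) - \<phi>' \<theta>))\<^sup>2)"
proof (rule set_integral_sphere[OF assms(1)])
  note [measurable] = measurable_sphere_test_function[OF assms(2)] that(1)
  show "(\<lambda>\<theta>. (norm (\<psi> (sgn \<theta>) - \<phi>' \<theta>))\<^sup>2) \<in> borel_measurable borel" by measurable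
qed (use that sphere_test_functions_zero[OF assms(2)] in \<open>auto simp: sgn_unit\<close>)

lemma sphere_energy_set_integral:
  assumes "sphere_domain \<Sigma>" "\<psi> \<in> sphere_test_functions \<Sigma>"
    and that: "G' \<in> borel_measurable borel" "\<And>\<theta>. \<theta> \<in> \<Sigma> \<Longrightarrow> G' \<theta> = G \<theta>" "\<And>\<theta>. \<theta> \<notin> \<Sigma> \<Longrightarrow> G' \<theta> = 0"
  shows "(LINT \<theta>:\<Sigma>|surface_measure. (norm (sphere_grad \<psi> \<theta> - G \<theta>))\<^sup>2) =
    (LINT \<theta>|surface_measure. (norm (sphere_grad \<psi> \<theta> - G' \<theta>))\<^sup>2)"
proof (rule set_integral_sphere[OF assms(1)])
  note [measurable] = measurable_sphere_test_function[OF assms(2)] that(1)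
  show "(\<lambda>\<theta>. (norm (sphere_grad \<psi> \<theta> - G' \<theta>))\<^sup>2) \<in> borel_measurable borel" by measurable
qed (use that sphere_grad_zero[OF assms(2)] in auto)

lemma weak_form_set_integral:
  assumes "sphere_domain \<Sigma>" "\<psi> \<in> sphere_test_functions \<Sigma>"
    and "G' \<in> borel_measurable borel" "\<And>\<theta>. \<theta> \<in> \<Sigma> \<Longrightarrow> G' \<theta> = G \<theta>"
    and "\<phi>' \<in> borel_measurable borel" "\<And>\<theta>. \<theta> \<in> \<Sigma> \<Longrightarrow> \<phi>' \<theta> = \<phi> \<theta>"
  shows "(LINT \<theta>:\<Sigma>|surface_measure. G \<theta> \<bullet> sphere_grad \<psi> \<theta>) = (LINT \<theta>|surface_measure. sphere_grad \<psi> \<theta> \<bullet> G' \<theta>)"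
    and "(LINT \<theta>:\<Sigma>|surface_measure. \<phi> \<theta> * \<psi> \<theta>) = (LINT \<theta>|surface_measure. \<psi> (sgn \<theta>) \<bullet> \<phi>' \<theta>)"
proof -
  note [measurable] = measurable_sphere_test_function[OF assms(2)] assms(3,5)
  show "(LINT \<theta>:\<Sigma>|surface_measure. G \<theta> \<bullet> sphere_grad \<psi> \<theta>) = (LINT \<theta>|surface_measure. sphere_grad \<psi> \<theta> \<bullet> G' \<theta>)"
    by (rule set_integral_sphere[OF assms(1)])
      (use assms sphere_grad_zero[OF assms(2)] in \<open>auto simp: inner_commute\<close>)
  show "(LINT \<theta>:\<Sigma>|surface_measure. \<phi> \<theta> * \<psi> \<theta>) = (LINT \<theta>|surface_measure. \<psi> (sgn \<theta>) \<bullet> \<phi>' \<theta>)"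
    by (rule set_integral_sphere[OF assms(1)])
      (use assms sphere_test_functions_zero[OF assms(2)] in \<open>auto simp: sgn_unit\<close>)
qed

text \<open>A normalised minimising sequence can be chosen to be Cauchy in $L^2$ by compactness. By the
  parallelogram identity the energy of a difference is twice the sum of the energies minus the energy of the sum,
  and the latter is bounded from below through the Rayleigh quotient; so the gradients are Cauchy as
  well.\<close>

lemma rayleigh_minimizer:
  fixes \<Sigma> :: "(real^'n) set"
  assumes \<Sigma>: "sphere_domain \<Sigma>"
  shows "\<exists>(w :: nat \<Rightarrow> real^'n \<Rightarrow> real) \<phi> G. (\<forall>k. w k \<in> sphere_test_functions \<Sigma>) \<and>
    \<phi> \<in> borel_measurable borel \<and> G \<in> borel_measurable borel \<and>
    integrable surface_measure (\<lambda>\<theta>. (norm (\<phi> \<theta> :: real))\<^sup>2) \<and>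
    integrable surface_measure (\<lambda>\<theta>. (norm (G \<theta>))\<^sup>2) \<and>
    (\<forall>k. sphere_mass (w k) = 1) \<and> (\<lambda>k. sphere_energy (w k)) \<longlonglongrightarrow> rayleigh \<Sigma> \<and>
    (\<lambda>k. LINT \<theta>|surface_measure. (norm (w k (sgn \<theta>) - \<phi> \<theta>))\<^sup>2) \<longlonglongrightarrow> 0 \<and>
    (\<lambda>k. LINT \<theta>|surface_measure. (norm (sphere_grad (w k) \<theta> - G \<theta>))\<^sup>2) \<longlonglongrightarrow> 0"
proof -
  let ?m = "rayleigh \<Sigma>"
  have "\<exists>\<psi> \<in> sphere_test_functions \<Sigma>. sphere_mass \<psi> = 1 \<and> sphere_energy \<psi> < ?m + 1 / real (Suc k)" for k
    by (rule rayleigh_approx[OF \<Sigma>]) simp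
  then obtain \<psi> where \<psi>: "\<And>k. \<psi> k \<in> sphere_test_functions \<Sigma>" "\<And>k. sphere_mass (\<psi> k) = 1"
    "\<And>k. sphere_energy (\<psi> k) < ?m + 1 / real (Suc k)" by metis
  have b: "sphere_mass (\<psi> k) \<le> ?m + 1" "sphere_energy (\<psi> k) \<le> ?m + 1" for k
  proof -
    have "1 / real (Suc k) \<le> 1" by simp
    then show "sphere_energy (\<psi> k) \<le> ?m + 1" using \<psi>(3)[of k] by linarith
    show "sphere_mass (\<psi> k) \<le> ?m + 1" using \<psi>(2)[of k] rayleigh_nonneg[OF \<Sigma>] by simp
  qed
  obtain r where r: "strict_mono (r :: nat \<Rightarrow> nat)" and cauchy:
    "\<And>e. e > 0 \<Longrightarrow> \<exists>N. \<forall>m\<ge>N. \<forall>k\<ge>N. sphere_mass (\<lambda>\<theta>. \<psi> (r m) \<theta> - \<psi> (r k) \<theta>) < e"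
    by (rule Rellich_sphere[where \<psi> = \<psi>, OF \<psi>(1) sphere_domain_subset[OF \<Sigma>] b]) (erule that, blast)
  define w where "w k = \<psi> (r k)" for k
  have w: "w k \<in> sphere_test_functions \<Sigma>" "sphere_mass (w k) = 1" for k
    by (simp_all add: w_def \<psi>)
  note d = sphere_test_functions_diff[OF w(1) w(1)]
  have en: "sphere_energy (w k) < ?m + 1 / real (Suc k)" for k
  proof -
    have "1 / real (Suc (r k)) \<le> 1 / real (Suc k)"
      using seq_suble[OF r, of k] by (intro divide_left_mono) auto
    then show ?thesis using \<psi>(3)[of "r k"] by (simp add: w_def)
  qed
  have en': "?m \<le> sphere_energy (w k)" for k
    using rayleigh_le[OF w(1)[of k]] w(2)[of k] by simp
  have mass_diff: "sphere_mass (\<lambda>\<theta>. w m \<theta> - w k \<theta>) =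
      (LINT \<theta>|surface_measure. (norm (w m (sgn \<theta>) - w k (sgn \<theta>)))\<^sup>2)" for m k
    by (simp add: sphere_mass_def)
  have energy_diff: "sphere_energy (\<lambda>\<theta>. w m \<theta> - w k \<theta>) =
      (LINT \<theta>|surface_measure. (norm (sphere_grad (w m) \<theta> - sphere_grad (w k) \<theta>))\<^sup>2)" for m k
    unfolding sphere_energy_def
  proof (rule integral_cong_AE)
    note [measurable] = measurable_sphere_test_function[OF d] measurable_sphere_test_function[OF w(1)]
    show "(\<lambda>\<theta>. (norm (sphere_grad (\<lambda>\<theta>. w m \<theta> - w k \<theta>) \<theta>))\<^sup>2) \<in> borel_measurable surface_measure"
      "(\<lambda>\<theta>. (norm (sphere_grad (w m) \<theta> - sphere_grad (w k) \<theta>))\<^sup>2) \<in> borel_measurable surface_measure"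
      by measurable
    show "AE \<theta> in surface_measure. (norm (sphere_grad (\<lambda>\<theta>. w m \<theta> - w k \<theta>) \<theta>))\<^sup>2 =
        (norm (sphere_grad (w m) \<theta> - sphere_grad (w k) \<theta>))\<^sup>2"
      using AE_surface_nonzero
    proof eventually_elim
      case (elim \<theta>)
      then show ?case using sphere_grad_lincomb[OF w(1)[of m] w(1)[of k] elim, of 1 "-1"] by simp
    qed
  qed
  have energy_le: "sphere_energy (\<lambda>\<theta>. w m \<theta> - w k \<theta>) \<le>
      2 / real (Suc m) + 2 / real (Suc k) + ?m * sphere_mass (\<lambda>\<theta>. w m \<theta> - w k \<theta>)" for m k
  proof -
    have s: "(\<lambda>\<theta>. w m \<theta> + w k \<theta>) \<in> sphere_test_functions \<Sigma>"
      using sphere_test_functions_lincomb[OF w(1) w(1), of 1 m 1 k] by simp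
    have "sphere_energy (\<lambda>\<theta>. w m \<theta> - w k \<theta>) =
        2 * sphere_energy (w m) + 2 * sphere_energy (w k) - sphere_energy (\<lambda>\<theta>. w m \<theta> + w k \<theta>)"
      using sphere_energy_lincomb[OF w(1)[of m] w(1)[of k], of 1 1]
        sphere_energy_lincomb[OF w(1)[of m] w(1)[of k], of 1 "-1"] by simp
    moreover have mp: "sphere_mass (\<lambda>\<theta>. w m \<theta> + w k \<theta>) = 4 - sphere_mass (\<lambda>\<theta>. w m \<theta> - w k \<theta>)"
      using sphere_mass_lincomb[OF w(1)[of m] w(1)[of k], of 1 1]
        sphere_mass_lincomb[OF w(1)[of m] w(1)[of k], of 1 "-1"] w(2)[of m] w(2)[of k] by simp
    moreover have "2 * sphere_energy (w m) \<le> 2 * ?m + 2 / real (Suc m)"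
      "2 * sphere_energy (w k) \<le> 2 * ?m + 2 / real (Suc k)"
      using en[of m] en[of k] by auto
    moreover have "4 * ?m - ?m * sphere_mass (\<lambda>\<theta>. w m \<theta> - w k \<theta>) \<le> sphere_energy (\<lambda>\<theta>. w m \<theta> + w k \<theta>)"
      using rayleigh_le[OF s] unfolding mp by (simp add: right_diff_distrib)
    ultimately show ?thesis by linarith
  qed
  have fin: "finite_measure (surface_measure :: (real^'n) measure)"
    by (rule finite_measure_surface_measure)
  obtain \<phi> where \<phi>: "\<phi> \<in> borel_measurable surface_measure"
    "integrable surface_measure (\<lambda>\<theta>. (norm (\<phi> \<theta>))\<^sup>2)"
    "(\<lambda>k. LINT \<theta>|surface_measure. (norm (w k (sgn \<theta>) - \<phi> \<theta>))\<^sup>2) \<longlonglongrightarrow> 0"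
  proof (rule L2_complete[OF fin, of "\<lambda>k \<theta>. w k (sgn \<theta>)"])
    show "(\<lambda>\<theta>. w k (sgn \<theta>)) \<in> borel_measurable surface_measure" for k
      using measurable_sphere_test_function(1)[OF w(1)] by simp
    show "integrable surface_measure (\<lambda>\<theta>. (norm (w k (sgn \<theta>)))\<^sup>2)" for k
      using integrable_sphere_test_functions(1)[OF w(1) w(1)] by simp
    show "\<exists>N. \<forall>m\<ge>N. \<forall>k\<ge>N. (LINT \<theta>|surface_measure. (norm (w m (sgn \<theta>) - w k (sgn \<theta>)))\<^sup>2) < e" if "e > 0" for e
      using cauchy[OF that] unfolding mass_diff[symmetric] by (simp add: w_def)
  qed (rule that)
  obtain G where G: "G \<in> borel_measurable surface_measure"
    "integrable surface_measure (\<lambda>\<theta>. (norm (G \<theta>))\<^sup>2)"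
    "(\<lambda>k. LINT \<theta>|surface_measure. (norm (sphere_grad (w k) \<theta> - G \<theta>))\<^sup>2) \<longlonglongrightarrow> 0"
  proof (rule L2_complete[OF fin, of "\<lambda>k. sphere_grad (w k)"])
    show "sphere_grad (w k) \<in> borel_measurable surface_measure" for k
      using measurable_sphere_test_function(2)[OF w(1)] by simp
    show "integrable surface_measure (\<lambda>\<theta>. (norm (sphere_grad (w k) \<theta>))\<^sup>2)" for k
      by (rule integrable_sphere_test_functions(3)[OF w(1) w(1)])
    fix e :: real assume e: "e > 0"
    define e' where "e' = e / (2 * (?m + 1))"
    have e': "e' > 0" "?m * e' \<le> e / 2"
      using e rayleigh_nonneg[OF \<Sigma>] by (auto simp: e'_def field_simps)
    obtain N1 where N1: "\<And>m k. m \<ge> N1 \<Longrightarrow> k \<ge> N1 \<Longrightarrow> sphere_mass (\<lambda>\<theta>. w m \<theta> - w k \<theta>) < e'"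
      using cauchy[OF e'(1)] unfolding w_def by blast
    obtain N2 :: nat where N2: "8 / e < real N2" using reals_Archimedean2 by blast
    have small: "2 / real (Suc m) < e / 4" if "m \<ge> N2" for m
    proof -
      have "8 / e < real (Suc m)" using N2 that by simp
      then show ?thesis using e by (simp add: field_simps)
    qed
    have "(LINT \<theta>|surface_measure. (norm (sphere_grad (w m) \<theta> - sphere_grad (w k) \<theta>))\<^sup>2) < e"
      if "m \<ge> max N1 N2" "k \<ge> max N1 N2" for m k
    proof -
      have "?m * sphere_mass (\<lambda>\<theta>. w m \<theta> - w k \<theta>) \<le> ?m * e'"
        using N1[of m k] that rayleigh_nonneg[OF \<Sigma>] by (intro mult_left_mono) auto
      then show ?thesis
        using energy_le[of m k] small[of m] small[of k] that e'(2) unfolding energy_diff[symmetric] by auto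
    qed
    then show "\<exists>N. \<forall>m\<ge>N. \<forall>k\<ge>N. (LINT \<theta>|surface_measure. (norm (sphere_grad (w m) \<theta> - sphere_grad (w k) \<theta>))\<^sup>2) < e"
      by blast
  qed (rule that)
  have lim: "(\<lambda>k. sphere_energy (w k)) \<longlonglongrightarrow> ?m"
  proof (rule tendsto_sandwich[of "\<lambda>k. ?m" _ _ "\<lambda>k. ?m + 1 / real (Suc k)"])
    show "(\<lambda>k. ?m + 1 / real (Suc k)) \<longlonglongrightarrow> ?m"
      using tendsto_add[OF tendsto_const LIMSEQ_inverse_real_of_nat, of ?m] by (simp add: inverse_eq_divide)
  qed (use en en' in \<open>auto simp: less_imp_le intro!: always_eventually\<close>)
  show ?thesis
    using w \<phi> G lim by (intro exI[of _ w] exI[of _ \<phi>] exI[of _ G] conjI allI) simp_all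
qed

text \<open>An $L^2$ limit of functions that vanish off $\Sigma$ may be cut off at $\Sigma$; this makes it
  indifferent whether one integrates over $\Sigma$ or over the sphere.\<close>

lemma L2_truncate:
  fixes f :: "nat \<Rightarrow> real^'n \<Rightarrow> 'b::euclidean_space"
  assumes [measurable]: "\<And>k. f k \<in> borel_measurable borel" "g \<in> borel_measurable borel" "\<Sigma> \<in> sets borel"
    and int: "\<And>k. integrable surface_measure (\<lambda>\<theta>. (norm (f k \<theta>))\<^sup>2)" "integrable surface_measure (\<lambda>\<theta>. (norm (g \<theta>))\<^sup>2)"
    and zero: "\<And>k \<theta>. norm \<theta> = 1 \<Longrightarrow> \<theta> \<notin> \<Sigma> \<Longrightarrow> f k \<theta> = 0"
    and lim: "(\<lambda>k. LINT \<theta>|surface_measure. (norm (f k \<theta> - g \<theta>))\<^sup>2) \<longlonglongrightarrow> 0"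
  shows "integrable surface_measure (\<lambda>\<theta>. (norm (indicator \<Sigma> \<theta> *\<^sub>R g \<theta>))\<^sup>2)"
    and "(\<lambda>k. LINT \<theta>|surface_measure. (norm (f k \<theta> - indicator \<Sigma> \<theta> *\<^sub>R g \<theta>))\<^sup>2) \<longlonglongrightarrow> 0"
proof -
  show ig: "integrable surface_measure (\<lambda>\<theta>. (norm (indicator \<Sigma> \<theta> *\<^sub>R g \<theta>))\<^sup>2)"
    by (rule Bochner_Integration.integrable_bound[OF int(2)]) (auto simp: indicator_def)
  have le: "(LINT \<theta>|surface_measure. (norm (f k \<theta> - indicator \<Sigma> \<theta> *\<^sub>R g \<theta>))\<^sup>2) \<le>
      (LINT \<theta>|surface_measure. (norm (f k \<theta> - g \<theta>))\<^sup>2)" for k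
  proof (rule integral_mono_AE)
    have "(\<lambda>\<theta>. indicator \<Sigma> \<theta> *\<^sub>R g \<theta>) \<in> borel_measurable surface_measure" by measurable
    then show "integrable surface_measure (\<lambda>\<theta>. (norm (f k \<theta> - indicator \<Sigma> \<theta> *\<^sub>R g \<theta>))\<^sup>2)"
      by (intro L2_integrable_diff int ig) auto
    show "integrable surface_measure (\<lambda>\<theta>. (norm (f k \<theta> - g \<theta>))\<^sup>2)"
      by (intro L2_integrable_diff int) auto
    show "AE \<theta> in surface_measure. (norm (f k \<theta> - indicator \<Sigma> \<theta> *\<^sub>R g \<theta>))\<^sup>2 \<le> (norm (f k \<theta> - g \<theta>))\<^sup>2"
      using AE_surface_measure_norm
    proof eventually_elim
      case (elim \<theta>)
      then show ?case using zero[of \<theta> k] by (cases "\<theta> \<in> \<Sigma>") auto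
    qed
  qed
  show "(\<lambda>k. LINT \<theta>|surface_measure. (norm (f k \<theta> - indicator \<Sigma> \<theta> *\<^sub>R g \<theta>))\<^sup>2) \<longlonglongrightarrow> 0"
    by (rule tendsto_sandwich[of "\<lambda>k. 0", OF _ always_eventually tendsto_const lim]) (use le in auto)
qed

text \<open>The Euler--Lagrange equation. Testing \<open>rayleigh_le\<close> with $w_k + t \eta$ and letting $k \to \infty$ gives a quadratic
  polynomial in $t$ that is nonnegative and vanishes at $t = 0$; its linear coefficient is the
  defect in the weak equation.\<close>

lemma dirichlet_eigenvalue_rayleigh:
  fixes \<Sigma> :: "(real^'n) set"
  assumes \<Sigma>: "sphere_domain \<Sigma>"
  shows "dirichlet_eigenvalue \<Sigma> (rayleigh \<Sigma>)"
proof -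
  let ?m = "rayleigh \<Sigma>"
  obtain w \<phi>0 G0 where w: "\<And>k::nat. w k \<in> sphere_test_functions \<Sigma>"
    and m0: "\<phi>0 \<in> borel_measurable borel" "G0 \<in> borel_measurable borel"
    and i0: "integrable surface_measure (\<lambda>\<theta>. (norm (\<phi>0 \<theta>))\<^sup>2)" "integrable surface_measure (\<lambda>\<theta>. (norm (G0 \<theta>))\<^sup>2)"
    and mass: "\<And>k. sphere_mass (w k) = 1" and energy: "(\<lambda>k. sphere_energy (w k)) \<longlonglongrightarrow> ?m"
    and l0: "(\<lambda>k. LINT \<theta>|surface_measure. (norm (w k (sgn \<theta>) - \<phi>0 \<theta>))\<^sup>2) \<longlonglongrightarrow> 0"
      "(\<lambda>k. LINT \<theta>|surface_measure. (norm (sphere_grad (w k) \<theta> - G0 \<theta>))\<^sup>2) \<longlonglongrightarrow> 0"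
    using rayleigh_minimizer[OF \<Sigma>] by blast
  note mt = measurable_sphere_test_function
  note it = integrable_sphere_test_functions
  have it1: "integrable surface_measure (\<lambda>\<theta>. (norm (\<psi> (sgn \<theta>)))\<^sup>2)" if "\<psi> \<in> sphere_test_functions \<Sigma>" for \<psi>
    using it(1)[OF that that] by simp
  define \<phi> where "\<phi> \<theta> = indicator \<Sigma> \<theta> *\<^sub>R \<phi>0 \<theta>" for \<theta>
  define G where "G \<theta> = indicator \<Sigma> \<theta> *\<^sub>R G0 \<theta>" for \<theta>
  note bS = sphere_domain_borel[OF \<Sigma>]
  have m: "\<phi> \<in> borel_measurable borel" "G \<in> borel_measurable borel"
    unfolding \<phi>_def G_def using m0 bS by measurable
  have i: "integrable surface_measure (\<lambda>\<theta>. (norm (\<phi> \<theta>))\<^sup>2)"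
    and l: "(\<lambda>k. LINT \<theta>|surface_measure. (norm (w k (sgn \<theta>) - \<phi> \<theta>))\<^sup>2) \<longlonglongrightarrow> 0"
    unfolding \<phi>_def
    by (rule L2_truncate[OF mt(1)[OF w] m0(1) bS it1[OF w] i0(1) _ l0(1)];
        simp add: sgn_unit sphere_test_functions_zero[OF w])+
  have iG: "integrable surface_measure (\<lambda>\<theta>. (norm (G \<theta>))\<^sup>2)"
    and lG: "(\<lambda>k. LINT \<theta>|surface_measure. (norm (sphere_grad (w k) \<theta> - G \<theta>))\<^sup>2) \<longlonglongrightarrow> 0"
    unfolding G_def
    by (rule L2_truncate[OF mt(2)[OF w] m0(2) bS it(3)[OF w w] i0(2) _ l0(2)];
        simp add: sphere_grad_zero[OF w])+
  have H10: "sphere_H10 \<Sigma> \<phi> G"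
    unfolding sphere_H10_def
  proof (intro conjI m exI[of _ w] allI w)
    show "set_integrable surface_measure \<Sigma> (\<lambda>\<theta>. (\<phi> \<theta>)\<^sup>2)"
      using integrable_mult_indicator[OF _ i, of \<Sigma>] bS by (simp add: set_integrable_def)
    show "set_integrable surface_measure \<Sigma> (\<lambda>\<theta>. (norm (G \<theta>))\<^sup>2)"
      using integrable_mult_indicator[OF _ iG, of \<Sigma>] bS by (simp add: set_integrable_def)
    show "(\<lambda>k. LINT \<theta>:\<Sigma>|surface_measure. (w k \<theta> - \<phi> \<theta>)\<^sup>2) \<longlonglongrightarrow> 0"
      using l by (subst sphere_mass_set_integral[OF \<Sigma> w m(1)]) (auto simp: \<phi>_def)
    show "(\<lambda>k. LINT \<theta>:\<Sigma>|surface_measure. (norm (sphere_grad (w k) \<theta> - G \<theta>))\<^sup>2) \<longlonglongrightarrow> 0"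
      using lG by (subst sphere_energy_set_integral[OF \<Sigma> w m(2)]) (auto simp: G_def)
  qed
  have mS: "(\<lambda>\<theta>. \<psi> (sgn \<theta>)) \<in> borel_measurable surface_measure" "sphere_grad \<psi> \<in> borel_measurable surface_measure"
    if "\<psi> \<in> sphere_test_functions \<Sigma>" for \<psi> using mt[OF that] by simp_all
  have mS': "\<phi> \<in> borel_measurable surface_measure" "G \<in> borel_measurable surface_measure" using m by simp_all
  have nonzero: "\<not> (AE \<theta> in surface_measure. \<theta> \<in> \<Sigma> \<longrightarrow> \<phi> \<theta> = 0)"
  proof
    assume "AE \<theta> in surface_measure. \<theta> \<in> \<Sigma> \<longrightarrow> \<phi> \<theta> = 0"
    then have "AE \<theta> in surface_measure. (norm (\<phi> \<theta>))\<^sup>2 = 0"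
      by eventually_elim (auto simp: \<phi>_def indicator_def)
    then have "(LINT \<theta>|surface_measure. (norm (\<phi> \<theta>))\<^sup>2) = 0"
      by (simp add: integral_eq_zero_AE)
    moreover have "(\<lambda>k. LINT \<theta>|surface_measure. (norm (w k (sgn \<theta>)))\<^sup>2) \<longlonglongrightarrow> (LINT \<theta>|surface_measure. (norm (\<phi> \<theta>))\<^sup>2)"
      by (rule L2_tendsto_norm[OF mS(1)[OF w] mS'(1) mS'(1) it1[OF w] i i l])
    moreover have "(LINT \<theta>|surface_measure. (norm (w k (sgn \<theta>)))\<^sup>2) = 1" for k
      using mass[of k] by (simp add: sphere_mass_def)
    ultimately show False by (simp add: LIMSEQ_const_iff)
  qed
  have weak: "(LINT \<theta>:\<Sigma>|surface_measure. G \<theta> \<bullet> sphere_grad \<eta> \<theta>) = ?m * (LINT \<theta>:\<Sigma>|surface_measure. \<phi> \<theta> * \<eta> \<theta>)"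
    if \<eta>: "\<eta> \<in> sphere_test_functions \<Sigma>" for \<eta>
  proof -
    define a where "a = (LINT \<theta>|surface_measure. G \<theta> \<bullet> sphere_grad \<eta> \<theta>)"
    define b where "b = (LINT \<theta>|surface_measure. \<phi> \<theta> \<bullet> \<eta> (sgn \<theta>))"
    define ak where "ak k = (LINT \<theta>|surface_measure. sphere_grad (w k) \<theta> \<bullet> sphere_grad \<eta> \<theta>)" for k
    define bk where "bk k = (LINT \<theta>|surface_measure. w k (sgn \<theta>) \<bullet> \<eta> (sgn \<theta>))" for k
    have la: "ak \<longlonglongrightarrow> a" unfolding ak_def a_def
      by (rule L2_tendsto_inner[OF mS(2)[OF w] mS'(2) mS(2)[OF \<eta>] it(3)[OF w w] iG it(3)[OF \<eta> \<eta>] lG])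
    have lb: "bk \<longlonglongrightarrow> b" unfolding bk_def b_def
      by (rule L2_tendsto_inner[OF mS(1)[OF w] mS'(1) mS(1)[OF \<eta>] it1[OF w] i it1[OF \<eta>] l])
    have "0 \<le> t\<^sup>2 * (sphere_energy \<eta> - ?m * sphere_mass \<eta>) + 2 * t * (a - ?m * b)" for t
    proof -
      have "0 \<le> (sphere_energy (w k) + t\<^sup>2 * sphere_energy \<eta> + 2 * t * ak k) -
          ?m * (1 + t\<^sup>2 * sphere_mass \<eta> + 2 * t * bk k)" for k
        using rayleigh_le[OF sphere_test_functions_lincomb[OF w[of k] \<eta>, of 1 t]]
          sphere_energy_lincomb[OF w[of k] \<eta>, of 1 t] sphere_mass_lincomb[OF w[of k] \<eta>, of 1 t] mass[of k]
        by (simp add: ak_def bk_def)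
      moreover have "(\<lambda>k. (sphere_energy (w k) + t\<^sup>2 * sphere_energy \<eta> + 2 * t * ak k) -
          ?m * (1 + t\<^sup>2 * sphere_mass \<eta> + 2 * t * bk k)) \<longlonglongrightarrow>
          (?m + t\<^sup>2 * sphere_energy \<eta> + 2 * t * a) - ?m * (1 + t\<^sup>2 * sphere_mass \<eta> + 2 * t * b)"
        by (intro tendsto_intros energy la lb)
      ultimately have "0 \<le> (?m + t\<^sup>2 * sphere_energy \<eta> + 2 * t * a) - ?m * (1 + t\<^sup>2 * sphere_mass \<eta> + 2 * t * b)"
        by (intro LIMSEQ_le_const) auto
      then show ?thesis by (simp add: algebra_simps)
    qed
    then have "a - ?m * b = 0" by (rule quadratic_nonneg_imp_zero)
    moreover have "(LINT \<theta>:\<Sigma>|surface_measure. G \<theta> \<bullet> sphere_grad \<eta> \<theta>) = a"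
      unfolding a_def using weak_form_set_integral(1)[OF \<Sigma> \<eta> m(2) refl m(1) refl] by (simp add: inner_commute)
    moreover have "(LINT \<theta>:\<Sigma>|surface_measure. \<phi> \<theta> * \<eta> \<theta>) = b"
      unfolding b_def using weak_form_set_integral(2)[OF \<Sigma> \<eta> m(2) refl m(1) refl] by (simp add: mult.commute)
    ultimately show ?thesis by simp
  qed
  show ?thesis
    unfolding dirichlet_eigenvalue_def using H10 nonzero weak by blast
qed

text \<open>Testing the weak equation with the approximations of the eigenfunction itself shows that its energy is
  $c$ times its mass; the bound by the Rayleigh quotient passes to the limit.\<close>

lemma rayleigh_le_dirichlet_eigenvalue:
  fixes \<Sigma> :: "(real^'n) set"
  assumes \<Sigma>: "sphere_domain \<Sigma>" and "dirichlet_eigenvalue \<Sigma> c"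
  shows "rayleigh \<Sigma> \<le> c"
proof -
  obtain \<phi>0 G0 where H10: "sphere_H10 \<Sigma> \<phi>0 G0" and nonzero: "\<not> (AE \<theta> in surface_measure. \<theta> \<in> \<Sigma> \<longrightarrow> \<phi>0 \<theta> = 0)"
    and weak: "\<And>\<psi>. \<psi> \<in> sphere_test_functions \<Sigma> \<Longrightarrow>
      (LINT \<theta>:\<Sigma>|surface_measure. G0 \<theta> \<bullet> sphere_grad \<psi> \<theta>) = c * (LINT \<theta>:\<Sigma>|surface_measure. \<phi>0 \<theta> * \<psi> \<theta>)"
    using assms(2) unfolding dirichlet_eigenvalue_def by blast
  obtain w where w: "\<And>k::nat. w k \<in> sphere_test_functions \<Sigma>"
    and l0: "(\<lambda>k. LINT \<theta>:\<Sigma>|surface_measure. (w k \<theta> - \<phi>0 \<theta>)\<^sup>2) \<longlonglongrightarrow> 0"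
      "(\<lambda>k. LINT \<theta>:\<Sigma>|surface_measure. (norm (sphere_grad (w k) \<theta> - G0 \<theta>))\<^sup>2) \<longlonglongrightarrow> 0"
    and m0: "\<phi>0 \<in> borel_measurable borel" "G0 \<in> borel_measurable borel"
    and i0: "set_integrable surface_measure \<Sigma> (\<lambda>\<theta>. (\<phi>0 \<theta>)\<^sup>2)" "set_integrable surface_measure \<Sigma> (\<lambda>\<theta>. (norm (G0 \<theta>))\<^sup>2)"
    using H10 unfolding sphere_H10_def by blast
  define \<phi> where "\<phi> \<theta> = indicator \<Sigma> \<theta> *\<^sub>R \<phi>0 \<theta>" for \<theta>
  define G where "G \<theta> = indicator \<Sigma> \<theta> *\<^sub>R G0 \<theta>" for \<theta>
  note bS = sphere_domain_borel[OF \<Sigma>]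
  have m: "\<phi> \<in> borel_measurable borel" "G \<in> borel_measurable borel"
    unfolding \<phi>_def G_def using m0 bS by measurable
  have eq: "\<phi> \<theta> = \<phi>0 \<theta>" "G \<theta> = G0 \<theta>" if "\<theta> \<in> \<Sigma>" for \<theta> using that by (auto simp: \<phi>_def G_def)
  have zero: "\<phi> \<theta> = 0" "G \<theta> = 0" if "\<theta> \<notin> \<Sigma>" for \<theta> using that by (auto simp: \<phi>_def G_def)
  have i: "integrable surface_measure (\<lambda>\<theta>. (norm (\<phi> \<theta>))\<^sup>2)" "integrable surface_measure (\<lambda>\<theta>. (norm (G \<theta>))\<^sup>2)"
  proof -
    have "(norm (\<phi> \<theta>))\<^sup>2 = indicator \<Sigma> \<theta> *\<^sub>R (\<phi>0 \<theta>)\<^sup>2" "(norm (G \<theta>))\<^sup>2 = indicator \<Sigma> \<theta> *\<^sub>R (norm (G0 \<theta>))\<^sup>2" for \<theta>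
      by (cases "\<theta> \<in> \<Sigma>"; simp add: \<phi>_def G_def)+
    then show "integrable surface_measure (\<lambda>\<theta>. (norm (\<phi> \<theta>))\<^sup>2)" "integrable surface_measure (\<lambda>\<theta>. (norm (G \<theta>))\<^sup>2)"
      using i0 unfolding set_integrable_def by (simp_all only:)
  qed
  have l: "(\<lambda>k. LINT \<theta>|surface_measure. (norm (w k (sgn \<theta>) - \<phi> \<theta>))\<^sup>2) \<longlonglongrightarrow> 0"
    "(\<lambda>k. LINT \<theta>|surface_measure. (norm (sphere_grad (w k) \<theta> - G \<theta>))\<^sup>2) \<longlonglongrightarrow> 0"
    using l0 sphere_mass_set_integral[OF \<Sigma> w m(1) eq(1) zero(1)]
      sphere_energy_set_integral[OF \<Sigma> w m(2) eq(2) zero(2)] by simp_all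
  note mt = measurable_sphere_test_function[OF w]
  note it = integrable_sphere_test_functions[OF w w]
  have mS: "(\<lambda>\<theta>. w k (sgn \<theta>)) \<in> borel_measurable surface_measure" "sphere_grad (w k) \<in> borel_measurable surface_measure"
    "\<phi> \<in> borel_measurable surface_measure" "G \<in> borel_measurable surface_measure" for k using mt m by simp_all
  have it1: "integrable surface_measure (\<lambda>\<theta>. (norm (w k (sgn \<theta>)))\<^sup>2)" for k using it(1) by simp
  have mass: "(\<lambda>k. sphere_mass (w k)) \<longlonglongrightarrow> (LINT \<theta>|surface_measure. (norm (\<phi> \<theta>))\<^sup>2)"
    using L2_tendsto_norm[OF mS(1,3,3) it1 i(1) i(1) l(1)] by (simp add: sphere_mass_def)
  have energy: "(\<lambda>k. sphere_energy (w k)) \<longlonglongrightarrow> (LINT \<theta>|surface_measure. (norm (G \<theta>))\<^sup>2)"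
    using L2_tendsto_norm[OF mS(2,4,4) it(3) i(2) i(2) l(2)] by (simp add: sphere_energy_def)
  have weak': "(LINT \<theta>|surface_measure. sphere_grad (w k) \<theta> \<bullet> G \<theta>) = c * (LINT \<theta>|surface_measure. w k (sgn \<theta>) \<bullet> \<phi> \<theta>)" for k
    using weak[OF w] weak_form_set_integral[OF \<Sigma> w m(2) eq(2) m(1) eq(1), of k] by simp
  have 1: "(\<lambda>k. LINT \<theta>|surface_measure. sphere_grad (w k) \<theta> \<bullet> G \<theta>) \<longlonglongrightarrow> (LINT \<theta>|surface_measure. G \<theta> \<bullet> G \<theta>)"
    by (rule L2_tendsto_inner[OF mS(2,4,4) it(3) i(2) i(2) l(2)])
  have 2: "(\<lambda>k. LINT \<theta>|surface_measure. w k (sgn \<theta>) \<bullet> \<phi> \<theta>) \<longlonglongrightarrow> (LINT \<theta>|surface_measure. \<phi> \<theta> \<bullet> \<phi> \<theta>)"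
    by (rule L2_tendsto_inner[OF mS(1,3,3) it1 i(1) i(1) l(1)])
  have "(\<lambda>k. LINT \<theta>|surface_measure. sphere_grad (w k) \<theta> \<bullet> G \<theta>) \<longlonglongrightarrow> c * (LINT \<theta>|surface_measure. \<phi> \<theta> \<bullet> \<phi> \<theta>)"
    unfolding weak' by (intro tendsto_intros 2)
  then have "(LINT \<theta>|surface_measure. (norm (G \<theta>))\<^sup>2) = c * (LINT \<theta>|surface_measure. (norm (\<phi> \<theta>))\<^sup>2)"
    using LIMSEQ_unique[OF 1] by (simp only: power2_norm_eq_inner)
  moreover have "rayleigh \<Sigma> * (LINT \<theta>|surface_measure. (norm (\<phi> \<theta>))\<^sup>2) \<le> (LINT \<theta>|surface_measure. (norm (G \<theta>))\<^sup>2)"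
    by (rule LIMSEQ_le[OF tendsto_mult_left[OF mass] energy]) (use rayleigh_le[OF w] in auto)
  moreover have "(LINT \<theta>|surface_measure. (norm (\<phi> \<theta>))\<^sup>2) > 0"
  proof -
    have "(LINT \<theta>|surface_measure. (norm (\<phi> \<theta>))\<^sup>2) \<noteq> 0"
    proof
      assume "(LINT \<theta>|surface_measure. (norm (\<phi> \<theta>))\<^sup>2) = 0"
      then have "AE \<theta> in surface_measure. (norm (\<phi> \<theta>))\<^sup>2 = 0"
        using integral_nonneg_eq_0_iff_AE[OF i(1)] by simp
      then have "AE \<theta> in surface_measure. \<theta> \<in> \<Sigma> \<longrightarrow> \<phi>0 \<theta> = 0"
        by eventually_elim (auto simp: \<phi>_def)
      with nonzero show False ..
    qed
    moreover have "(LINT \<theta>|surface_measure. (norm (\<phi> \<theta>))\<^sup>2) \<ge> 0" by simp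
    ultimately show ?thesis by linarith
  qed
  ultimately show ?thesis by (metis mult_le_cancel_right_pos)
qed

theorem mu1_eq_rayleigh:
  assumes "sphere_domain \<Sigma>"
  shows "\<mu>\<^sub>1 \<Sigma> = rayleigh \<Sigma>"
  unfolding \<mu>\<^sub>1_def
  by (intro Least_equality dirichlet_eigenvalue_rayleigh[OF assms] rayleigh_le_dirichlet_eigenvalue[OF assms])


section \<open>The Hardy--Sobolev inequality\<close>

text \<open>The weight $X_1(e^t)$ for $t \le 0$, continued by $1$. The formula for $X_1$ has a pole at $t = 1$, whereas
  this function is continuous on the whole line.\<close>

definition log_weight :: "real \<Rightarrow> real" where
  "log_weight t = 1 / (1 - min t 0)"

lemma log_weight_pos: "log_weight t > 0" and log_weight_le_1: "log_weight t \<le> 1"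
  by (auto simp: log_weight_def min_def)

lemma log_weight_substitution: "s \<le> 0 \<Longrightarrow> log_weight (1 - exp (- s)) = exp s"
  by (simp add: log_weight_def exp_minus inverse_eq_divide min_def)

lemma continuous_on_log_weight [continuous_intros]:
  "continuous_on S f \<Longrightarrow> continuous_on S (\<lambda>x. log_weight (f x))"
  unfolding log_weight_def by (intro continuous_intros) (auto simp: min_def split: if_splits)

lemma log_substitution:
  fixes f :: "real \<Rightarrow> real"
  assumes f: "continuous_on UNIV f" "\<And>t. t \<notin> {a..0} \<Longrightarrow> f t = 0" and a: "a \<le> 0"
  shows "(LINT t|lborel. f t) = (LINT s|lborel. exp (- s) * f (1 - exp (- s)))"
proof -
  define g where "g s = 1 - exp (- s)" for s :: real
  have der: "(g has_real_derivative exp (- s)) (at s)" for s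
    unfolding g_def by (auto intro!: derivative_eq_intros)
  define A where "A = - ln (1 - a)"
  have A: "A \<le> 0" "g A = a" using a by (auto simp: A_def g_def)
  have zero: "f (g s) = 0" if "s \<notin> {A..0}" for s
  proof -
    have "g s \<notin> {g A..0}" using that by (auto simp: g_def)
    then show ?thesis using f(2) A(2) by simp
  qed
  have i: "set_integrable lborel {g A..g 0} f"
    using borel_integrable_compact[of "{g A..g 0}" f] continuous_on_subset[OF f(1)]
    by (simp add: set_integrable_def)
  have "(LINT t|lborel. f t) = (LINT t|lborel. f t * indicator {g A..g 0} t)"
    using f(2) A by (intro Bochner_Integration.integral_cong) (auto simp: indicator_def g_def)
  also have "\<dots> = (LINT s|lborel. f (g s) * exp (- s) * indicator {A..0} s)"
    by (rule integral_substitution(2)[where g = g and a = A and b = 0 and f = f and g' = "\<lambda>s. exp (- s)", OF i])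
      (auto simp: A intro!: der continuous_intros)
  also have "\<dots> = (LINT s|lborel. exp (- s) * f (g s))"
    using zero by (intro Bochner_Integration.integral_cong) (auto simp: indicator_def)
  finally show ?thesis by (simp add: g_def)
qed

text \<open>The image of the substitution is only $t < 1$, which suffices because $F$ vanishes for $t > 0$. The
  function $H$ is a separate argument since the transformed integrand is prescribed on the sphere only.\<close>

lemma cylinder_log_substitution:
  fixes F :: "real \<times> (real^'n) \<Rightarrow> real"
  assumes F: "continuous_on UNIV F" "\<And>t \<theta>. norm \<theta> = 1 \<Longrightarrow> t \<notin> {a..0} \<Longrightarrow> F (t, \<theta>) = 0" and a: "a \<le> 0"
    and H: "continuous_on UNIV H"
      "\<And>s \<theta>. norm \<theta> = 1 \<Longrightarrow> H (s, \<theta>) = exp (- s) * F (1 - exp (- s), \<theta>)"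
  shows "(LINT z|cylinder_measure. F z) = (LINT z|cylinder_measure. H z)"
proof -
  have iF: "integrable cylinder_measure F" by (rule integrable_cylinder_continuous[OF F])
  have iH: "integrable cylinder_measure H"
  proof (rule integrable_cylinder_continuous[OF H(1), of "- ln (1 - a)" 0])
    fix t and \<theta> :: "real^'n" assume \<theta>: "norm \<theta> = 1" and t: "t \<notin> {- ln (1 - a)..0}"
    have "1 - exp (- t) \<notin> {a..0}"
    proof
      assume "1 - exp (- t) \<in> {a..0}"
      then have "exp (- t) \<le> 1 - a" "exp 0 \<le> exp (- t)" by auto
      then have "- t \<le> ln (1 - a)" "t \<le> 0"
        using ln_le_cancel_iff[of "exp (- t)" "1 - a"] a by auto
      with t show False by auto
    qed
    then show "H (t, \<theta>) = 0" using H(2)[OF \<theta>] F(2)[OF \<theta>] by simp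
  qed
  have "(LINT z|cylinder_measure. F z) = (LINT \<theta>|surface_measure. LINT t|lborel. F (t, \<theta>))"
    using cylinder.integral_snd[of "\<lambda>t \<theta>. F (t, \<theta>)"] iF by simp
  also have "\<dots> = (LINT \<theta>|surface_measure. LINT s|lborel. H (s, \<theta>))"
  proof (rule integral_cong_AE)
    show "(\<lambda>\<theta>. LINT t|lborel. F (t, \<theta>)) \<in> borel_measurable surface_measure"
      using cylinder.integrable_snd[of "\<lambda>t \<theta>. F (t, \<theta>)"] iF by simp
    show "(\<lambda>\<theta>. LINT t|lborel. H (t, \<theta>)) \<in> borel_measurable surface_measure"
      using cylinder.integrable_snd[of "\<lambda>t \<theta>. H (t, \<theta>)"] iH by simp
    show "AE \<theta> in surface_measure. (LINT t|lborel. F (t, \<theta>)) = (LINT s|lborel. H (s, \<theta>))"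
      using AE_surface_measure_norm
    proof eventually_elim
      case (elim \<theta>)
      have "continuous_on UNIV (\<lambda>t. F (t, \<theta>))"
        by (rule continuous_on_compose2[OF F(1)]) (auto intro!: continuous_intros)
      from log_substitution[OF this F(2)[OF elim] a] show ?case by (simp add: H(2)[OF elim])
    qed
  qed
  also have "\<dots> = (LINT z|cylinder_measure. H z)"
    using cylinder.integral_snd[of "\<lambda>t \<theta>. H (t, \<theta>)"] iH by simp
  finally show ?thesis .
qed

text \<open>In logarithmic variables the radial map $x \mapsto X_1(|x|) \, x/|x|$ of the punctured ball is
  $t \mapsto s$ with $t = 1 - e^{-s}$. The power of $|z|$ is chosen such that the Emden--Fowler transforms
  $v$ of $u$ and $w$ of its image satisfy $w(s, \theta) = e^{s/2} v(t, \theta)$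
  (\<open>emden_log_transform\<close>), that is, $v = (1-t)^{1/2} w$ with the ground state of the one-dimensional
  Hardy operator.\<close>

definition log_transform :: "(real^'n \<Rightarrow> real) \<Rightarrow> real^'n \<Rightarrow> real" where
  "log_transform u z = norm z powr (1/2 - (real CARD('n) - 2) / 2) * emden u (1 - inverse (norm z)) (sgn z)"

lemma emden_log_transform:
  fixes u :: "real^'n \<Rightarrow> real"
  assumes "norm \<theta> = 1"
  shows "emden (log_transform u) s \<theta> = exp (s / 2) * emden u (1 - exp (- s)) \<theta>"
proof -
  have "exp ((real CARD('n) - 2) / 2 * s) * exp s powr (1/2 - (real CARD('n) - 2) / 2) = exp (s / 2)"
    by (simp add: powr_def exp_add[symmetric] field_simps)
  then show ?thesis using assms
    by (simp add: emden_def[of "log_transform u"] log_transform_def sgn_scaleR sgn_unit exp_minus mult.assoc[symmetric])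
qed

context
  fixes u :: "real^'n \<Rightarrow> real" and \<Sigma> :: "(real^'n) set"
  assumes u: "u \<in> test_functions (trunc_cone \<Sigma>)"
begin

lemma u_punctured: "u \<in> test_functions (- {0})"
  by (rule test_functions_trunc_cone[OF u])

lemma log_support_bound: obtains a where "a \<le> 0"
  "\<And>t \<theta>. norm \<theta> = 1 \<Longrightarrow> t \<notin> {a..0} \<Longrightarrow> exp t *\<^sub>R \<theta> \<notin> closure {x. u x \<noteq> 0}"
proof -
  obtain a b where ab: "\<And>t \<theta>. norm \<theta> = 1 \<Longrightarrow> t \<notin> {a..b} \<Longrightarrow> exp t *\<^sub>R \<theta> \<notin> closure {x. u x \<noteq> 0}"
    using test_functions_annulus[OF u_punctured] by metis
  show thesis
  proof (rule that[of "min a 0"])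
    fix t and \<theta> :: "real^'n" assume \<theta>: "norm \<theta> = 1" and t: "t \<notin> {min a 0..0}"
    show "exp t *\<^sub>R \<theta> \<notin> closure {x. u x \<noteq> 0}"
    proof (cases "t > 0")
      case True
      then have "exp t *\<^sub>R \<theta> \<notin> trunc_cone \<Sigma>" using \<theta> by (simp add: trunc_cone_def)
      then show ?thesis using u by (auto simp: test_functions_def)
    next
      case False
      with t have "t \<notin> {a..b}" by (auto simp: min_def split: if_splits)
      then show ?thesis by (rule ab[OF \<theta>])
    qed
  qed simp
qed

text \<open>The support $e^a \le |x| \le 1$ is mapped to $1/(1-a) \le |z| \le 1$, away from the origin.\<close>

lemma log_transform_test: "log_transform u \<in> test_functions (- {0})"
proof -
  let ?W = "log_transform u"
  obtain a where a: "a \<le> 0"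
    and z: "\<And>t \<theta>. norm \<theta> = 1 \<Longrightarrow> t \<notin> {a..0} \<Longrightarrow> exp t *\<^sub>R \<theta> \<notin> closure {x. u x \<noteq> 0}"
    by (rule log_support_bound) blast
  define \<rho> where "\<rho> = 1 / (1 - a)"
  have \<rho>: "\<rho> > 0" using a by (simp add: \<rho>_def)
  define K where "K = cball (0::real^'n) 1 - ball 0 \<rho>"
  have K: "compact K" "K \<subseteq> - {0}" using \<rho> by (auto simp: K_def compact_diff)
  have supp: "{x. ?W x \<noteq> 0} \<subseteq> K"
  proof
    fix x assume "x \<in> {x. ?W x \<noteq> 0}"
    then have x: "norm x > 0" "emden u (1 - inverse (norm x)) (sgn x) \<noteq> 0" by (auto simp: log_transform_def)
    then have "norm (sgn x) = 1" by (auto simp: norm_sgn)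
    then have "1 - inverse (norm x) \<in> {a..0}" using z emden_zero_outside(1)[of "1 - inverse (norm x)" "sgn x" u] x(2) by blast
    then have "inverse (norm x) \<le> 1 - a" "1 \<le> inverse (norm x)" by auto
    then have "norm x \<le> 1" "1 \<le> (1 - a) * norm x" using x(1) by (auto simp: field_simps)
    moreover from this have "\<rho> \<le> norm x" using a by (simp add: \<rho>_def divide_le_eq mult.commute)
    ultimately show "x \<in> K" by (simp add: K_def)
  qed
  then have closure_supp: "closure {x. ?W x \<noteq> 0} \<subseteq> K"
    using K by (simp add: closure_minimal compact_imp_closed)
  have us: "smooth_on UNIV u" using u by (simp add: test_functions_def)
  have "smooth_on (- {0} \<union> - K) ?W"
  proof (rule smooth_on_Un)
    have t: "smooth_on (- {0}) (\<lambda>x::real^'n. 1 - inverse (norm x))"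
      by (intro smooth_on_diff smooth_on_const smooth_on_inverse_norm) auto
    have e: "smooth_on (- {0}) (\<lambda>x::real^'n. exp (c * (1 - inverse (norm x))))" for c
      by (intro smooth_on_compose_real[OF smooth_on_exp] smooth_on_mult smooth_on_const t) auto
    have "smooth_on (- {0}) (\<lambda>x. u (exp (1 - inverse (norm x)) *\<^sub>R sgn x))"
    proof (rule smooth_on_compose[OF _ open_UNIV _ _ us])
      show "smooth_on (- {0}) (\<lambda>x::real^'n. (exp (1 - inverse (norm x)) *\<^sub>R sgn x) \<bullet> c)" for c
        using smooth_on_mult[OF _ e[of 1] smooth_on_sgn, of c] by simp
    qed auto
    then show "smooth_on (- {0}) ?W"
      unfolding log_transform_def emden_def
      by (intro smooth_on_mult e smooth_on_compose_real[OF smooth_on_powr] smooth_on_norm) auto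
    show "smooth_on (- K) ?W"
      by (rule smooth_on_cong[OF _ smooth_on_const[of _ 0]])
        (use supp K in \<open>auto simp: compact_imp_closed open_Compl\<close>)
  qed (use K in \<open>auto simp: compact_imp_closed open_Compl\<close>)
  moreover have "- {0} \<union> - K = UNIV" using K by auto
  moreover have "compact (closure {x. ?W x \<noteq> 0})"
    using closure_supp K by (metis closed_closure compact_Int_closed inf.absorb_iff2)
  ultimately show ?thesis
    using closure_supp K by (auto simp: test_functions_def)
qed

lemma emden_dt_log_transform:
  assumes "norm \<theta> = 1"
  shows "emden_dt (log_transform u) s \<theta> - emden (log_transform u) s \<theta> / 2 =
    exp (- s / 2) * emden_dt u (1 - exp (- s)) \<theta>"
proof -
  have g: "((\<lambda>s. 1 - exp (- s)) has_real_derivative exp (- s)) (at s)"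
    by (auto intro!: derivative_eq_intros)
  have "((\<lambda>s. emden u (1 - exp (- s)) \<theta>) has_real_derivative emden_dt u (1 - exp (- s)) \<theta> * exp (- s)) (at s)"
    by (rule DERIV_chain2[OF DERIV_emden[OF test_functions_differentiable[OF u_punctured]] g])
  then have "((\<lambda>s. exp (s / 2) * emden u (1 - exp (- s)) \<theta>) has_real_derivative
      exp (s / 2) * (1 / 2) * emden u (1 - exp (- s)) \<theta> + (emden_dt u (1 - exp (- s)) \<theta> * exp (- s)) * exp (s / 2)) (at s)"
    by (intro DERIV_mult) (auto intro!: derivative_eq_intros)
  moreover have "((\<lambda>s. exp (s / 2) * emden u (1 - exp (- s)) \<theta>) has_real_derivative emden_dt (log_transform u) s \<theta>) (at s)"
    using DERIV_emden[OF test_functions_differentiable[OF log_transform_test], of \<theta> s]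
    by (simp add: emden_log_transform[OF assms])
  ultimately have "emden_dt (log_transform u) s \<theta> =
      exp (s / 2) * (1 / 2) * emden u (1 - exp (- s)) \<theta> + (emden_dt u (1 - exp (- s)) \<theta> * exp (- s)) * exp (s / 2)"
    using DERIV_unique by blast
  moreover have "exp (- s) * exp (s / 2) = exp (- s / 2)" by (simp add: exp_add[symmetric])
  ultimately show ?thesis by (simp add: emden_log_transform[OF assms] mult.assoc mult.commute)
qed

lemma emden_ang_log_transform:
  assumes "norm \<theta> = 1"
  shows "emden_ang (log_transform u) s \<theta> = exp s * emden_ang u (1 - exp (- s)) \<theta>"
proof -
  have \<theta>: "\<theta> \<noteq> 0" using assms by auto
  have t: "emden u (1 - exp (- s)) \<in> sphere_test_functions \<Sigma>" by (rule emden_slice_sphere_test_functions[OF u])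
  have "sphere_grad (emden (log_transform u) s) \<theta> =
      sphere_grad (\<lambda>\<theta>. exp (s / 2) * emden u (1 - exp (- s)) \<theta> + 0 * emden u (1 - exp (- s)) \<theta>) \<theta>"
    by (rule sphere_grad_cong[OF _ \<theta>]) (simp add: emden_log_transform)
  also have "\<dots> = exp (s / 2) *\<^sub>R sphere_grad (emden u (1 - exp (- s))) \<theta>"
    by (subst sphere_grad_lincomb[OF t t \<theta>]) simp
  finally have "(norm (sphere_grad (emden (log_transform u) s) \<theta>))\<^sup>2 =
      (exp (s / 2))\<^sup>2 * (norm (sphere_grad (emden u (1 - exp (- s))) \<theta>))\<^sup>2"
    by (simp add: power_mult_distrib)
  moreover have "(exp (s / 2))\<^sup>2 = exp s" by (simp add: exp_double[symmetric])
  ultimately show ?thesis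
    using norm_sphere_grad_emden[OF test_functions_differentiable[OF log_transform_test] assms, of s]
      norm_sphere_grad_emden[OF test_functions_differentiable[OF u_punctured] assms, of "1 - exp (- s)"] by simp
qed

text \<open>As in the proof of the one-dimensional Hardy inequality, the mixed term in the radial energy integrates
  to zero. In the critical term $(1-t)^{-q} |v|^p \, dt = e^{(q - 1 - p/2) s} |w|^p \, ds$, and the
  hypothesis on $q$ says that the exponential is absent.\<close>

lemma emden_log_transform_integrals:
  fixes p q :: real
  assumes p: "p > 0" and q: "q = p / 2 + 1"
  shows "(LINT (t, \<theta>)|cylinder_measure. (emden_dt u t \<theta>)\<^sup>2) =
      (LINT (t, \<theta>)|cylinder_measure. (emden_dt (log_transform u) t \<theta>)\<^sup>2) +
      (LINT (t, \<theta>)|cylinder_measure. (emden (log_transform u) t \<theta>)\<^sup>2) / 4" (is ?dt)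
    and "(LINT (t, \<theta>)|cylinder_measure. (emden (log_transform u) t \<theta>)\<^sup>2) =
      (LINT (t, \<theta>)|cylinder_measure. (log_weight t)\<^sup>2 * (emden u t \<theta>)\<^sup>2)" (is ?mass)
    and "(LINT (t, \<theta>)|cylinder_measure. emden_ang (log_transform u) t \<theta>) =
      (LINT (t, \<theta>)|cylinder_measure. (log_weight t)\<^sup>2 * emden_ang u t \<theta>)" (is ?ang)
    and "(LINT (t, \<theta>)|cylinder_measure. \<bar>emden (log_transform u) t \<theta>\<bar> powr p) =
      (LINT (t, \<theta>)|cylinder_measure. (1 / (1 - t)) powr q * \<bar>emden u t \<theta>\<bar> powr p)" (is ?pow)
proof -
  obtain a where a: "a \<le> 0"
    and z: "\<And>t \<theta>. norm \<theta> = 1 \<Longrightarrow> t \<notin> {a..0} \<Longrightarrow> exp t *\<^sub>R \<theta> \<notin> closure {x. u x \<noteq> 0}"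
    by (rule log_support_bound) blast
  let ?W = "log_transform u"
  note W = log_transform_test
  note zero = emden_zero_outside[OF z]
  note iW = integrable_emden[OF W]
  have neg: "1 - exp (- s) \<notin> {a..0}" if "\<not> s \<le> 0" for s :: real using that by auto
  have "(LINT z|cylinder_measure. (emden_dt u (fst z) (snd z))\<^sup>2) =
      (LINT z|cylinder_measure. (emden_dt ?W (fst z) (snd z) - emden ?W (fst z) (snd z) / 2)\<^sup>2)"
  proof (rule cylinder_log_substitution[OF _ _ a])
    fix s :: real and \<theta> :: "real^'n" assume \<theta>: "norm \<theta> = 1"
    have "(exp (- s / 2))\<^sup>2 = exp (- s)" by (simp add: exp_double[symmetric])
    then show "(emden_dt ?W (fst (s, \<theta>)) (snd (s, \<theta>)) - emden ?W (fst (s, \<theta>)) (snd (s, \<theta>)) / 2)\<^sup>2 =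
        exp (- s) * (emden_dt u (fst (1 - exp (- s), \<theta>)) (snd (1 - exp (- s), \<theta>)))\<^sup>2"
      by (simp only: fst_conv snd_conv emden_dt_log_transform[OF \<theta>] power_mult_distrib)
  qed (auto intro!: continuous_intros u_punctured W simp: zero)
  also have "\<dots> = (LINT z|cylinder_measure. (emden_dt ?W (fst z) (snd z))\<^sup>2 + (emden ?W (fst z) (snd z))\<^sup>2 / 4 -
      emden ?W (fst z) (snd z) * emden_dt ?W (fst z) (snd z))"
    by (simp add: power2_diff power_divide mult.commute)
  also have "\<dots> = (LINT z|cylinder_measure. (emden_dt ?W (fst z) (snd z))\<^sup>2) +
      (LINT z|cylinder_measure. (emden ?W (fst z) (snd z))\<^sup>2) / 4 -
      (LINT z|cylinder_measure. emden ?W (fst z) (snd z) * emden_dt ?W (fst z) (snd z))"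
    using iW by (simp add: case_prod_unfold)
  also have "(LINT z|cylinder_measure. emden ?W (fst z) (snd z) * emden_dt ?W (fst z) (snd z)) = 0"
    using integral_emden_mult_dt[OF W] by (simp add: case_prod_unfold)
  finally show ?dt by (simp add: case_prod_unfold)
  have ee: "exp (- s) * ((exp s)\<^sup>2 * x) = exp s * x" for s x :: real
  proof -
    have "exp (- s) * (exp s)\<^sup>2 = exp s" by (simp add: exp_double[symmetric] exp_add[symmetric])
    then show ?thesis by (simp add: mult.assoc[symmetric])
  qed
  have "(LINT z|cylinder_measure. (log_weight (fst z))\<^sup>2 * (emden u (fst z) (snd z))\<^sup>2) =
      (LINT z|cylinder_measure. (emden ?W (fst z) (snd z))\<^sup>2)"
  proof (rule cylinder_log_substitution[OF _ _ a])
    fix s :: real and \<theta> :: "real^'n" assume \<theta>: "norm \<theta> = 1"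
    have "(exp (s / 2))\<^sup>2 = exp s" by (simp add: exp_double[symmetric])
    then show "(emden ?W (fst (s, \<theta>)) (snd (s, \<theta>)))\<^sup>2 = exp (- s) *
        ((log_weight (fst (1 - exp (- s), \<theta>)))\<^sup>2 * (emden u (fst (1 - exp (- s), \<theta>)) (snd (1 - exp (- s), \<theta>)))\<^sup>2)"
      using zero(1)[OF \<theta> neg, of s]
      by (cases "s \<le> 0") (simp_all add: emden_log_transform[OF \<theta>] power_mult_distrib log_weight_substitution ee)
  qed (auto intro!: continuous_intros u_punctured W simp: zero)
  then show ?mass by (simp add: case_prod_unfold)
  have "(LINT z|cylinder_measure. (log_weight (fst z))\<^sup>2 * emden_ang u (fst z) (snd z)) =
      (LINT z|cylinder_measure. emden_ang ?W (fst z) (snd z))"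
  proof (rule cylinder_log_substitution[OF _ _ a])
    fix s :: real and \<theta> :: "real^'n" assume \<theta>: "norm \<theta> = 1"
    show "emden_ang ?W (fst (s, \<theta>)) (snd (s, \<theta>)) = exp (- s) *
        ((log_weight (fst (1 - exp (- s), \<theta>)))\<^sup>2 * emden_ang u (fst (1 - exp (- s), \<theta>)) (snd (1 - exp (- s), \<theta>)))"
      using zero(3)[OF \<theta> neg, of s]
      by (cases "s \<le> 0") (simp_all add: emden_ang_log_transform[OF \<theta>] log_weight_substitution ee)
  qed (auto intro!: continuous_intros u_punctured W simp: zero)
  then show ?ang by (simp add: case_prod_unfold)
  have "(LINT z|cylinder_measure. log_weight (fst z) powr q * \<bar>emden u (fst z) (snd z)\<bar> powr p) =
      (LINT z|cylinder_measure. \<bar>emden ?W (fst z) (snd z)\<bar> powr p)"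
  proof (rule cylinder_log_substitution[OF _ _ a])
    show "continuous_on UNIV (\<lambda>z::real \<times> (real^'n). log_weight (fst z) powr q * \<bar>emden u (fst z) (snd z)\<bar> powr p)"
    proof (intro continuous_on_mult)
      show "continuous_on UNIV (\<lambda>z::real \<times> (real^'n). log_weight (fst z) powr q)"
        by (intro continuous_on_powr continuous_intros) (use log_weight_pos in \<open>auto simp: less_imp_neq[symmetric]\<close>)
      show "continuous_on UNIV (\<lambda>z::real \<times> (real^'n). \<bar>emden u (fst z) (snd z)\<bar> powr p)"
        by (intro continuous_on_powr' continuous_intros u_punctured) (use p in auto)
    qed
    show "continuous_on UNIV (\<lambda>z::real \<times> (real^'n). \<bar>emden ?W (fst z) (snd z)\<bar> powr p)"
      by (intro continuous_on_powr' continuous_intros W) (use p in auto)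
    fix s :: real and \<theta> :: "real^'n" assume \<theta>: "norm \<theta> = 1"
    have "exp (s / 2) powr p = exp (- s) * exp s powr q"
      by (simp add: q powr_def exp_add[symmetric] algebra_simps)
    then show "\<bar>emden ?W (fst (s, \<theta>)) (snd (s, \<theta>))\<bar> powr p = exp (- s) *
        (log_weight (fst (1 - exp (- s), \<theta>)) powr q * \<bar>emden u (fst (1 - exp (- s), \<theta>)) (snd (1 - exp (- s), \<theta>))\<bar> powr p)"
      using zero(1)[OF \<theta> neg, of s]
      by (cases "s \<le> 0") (simp_all add: emden_log_transform[OF \<theta>] log_weight_substitution abs_mult powr_mult)
  qed (simp add: zero)
  also have "(LINT z|cylinder_measure. log_weight (fst z) powr q * \<bar>emden u (fst z) (snd z)\<bar> powr p) =
      (LINT z|cylinder_measure. (1 / (1 - fst z)) powr q * \<bar>emden u (fst z) (snd z)\<bar> powr p)"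
  proof (rule integral_cong_AE)
    show "AE z in cylinder_measure. log_weight (fst z) powr q * \<bar>emden u (fst z) (snd z)\<bar> powr p =
        (1 / (1 - fst z)) powr q * \<bar>emden u (fst z) (snd z)\<bar> powr p"
      using AE_cylinder_norm
    proof eventually_elim
      case (elim z)
      then show ?case using zero(1)[of "snd z" "fst z"]
        by (cases "fst z \<le> 0") (auto simp: log_weight_def min_def)
    qed
    have [measurable]: "(\<lambda>z::real \<times> (real^'n). emden u (fst z) (snd z)) \<in> borel_measurable cylinder_measure"
      unfolding borel_measurable_cylinder_iff by (intro borel_measurable_continuous_onI continuous_intros u_punctured)
    have [measurable]: "log_weight \<in> borel_measurable borel"
      by (intro borel_measurable_continuous_onI continuous_on_log_weight continuous_on_id)
    show "(\<lambda>z::real \<times> (real^'n). log_weight (fst z) powr q * \<bar>emden u (fst z) (snd z)\<bar> powr p) \<in> borel_measurable cylinder_measure"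
      "(\<lambda>z::real \<times> (real^'n). (1 / (1 - fst z)) powr q * \<bar>emden u (fst z) (snd z)\<bar> powr p) \<in> borel_measurable cylinder_measure"
      by measurable
  qed
  finally show ?pow by (simp add: case_prod_unfold)
qed

lemma slice_integrals:
  "sphere_mass (emden u t) = (LINT \<theta>|surface_measure. (emden u t \<theta>)\<^sup>2)"
  "sphere_energy (emden u t) = (LINT \<theta>|surface_measure. emden_ang u t \<theta>)"
proof -
  have t: "emden u t \<in> sphere_test_functions \<Sigma>" by (rule emden_slice_sphere_test_functions[OF u])
  note [measurable] = measurable_sphere_test_function[OF t]
  have [measurable]: "emden u t \<in> borel_measurable borel" "emden_ang u t \<in> borel_measurable borel"
    by (intro borel_measurable_continuous_onI continuous_on_emden[OF u_punctured, where f="\<lambda>x. t" and g="\<lambda>x. x", simplified]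
        continuous_intros)+
  show "sphere_mass (emden u t) = (LINT \<theta>|surface_measure. (emden u t \<theta>)\<^sup>2)"
    unfolding sphere_mass_def
  proof (rule integral_cong_AE)
    show "AE \<theta> in surface_measure. (emden u t (sgn \<theta>))\<^sup>2 = (emden u t \<theta>)\<^sup>2"
      using AE_surface_measure_norm by eventually_elim (simp add: sgn_unit)
  qed measurable
  show "sphere_energy (emden u t) = (LINT \<theta>|surface_measure. emden_ang u t \<theta>)"
    unfolding sphere_energy_def
  proof (rule integral_cong_AE)
    show "AE \<theta> in surface_measure. (norm (sphere_grad (emden u t) \<theta>))\<^sup>2 = emden_ang u t \<theta>"
      using AE_surface_measure_norm
      by eventually_elim (rule norm_sphere_grad_emden[OF test_functions_differentiable[OF u_punctured]])
  qed measurable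
qed

text \<open>Slice by slice the energy exceeds the Rayleigh bound by a nonnegative amount, so a weight between $0$ and $1$ in
  the variable $t$ can only decrease the total excess.\<close>

lemma weighted_spherical_deficit:
  fixes w :: "real \<Rightarrow> real"
  assumes w: "continuous_on UNIV w" "\<And>t. 0 \<le> w t" "\<And>t. w t \<le> 1"
  shows "0 \<le> (LINT (t, \<theta>)|cylinder_measure. emden_ang u t \<theta>) - rayleigh \<Sigma> * (LINT (t, \<theta>)|cylinder_measure. (emden u t \<theta>)\<^sup>2)"
    and "(LINT (t, \<theta>)|cylinder_measure. w t * emden_ang u t \<theta>) - rayleigh \<Sigma> * (LINT (t, \<theta>)|cylinder_measure. w t * (emden u t \<theta>)\<^sup>2)
      \<le> (LINT (t, \<theta>)|cylinder_measure. emden_ang u t \<theta>) - rayleigh \<Sigma> * (LINT (t, \<theta>)|cylinder_measure. (emden u t \<theta>)\<^sup>2)"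
proof -
  define N where "N t = sphere_energy (emden u t) - rayleigh \<Sigma> * sphere_mass (emden u t)" for t
  have N: "0 \<le> N t" for t
    using rayleigh_le[OF emden_slice_sphere_test_functions[OF u]] by (simp add: N_def)
  obtain a where z: "\<And>t \<theta>. norm \<theta> = 1 \<Longrightarrow> t \<notin> {a..0} \<Longrightarrow> exp t *\<^sub>R \<theta> \<notin> closure {x. u x \<noteq> 0}"
    by (rule log_support_bound) blast
  note zero = emden_zero_outside[OF z]
  have key: "(LINT (t, \<theta>)|cylinder_measure. g t * emden_ang u t \<theta>) - rayleigh \<Sigma> * (LINT (t, \<theta>)|cylinder_measure. g t * (emden u t \<theta>)\<^sup>2) =
      (LINT t|lborel. g t * N t) \<and> integrable lborel (\<lambda>t. g t * N t)" if g: "continuous_on UNIV g" for g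
  proof -
    have g1: "continuous_on UNIV (\<lambda>z::real \<times> (real^'n). g (fst z))"
      by (rule continuous_on_compose2[OF g]) (auto intro!: continuous_intros)
    have i1: "integrable cylinder_measure (\<lambda>(t, \<theta>). g t * emden_ang u t \<theta>)"
      by (rule integrable_cylinder_continuous[of _ a 0])
        (auto simp: case_prod_unfold zero intro!: continuous_intros u_punctured g1)
    have i2: "integrable cylinder_measure (\<lambda>(t, \<theta>). g t * (emden u t \<theta>)\<^sup>2)"
      by (rule integrable_cylinder_continuous[of _ a 0])
        (auto simp: case_prod_unfold zero intro!: continuous_intros u_punctured g1)
    have e1: "(LINT (t, \<theta>)|cylinder_measure. g t * emden_ang u t \<theta>) = (LINT t|lborel. g t * sphere_energy (emden u t))"
      and j1: "integrable lborel (\<lambda>t. g t * sphere_energy (emden u t))"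
      using cylinder.integral_fst'[OF i1] cylinder.integrable_fst'[OF i1] by (simp_all add: slice_integrals)
    have e2: "(LINT (t, \<theta>)|cylinder_measure. g t * (emden u t \<theta>)\<^sup>2) = (LINT t|lborel. g t * sphere_mass (emden u t))"
      and j2: "integrable lborel (\<lambda>t. g t * sphere_mass (emden u t))"
      using cylinder.integral_fst'[OF i2] cylinder.integrable_fst'[OF i2] by (simp_all add: slice_integrals)
    have gN: "g t * N t = g t * sphere_energy (emden u t) - rayleigh \<Sigma> * (g t * sphere_mass (emden u t))" for t
      by (simp add: N_def algebra_simps)
    show ?thesis unfolding e1 e2 gN using j1 j2 by simp
  qed
  note k1 = key[OF continuous_on_const[of _ 1], simplified] and kw = key[OF w(1)]
  show "0 \<le> (LINT (t, \<theta>)|cylinder_measure. emden_ang u t \<theta>) - rayleigh \<Sigma> * (LINT (t, \<theta>)|cylinder_measure. (emden u t \<theta>)\<^sup>2)"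
    using k1 N by (simp add: Bochner_Integration.integral_nonneg)
  have "(LINT t|lborel. w t * N t) \<le> (LINT t|lborel. N t)"
    using k1 kw N w(2,3) by (intro integral_mono) (auto simp: mult_left_le_one_le)
  then show "(LINT (t, \<theta>)|cylinder_measure. w t * emden_ang u t \<theta>) - rayleigh \<Sigma> * (LINT (t, \<theta>)|cylinder_measure. w t * (emden u t \<theta>)\<^sup>2)
      \<le> (LINT (t, \<theta>)|cylinder_measure. emden_ang u t \<theta>) - rayleigh \<Sigma> * (LINT (t, \<theta>)|cylinder_measure. (emden u t \<theta>)\<^sup>2)"
    using k1 kw by simp
qed

end

text \<open>The Dirichlet integral of the transformed function is $\int w_s^2 + \alpha^2 \int w^2$ plus its angular
  energy, with $\alpha = (n-2)/2$. The angular energy is at most the angular deficit of $u$ plus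
  $\mu_1 \int w^2$, and $\int w^2 \le 4 \int v_t^2$, so a multiple of the radial energy and the deficit
  of $u$ bounds all of it; then apply the Sobolev inequality.\<close>

theorem hardy_sobolev_inequality:
  fixes \<Sigma> :: "(real^'n) set"
  assumes n: "CARD('n) \<ge> 3" and \<Sigma>: "sphere_domain \<Sigma>"
  shows "\<exists>C>0. hardy_sobolev \<Sigma> (weight_exponent TYPE('n)) C"
proof -
  define n where "n = real CARD('n)"
  define p where "p = 2 * n / (n - 2)"
  define q where "q = weight_exponent TYPE('n)"
  define \<alpha> where "\<alpha> = (n - 2) / 2"
  define S where "S = (2 * (n - 1) / (n - 2))\<^sup>2"
  define K where "K = 1 + 4 * (\<alpha>\<^sup>2 + rayleigh \<Sigma>)"
  have n3: "n \<ge> 3" using n by (simp add: n_def)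
  have p: "p > 0" using n3 by (simp add: p_def)
  have q: "q = p / 2 + 1" using n3 by (simp add: q_def p_def weight_exponent_def n_def[symmetric] field_simps)
  have S: "S > 0" using n3 by (simp add: S_def)
  have K: "K > 0" using rayleigh_nonneg[OF \<Sigma>] by (simp add: K_def add_pos_nonneg)
  have "hardy_sobolev \<Sigma> q (1 / (S * K))"
    unfolding hardy_sobolev_emden[OF n] n_def[symmetric] p_def[symmetric] mu1_eq_rayleigh[OF \<Sigma>]
  proof
    fix u :: "real^'n \<Rightarrow> real" assume u: "u \<in> test_functions (trunc_cone \<Sigma>)"
    let ?W = "log_transform u"
    define T where "T = (LINT (t, \<theta>)|cylinder_measure. (emden_dt u t \<theta>)\<^sup>2)"
    define A where "A = (LINT (t, \<theta>)|cylinder_measure. emden_ang u t \<theta>)"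
    define M where "M = (LINT (t, \<theta>)|cylinder_measure. (emden u t \<theta>)\<^sup>2)"
    define P where "P = (LINT (t, \<theta>)|cylinder_measure. (1 / (1 - t)) powr q * \<bar>emden u t \<theta>\<bar> powr p)"
    define TW where "TW = (LINT (t, \<theta>)|cylinder_measure. (emden_dt ?W t \<theta>)\<^sup>2)"
    define AW where "AW = (LINT (t, \<theta>)|cylinder_measure. emden_ang ?W t \<theta>)"
    define MW where "MW = (LINT (t, \<theta>)|cylinder_measure. (emden ?W t \<theta>)\<^sup>2)"
    note W = log_transform_test[OF u]
    note int = emden_log_transform_integrals[OF u p q]
    have T: "T = TW + MW / 4" using int(1) by (simp add: T_def TW_def MW_def)
    have TW: "TW \<ge> 0" by (auto simp: TW_def intro!: Bochner_Integration.integral_nonneg)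
    have MW: "MW \<ge> 0" by (auto simp: MW_def intro!: Bochner_Integration.integral_nonneg)
    have lw: "continuous_on UNIV (\<lambda>t. (log_weight t)\<^sup>2)" "\<And>t. 0 \<le> (log_weight t)\<^sup>2" "\<And>t. (log_weight t)\<^sup>2 \<le> 1"
      using log_weight_pos log_weight_le_1 by (auto intro!: continuous_intros power_le_one simp: less_imp_le)
    have deficit: "0 \<le> A - rayleigh \<Sigma> * M" "AW - rayleigh \<Sigma> * MW \<le> A - rayleigh \<Sigma> * M"
      using weighted_spherical_deficit[OF u lw] int(2,3) by (simp_all add: A_def M_def AW_def MW_def)
    have "(LINT x|lborel. \<bar>?W x\<bar> powr p) powr ((n - 2) / n) \<le> S * (LINT x|lborel. (norm (grad ?W x))\<^sup>2)"
      using Sobolev_inequality[OF n test_functions_mono[OF W]] by (simp add: p_def n_def S_def)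
    also have "(LINT x|lborel. \<bar>?W x\<bar> powr p) = P"
      using power_integral_emden[OF n W, of "\<lambda>t. 1"] int(4) by (simp add: p_def n_def P_def)
    also have "(LINT x|lborel. (norm (grad ?W x))\<^sup>2) = TW + \<alpha>\<^sup>2 * MW + AW"
      using dirichlet_integral_emden[OF W] by (simp add: TW_def MW_def AW_def \<alpha>_def n_def)
    also have "TW + \<alpha>\<^sup>2 * MW + AW \<le> K * (T + (A - rayleigh \<Sigma> * M))"
    proof -
      have "MW \<le> 4 * T" "TW \<le> T" using T TW MW by auto
      then have "(\<alpha>\<^sup>2 + rayleigh \<Sigma>) * MW \<le> (\<alpha>\<^sup>2 + rayleigh \<Sigma>) * (4 * T)"
        using rayleigh_nonneg[OF \<Sigma>] by (intro mult_left_mono) auto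
      moreover have "0 \<le> (4 * (\<alpha>\<^sup>2 + rayleigh \<Sigma>)) * (A - rayleigh \<Sigma> * M)"
        using rayleigh_nonneg[OF \<Sigma>] deficit(1) by (intro mult_nonneg_nonneg) auto
      ultimately show ?thesis
        using deficit(2) \<open>TW \<le> T\<close> unfolding K_def by (simp add: algebra_simps)
    qed
    finally have "P powr ((n - 2) / n) \<le> S * (K * (T + (A - rayleigh \<Sigma> * M)))"
      using S by (simp add: mult_left_mono)
    then have "1 / (S * K) * P powr ((n - 2) / n) \<le> T + (A - rayleigh \<Sigma> * M)"
      using S K by (simp add: field_simps)
    then show "rayleigh \<Sigma> * (LINT (t, \<theta>)|cylinder_measure. (emden u t \<theta>)\<^sup>2) + 1 / (S * K) *
        (LINT (t, \<theta>)|cylinder_measure. (1 / (1 - t)) powr q * \<bar>emden u t \<theta>\<bar> powr p) powr ((n - 2) / n)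
        \<le> (LINT (t, \<theta>)|cylinder_measure. (emden_dt u t \<theta>)\<^sup>2) + (LINT (t, \<theta>)|cylinder_measure. emden_ang u t \<theta>)"
      by (simp add: T_def A_def M_def P_def)
  qed
  then show ?thesis using S K by (intro exI[of _ "1 / (S * K)"]) (simp add: q_def)
qed


section \<open>Optimality of the exponent and the bound for the best constant\<close>

definition profile_integral :: "real \<Rightarrow> real \<Rightarrow> real \<Rightarrow> real" where
  "profile_integral p q R = (LINT t|lborel. (1 / (1 - t)) powr q * \<bar>bump (- (t / R))\<bar> powr p)"

lemma integral_rescale:
  fixes f :: "real \<Rightarrow> real"
  assumes "R > 0"
  shows "(LINT t|lborel. f (- (t / R))) = R * (LINT t|lborel. f t)"
proof -
  have "(LINT t|lborel. f t) = \<bar>- (1 / R)\<bar> *\<^sub>R (LINT t|lborel. f (0 + (- (1 / R)) * t))"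
    using assms by (intro lborel_integral_real_affine) auto
  then show ?thesis using assms by (simp add: field_simps)
qed

text \<open>Young's inequality for $|\psi|/l$ is integrated over $\Sigma$ and the scale $l$ is chosen optimally, with $l^p = P/m$ in the
  notation of the proof. Scales of other size serve to show that $P$ is positive.\<close>

lemma sphere_Hoelder:
  fixes \<Sigma> :: "(real^'n) set"
  assumes \<Sigma>: "sphere_domain \<Sigma>" and \<psi>: "\<psi> \<in> sphere_test_functions \<Sigma>" "sphere_mass \<psi> = 1" and p: "p > 2"
  shows "1 \<le> (LINT \<theta>|surface_measure. \<bar>\<psi> (sgn \<theta>)\<bar> powr p) powr (2 / p) * measure surface_measure \<Sigma> powr (1 - 2 / p)"
proof -
  define P where "P = (LINT \<theta>|surface_measure. \<bar>\<psi> (sgn \<theta>)\<bar> powr p)"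
  define m where "m = measure surface_measure \<Sigma>"
  note bS = sphere_domain_borel[OF \<Sigma>]
  have iP: "integrable surface_measure (\<lambda>\<theta>. \<bar>\<psi> (sgn \<theta>)\<bar> powr p)"
    using integrable_sphere_test_functions(5)[OF \<psi>(1) \<psi>(1)] p by simp
  have iS: "integrable surface_measure (indicator \<Sigma> :: _ \<Rightarrow> real)"
    using bS top.not_eq_extremum[THEN iffD1, OF surface.emeasure_finite[of \<Sigma>]]
    by (intro integrable_real_indicator) auto
  have P0: "P \<ge> 0" and m0: "m \<ge> 0" by (auto simp: P_def m_def)
  have young: "1 \<le> l\<^sup>2 * (2 / p * (P / l powr p) + (1 - 2 / p) * m)" if l: "l > 0" for l
  proof -
    have "1 = (LINT \<theta>|surface_measure. (\<psi> (sgn \<theta>))\<^sup>2)" using \<psi>(2) by (simp add: sphere_mass_def)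
    also have "\<dots> \<le> (LINT \<theta>|surface_measure. l\<^sup>2 * (2 / p * (\<bar>\<psi> (sgn \<theta>)\<bar> powr p / l powr p) + (1 - 2 / p) * indicator \<Sigma> \<theta>))"
    proof (rule integral_mono_AE)
      show "integrable surface_measure (\<lambda>\<theta>. (\<psi> (sgn \<theta>))\<^sup>2)"
        by (rule integrable_sphere_test_functions(1)[OF \<psi>(1) \<psi>(1)])
      show "integrable surface_measure (\<lambda>\<theta>. l\<^sup>2 * (2 / p * (\<bar>\<psi> (sgn \<theta>)\<bar> powr p / l powr p) + (1 - 2 / p) * indicator \<Sigma> \<theta>))"
        using iP iS by simp
      show "AE \<theta> in surface_measure. (\<psi> (sgn \<theta>))\<^sup>2 \<le>
          l\<^sup>2 * (2 / p * (\<bar>\<psi> (sgn \<theta>)\<bar> powr p / l powr p) + (1 - 2 / p) * indicator \<Sigma> \<theta>)"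
        using AE_surface_measure_norm
      proof eventually_elim
        case (elim \<theta>)
        show ?case
        proof (cases "\<theta> \<in> \<Sigma>")
          case True
          define y where "y = \<bar>\<psi> (sgn \<theta>)\<bar> / l"
          have y: "y \<ge> 0" using l by (simp add: y_def)
          have "y\<^sup>2 \<le> 2 / p * y powr p + (1 - 2 / p)"
          proof (cases "y = 0")
            case False
            with y have "(y powr p) powr (2 / p) * 1 powr (1 - 2 / p) \<le> 2 / p * y powr p + (1 - 2 / p) * 1"
              using p by (intro Youngs_inequality_0) auto
            moreover have "(y powr p) powr (2 / p) = y\<^sup>2"
              using p y False by (simp add: powr_powr)
            ultimately show ?thesis by simp
          qed (use p in simp)
          moreover have "y powr p = \<bar>\<psi> (sgn \<theta>)\<bar> powr p / l powr p"
            using l by (simp add: y_def powr_divide)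
          ultimately have "y\<^sup>2 \<le> 2 / p * (\<bar>\<psi> (sgn \<theta>)\<bar> powr p / l powr p) + (1 - 2 / p)" by simp
          then have "l\<^sup>2 * y\<^sup>2 \<le> l\<^sup>2 * (2 / p * (\<bar>\<psi> (sgn \<theta>)\<bar> powr p / l powr p) + (1 - 2 / p))"
            by (rule mult_left_mono) simp
          moreover have "l\<^sup>2 * y\<^sup>2 = (\<psi> (sgn \<theta>))\<^sup>2" using l by (simp add: y_def power_divide)
          ultimately show ?thesis using True by simp
        next
          case False
          then show ?thesis using sphere_test_functions_zero[OF \<psi>(1) elim] elim p by (simp add: sgn_unit)
        qed
      qed
    qed
    also have "\<dots> = l\<^sup>2 * (2 / p * (P / l powr p) + (1 - 2 / p) * m)"
      using iP iS bS by (simp add: P_def m_def)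
    finally show ?thesis .
  qed
  have m: "m > 0"
  proof (rule ccontr)
    assume "\<not> m > 0"
    then have "measure surface_measure \<Sigma> = 0" using m0 unfolding m_def by linarith
    then have "emeasure surface_measure \<Sigma> = 0"
      using surface.emeasure_eq_measure[of \<Sigma>] by simp
    then have "\<Sigma> \<in> null_sets surface_measure" using bS by (intro null_setsI) auto
    then have "AE \<theta> in surface_measure. \<theta> \<notin> \<Sigma>" by (rule AE_not_in)
    then have "AE \<theta> in surface_measure. (\<psi> (sgn \<theta>))\<^sup>2 = 0"
      using AE_surface_measure_norm
      by eventually_elim (simp add: sgn_unit sphere_test_functions_zero[OF \<psi>(1)])
    then have "sphere_mass \<psi> = 0" unfolding sphere_mass_def by (rule integral_eq_zero_AE)
    then show False using \<psi>(2) by simp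
  qed
  have P: "P > 0"
  proof (rule ccontr)
    assume "\<not> P > 0"
    then have "P = 0" using P0 by simp
    define l where "l = 1 / sqrt (m + 1)"
    have l: "l > 0" "l\<^sup>2 = 1 / (m + 1)" using m by (auto simp: l_def power_divide)
    have "1 \<le> l\<^sup>2 * ((1 - 2 / p) * m)" using young[OF l(1)] \<open>P = 0\<close> by simp
    also have "\<dots> \<le> l\<^sup>2 * (1 * m)" using m p by (intro mult_left_mono mult_right_mono) auto
    also have "\<dots> < 1" using m by (simp add: l(2) field_simps)
    finally show False by simp
  qed
  define l where "l = (P / m) powr (1 / p)"
  have l: "l > 0" "l powr p = P / m" using P m p by (auto simp: l_def powr_powr)
  have "2 / p * (P / l powr p) + (1 - 2 / p) * m = m"
    using P m p by (simp add: l(2) field_simps)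
  then have "1 \<le> l\<^sup>2 * m" using young[OF l(1)] by simp
  also have "l\<^sup>2 = (P / m) powr (2 / p)"
  proof -
    have "l\<^sup>2 = l powr 2" using l by simp
    then show ?thesis by (simp add: l_def powr_powr)
  qed
  also have "(P / m) powr (2 / p) * m = P powr (2 / p) * m powr (1 - 2 / p)"
    using P m by (simp add: powr_divide powr_diff)
  finally show ?thesis by (simp add: P_def m_def)
qed

context
  fixes \<Sigma> :: "(real^'n) set" and q C p \<gamma> :: real
  assumes n: "CARD('n) \<ge> 3" and \<Sigma>: "sphere_domain \<Sigma>"
    and hs: "hardy_sobolev \<Sigma> q C" and C: "C > 0"
    and p: "p = 2 * real CARD('n) / (real CARD('n) - 2)"
    and \<gamma>: "\<gamma> = (real CARD('n) - 2) / real CARD('n)"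
begin

text \<open>Integrability is first shown with \<open>log_weight\<close> in place of the weight, as the two agree on the
  support and the former is continuous.\<close>

lemma power_separated:
  fixes \<psi> :: "real^'n \<Rightarrow> real"
  assumes \<psi>: "\<psi> \<in> sphere_test_functions \<Sigma>" and R: "R \<ge> 1"
  shows "(LINT (t, \<theta>)|cylinder_measure. (1 / (1 - t)) powr q * \<bar>emden (separated (\<lambda>t. bump (- (t / R))) \<psi>) t \<theta>\<bar> powr p) =
    profile_integral p q R * (LINT \<theta>|surface_measure. \<bar>\<psi> (sgn \<theta>)\<bar> powr p)"
proof -
  let ?f = "\<lambda>t. bump (- (t / R))"
  let ?u = "separated ?f \<psi>"
  have p0: "p > 0" using n by (simp add: p)
  have supp: "?f t = 0" if "t \<notin> {- 2 * R..- R}" for t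
    using rescaled_bump_support[OF _ that] R by simp
  note smooth = smooth_on_rescaled_bump[of R]
  have u: "?u \<in> test_functions (- {0})"
    by (rule test_functions_mono[OF separated_test_function[OF smooth supp \<psi> sphere_domain_subset[OF \<Sigma>]]]) auto
  have zero: "emden ?u t \<theta> = 0" if "norm \<theta> = 1" "t \<notin> {- 2 * R..- R}" for t \<theta>
    using emden_separated[OF that(1), of ?f \<psi> t] supp[OF that(2)] by simp
  have cont: "continuous_on UNIV (\<lambda>z::real \<times> (real^'n). log_weight (fst z) powr q * \<bar>emden ?u (fst z) (snd z)\<bar> powr p)"
  proof (intro continuous_on_mult)
    show "continuous_on UNIV (\<lambda>z::real \<times> (real^'n). log_weight (fst z) powr q)"
      by (intro continuous_on_powr continuous_intros) (use log_weight_pos in \<open>auto simp: less_imp_neq[symmetric]\<close>)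
    show "continuous_on UNIV (\<lambda>z::real \<times> (real^'n). \<bar>emden ?u (fst z) (snd z)\<bar> powr p)"
      by (intro continuous_on_powr' continuous_intros u) (use p0 in auto)
  qed
  have i: "integrable cylinder_measure (\<lambda>z::real \<times> (real^'n). log_weight (fst z) powr q * \<bar>emden ?u (fst z) (snd z)\<bar> powr p)"
    by (rule integrable_cylinder_continuous[OF cont, of "- 2 * R" "- R"]) (use zero in simp)
  have [measurable]: "(\<lambda>z::real \<times> (real^'n). emden ?u (fst z) (snd z)) \<in> borel_measurable cylinder_measure"
    unfolding borel_measurable_cylinder_iff by (intro borel_measurable_continuous_onI continuous_intros u)
  have m: "case_prod (\<lambda>t \<theta>. (1 / (1 - t)) powr q * \<bar>emden ?u t \<theta>\<bar> powr p) \<in> borel_measurable (cylinder_measure :: (real \<times> (real^'n)) measure)"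
    unfolding case_prod_unfold by measurable
  have i': "integrable cylinder_measure (case_prod (\<lambda>t \<theta>. (1 / (1 - t)) powr q * \<bar>emden ?u t \<theta>\<bar> powr p))"
  proof (rule integrable_cong_AE_imp[OF i m])
    show "AE z in cylinder_measure. log_weight (fst z) powr q * \<bar>emden ?u (fst z) (snd z)\<bar> powr p =
        (case z of (t, \<theta>) \<Rightarrow> (1 / (1 - t)) powr q * \<bar>emden ?u t \<theta>\<bar> powr p)"
      using AE_cylinder_norm
    proof eventually_elim
      case (elim z)
      then show ?case using zero[of "snd z" "fst z"] R
        by (cases "fst z \<le> 0") (auto simp: case_prod_unfold log_weight_def min_def)
    qed
  qed
  note [measurable] = measurable_sphere_test_function(1)[OF \<psi>]
  show ?thesis
    unfolding profile_integral_def
    by (rule cylinder_integral_product[OF m i'])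
      (auto simp: emden_separated abs_mult powr_mult sgn_unit)
qed

text \<open>Test with a rescaled bump times a function $\psi$ of mass $1$ whose energy exceeds the infimum by less than
  $\epsilon / (R c_0)$. The radial energy scales like $1/R$, the angular deficit is less than
  $\epsilon$, and the power of $\psi$ is bounded from below by \<open>sphere_Hoelder\<close>.\<close>

lemma profile_bound:
  assumes R: "R \<ge> 1"
  shows "C * profile_integral p q R powr \<gamma> \<le>
    (LINT t|lborel. (grad bump t)\<^sup>2) / R * measure surface_measure \<Sigma> powr (2 / real CARD('n))"
proof -
  define c0 where "c0 = (LINT t|lborel. (bump t)\<^sup>2)"
  define c1 where "c1 = (LINT t|lborel. (grad bump t)\<^sup>2)"
  define m where "m = measure surface_measure \<Sigma> powr (2 / real CARD('n))"
  define I where "I = profile_integral p q R"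
  let ?f = "\<lambda>t. bump (- (t / R))"
  let ?f' = "\<lambda>t. grad bump (- (t / R)) * (- (1 / R))"
  have n3: "real CARD('n) \<ge> 3" using n by simp
  have pg: "2 / p = \<gamma>" "1 - 2 / p = 2 / real CARD('n)" "p > 2"
    using n3 by (auto simp: p \<gamma> field_simps)
  have I0: "I \<ge> 0" unfolding I_def profile_integral_def by (intro Bochner_Integration.integral_nonneg) auto
  have supp: "?f t = 0" if "t \<notin> {- 2 * R..- R}" for t
    using rescaled_bump_support[OF _ that] R by simp
  note smooth = smooth_on_rescaled_bump[of R]
  have der: "(?f has_real_derivative ?f' t) (at t)" for t
    by (rule DERIV_chain2[OF DERIV_bump]) (use R in \<open>auto intro!: derivative_eq_intros\<close>)
  have "(LINT t|lborel. (?f' t)\<^sup>2) = (LINT t|lborel. (1 / R)\<^sup>2 * (grad bump (- (t / R)))\<^sup>2)"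
    by (intro Bochner_Integration.integral_cong refl) (simp add: power_mult_distrib power_divide)
  also have "\<dots> = (1 / R)\<^sup>2 * (R * c1)"
    using integral_rescale[of R "\<lambda>t. (grad bump t)\<^sup>2"] R by (simp add: c1_def)
  also have "\<dots> = c1 / R" using R by (simp add: power2_eq_square)
  finally have f'2_prod: "(LINT t|lborel. (?f' t)\<^sup>2) = c1 / R" .
  then have f'2: "(LINT t|lborel. (grad bump (- (t / R)) / R)\<^sup>2) = c1 / R" by simp
  have f2: "(LINT t|lborel. (?f t)\<^sup>2) = R * c0"
    using integral_rescale[of R "\<lambda>t. (bump t)\<^sup>2"] R by (simp add: c0_def)
  have c0: "c0 > 0" unfolding c0_def by (rule integral_bump_pos)
  have eps: "C * I powr \<gamma> \<le> (c1 / R + \<epsilon>) * m" if \<epsilon>: "\<epsilon> > 0" for \<epsilon>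
  proof -
    obtain \<psi> where \<psi>: "\<psi> \<in> sphere_test_functions \<Sigma>" "sphere_mass \<psi> = 1"
      "sphere_energy \<psi> < rayleigh \<Sigma> + \<epsilon> / (R * c0)"
      using rayleigh_approx[OF \<Sigma>, of "\<epsilon> / (R * c0)"] \<epsilon> R c0 by auto
    let ?u = "separated ?f \<psi>"
    define P where "P = (LINT \<theta>|surface_measure. \<bar>\<psi> (sgn \<theta>)\<bar> powr p)"
    have P0: "P \<ge> 0" by (simp add: P_def)
    note sep = smooth supp der \<psi>(1) sphere_domain_subset[OF \<Sigma>]
    have "?u \<in> test_functions (trunc_cone \<Sigma>)"
    proof (rule test_functions_mono[OF separated_test_function[OF smooth supp \<psi>(1) sphere_domain_subset[OF \<Sigma>]]])
      show "{x. x \<noteq> 0 \<and> sgn x \<in> \<Sigma> \<and> ln (norm x) \<in> {- 2 * R..- R}} \<subseteq> trunc_cone \<Sigma>"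
      proof
        fix x :: "real^'n" assume x: "x \<in> {x. x \<noteq> 0 \<and> sgn x \<in> \<Sigma> \<and> ln (norm x) \<in> {- 2 * R..- R}}"
        then have "ln (norm x) \<le> - R" by auto
        then have "ln (norm x) < 0" using R by linarith
        then have "exp (ln (norm x)) < exp 0" by (simp only: exp_less_cancel_iff)
        also have "exp (ln (norm x)) = norm x" using x by simp
        finally have "norm x < 1" by simp
        then show "x \<in> trunc_cone \<Sigma>" using x by (simp add: trunc_cone_eq)
      qed
    qed
    then have "rayleigh \<Sigma> * (R * c0) + C * (I * P) powr \<gamma> \<le> c1 / R + R * c0 * sphere_energy \<psi>"
      using hs[unfolded hardy_sobolev_emden[OF n], rule_format, of ?u]
        mass_separated[OF sep] dt_separated[OF sep] ang_separated[OF sep] power_separated[OF \<psi>(1) R]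
      by (simp add: f2 f'2 \<psi>(2) mu1_eq_rayleigh[OF \<Sigma>] p[symmetric] \<gamma>[symmetric] I_def P_def)
    moreover have "R * c0 * sphere_energy \<psi> \<le> R * c0 * (rayleigh \<Sigma> + \<epsilon> / (R * c0))"
      using \<psi>(3) R c0 by (intro mult_left_mono) auto
    moreover have "R * c0 * (rayleigh \<Sigma> + \<epsilon> / (R * c0)) = rayleigh \<Sigma> * (R * c0) + \<epsilon>"
      using R c0 by (simp add: distrib_left)
    ultimately have le: "C * (I * P) powr \<gamma> \<le> c1 / R + \<epsilon>" by linarith
    have "1 \<le> P powr \<gamma> * m"
      using sphere_Hoelder[OF \<Sigma> \<psi>(1,2) pg(3)] by (simp only: pg(1) pg(2)[unfolded pg(1)] P_def m_def)
    then have "C * I powr \<gamma> * 1 \<le> C * I powr \<gamma> * (P powr \<gamma> * m)"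
      using C by (intro mult_left_mono) auto
    also have "\<dots> = C * (I * P) powr \<gamma> * m"
      using I0 P0 by (simp add: powr_mult)
    also have "\<dots> \<le> (c1 / R + \<epsilon>) * m"
      using le by (intro mult_right_mono) (auto simp: m_def)
    finally show ?thesis by simp
  qed
  have m0: "m \<ge> 0" by (simp add: m_def)
  have "C * I powr \<gamma> \<le> c1 / R * m + e" if e: "e > 0" for e
  proof -
    have "C * I powr \<gamma> \<le> (c1 / R + e / (m + 1)) * m" using eps[of "e / (m + 1)"] e m0 by simp
    also have "\<dots> \<le> c1 / R * m + e" using e m0 by (simp add: field_simps)
    finally show ?thesis .
  qed
  then have "C * I powr \<gamma> \<le> c1 / R * m" by (rule field_le_epsilon)
  then show ?thesis by (simp add: I_def c1_def m_def)
qed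

end

lemma integrable_profile:
  assumes p: "p > 0" and R: "R \<ge> 1"
  shows "integrable lborel (\<lambda>t. (1 / (1 - t)) powr q * \<bar>bump (- (t / R))\<bar> powr p)"
proof -
  have bc: "continuous_on UNIV (\<lambda>t. \<bar>bump (- (t / R))\<bar> powr p)"
    using p R by (intro continuous_on_powr' continuous_intros
        continuous_on_compose2[OF smooth_on_continuous[OF smooth_on_bump], of UNIV "\<lambda>t. - (t / R)"]) auto
  have "continuous_on UNIV (\<lambda>t. log_weight t powr q * \<bar>bump (- (t / R))\<bar> powr p)"
    by (intro continuous_on_mult bc continuous_on_powr continuous_intros)
      (use log_weight_pos in \<open>auto simp: less_imp_neq[symmetric]\<close>)
  moreover have eq: "(1 / (1 - t)) powr q * \<bar>bump (- (t / R))\<bar> powr p = log_weight t powr q * \<bar>bump (- (t / R))\<bar> powr p" for t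
  proof (cases "t \<le> 0")
    case False
    then have "- (t / R) \<notin> {1..2}" using R by (auto simp: field_simps)
    from bump_support[OF this] show ?thesis by simp
  qed (simp add: log_weight_def min_def)
  moreover have "log_weight t powr q * \<bar>bump (- (t / R))\<bar> powr p = 0" if "t \<notin> {- 2 * R..- R}" for t
  proof -
    have "- (t / R) \<notin> {1..2}" using that R by (auto simp: field_simps)
    from bump_support[OF this] show ?thesis by simp
  qed
  ultimately have "integrable lborel (\<lambda>t. log_weight t powr q * \<bar>bump (- (t / R))\<bar> powr p)"
    by (intro integrable_continuous_compact_support[of _ "{- 2 * R..- R}"] compact_Icc)
  then show ?thesis by (simp only: eq)
qed

text \<open>On the support of the profile $1 - t$ lies between $R$ and $3 R$, so the weight is comparable to
  $R^{-q}$; the length of the support contributes the remaining factor $R$.\<close>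

lemma profile_lower_bound:
  assumes p: "p > 0"
  shows "\<exists>\<kappa>>0. \<forall>R\<ge>1. \<kappa> * R powr (1 - q) \<le> profile_integral p q R"
proof -
  define b where "b = (LINT t|lborel. \<bar>bump t\<bar> powr p)"
  have ib: "integrable lborel (\<lambda>t. \<bar>bump t\<bar> powr p)"
  proof (rule integrable_continuous_compact_support[of _ "{1..2}"])
    show "continuous_on UNIV (\<lambda>t. \<bar>bump t\<bar> powr p)"
      using p by (intro continuous_on_powr' continuous_intros smooth_on_continuous[OF smooth_on_bump]) auto
    fix t :: real assume "t \<notin> {1..2}"
    from bump_support[OF this] show "\<bar>bump t\<bar> powr p = 0" by simp
  qed simp
  have b: "b > 0"
  proof -
    have "b \<noteq> 0"
    proof
      assume "b = 0"
      then have "AE t in lborel. \<bar>bump t\<bar> powr p = 0"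
        using integral_nonneg_eq_0_iff_AE[OF ib] by (simp add: b_def)
      then have "AE t in lborel. (bump t)\<^sup>2 = 0" by eventually_elim simp
      then have "(LINT t|lborel. (bump t)\<^sup>2) = 0" by (rule integral_eq_zero_AE)
      then show False using integral_bump_pos by simp
    qed
    moreover have "b \<ge> 0" by (simp add: b_def)
    ultimately show ?thesis by linarith
  qed
  define \<kappa> where "\<kappa> = min 1 (3 powr (- q))"
  have \<kappa>: "\<kappa> > 0" by (simp add: \<kappa>_def)
  have "\<kappa> * b * R powr (1 - q) \<le> profile_integral p q R" if R: "R \<ge> 1" for R
  proof -
    have scaled: "integrable lborel (\<lambda>t. \<bar>bump (- (t / R))\<bar> powr p)"
      using lborel_integrable_real_affine[OF ib, of "- (1 / R)" 0] R by simp
    have "\<kappa> * b * R powr (1 - q) = \<kappa> * R powr (- q) * (R * b)"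
      using R powr_add[of R 1 "- q"] by simp
    also have "\<dots> = (LINT t|lborel. \<kappa> * R powr (- q) * \<bar>bump (- (t / R))\<bar> powr p)"
      using integral_rescale[of R "\<lambda>t. \<bar>bump t\<bar> powr p"] R by (simp add: b_def)
    also have "\<dots> \<le> profile_integral p q R"
      unfolding profile_integral_def
    proof (rule integral_mono[OF _ integrable_profile[OF p R]])
      show "integrable lborel (\<lambda>t. \<kappa> * R powr (- q) * \<bar>bump (- (t / R))\<bar> powr p)" using scaled by simp
      fix t :: real
      show "\<kappa> * R powr (- q) * \<bar>bump (- (t / R))\<bar> powr p \<le> (1 / (1 - t)) powr q * \<bar>bump (- (t / R))\<bar> powr p"
      proof (cases "- (t / R) \<in> {1..2}")
        case True
        then have t: "R \<le> - t" "- t \<le> 2 * R" using R by (auto simp: field_simps)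
        have "\<kappa> * R powr (- q) \<le> (1 - t) powr (- q)"
        proof (cases "q \<le> 0")
          case True
          have "\<kappa> * R powr (- q) \<le> 1 * R powr (- q)" by (intro mult_right_mono) (auto simp: \<kappa>_def)
          also have "\<dots> \<le> (1 - t) powr (- q)" using True t R by (auto intro: powr_mono2)
          finally show ?thesis .
        next
          case False
          have "\<kappa> * R powr (- q) \<le> 3 powr (- q) * R powr (- q)" by (intro mult_right_mono) (auto simp: \<kappa>_def)
          also have "\<dots> = (3 * R) powr (- q)" using R by (simp add: powr_mult)
          also have "\<dots> \<le> (1 - t) powr (- q)" using False t R by (intro powr_mono2') auto
          finally show ?thesis .
        qed
        also have "(1 - t) powr (- q) = (1 / (1 - t)) powr q"
          using t R by (simp add: powr_minus powr_divide inverse_eq_divide)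
        finally show ?thesis by (rule mult_right_mono) simp
      next
        case False
        from bump_support[OF this] show ?thesis by simp
      qed
    qed
    finally show ?thesis .
  qed
  then show ?thesis using \<kappa> b by (intro exI[of _ "\<kappa> * b"]) auto
qed

text \<open>By \<open>profile_bound\<close> and \<open>profile_lower_bound\<close>, $R^\delta$ with $\delta = 1 + (1 - q)(n-2)/n$ is bounded for
  $R \ge 1$; but $\delta > 0$ for $q$ below the critical exponent, where $\delta$ vanishes.\<close>

theorem weight_exponent_optimal:
  fixes \<Sigma> :: "(real^'n) set"
  assumes n: "CARD('n) \<ge> 3" and \<Sigma>: "sphere_domain \<Sigma>" and q: "q < weight_exponent TYPE('n)" and C: "C > 0"
  shows "\<not> hardy_sobolev \<Sigma> q C"
proof
  assume hs: "hardy_sobolev \<Sigma> q C"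
  define p where "p = 2 * real CARD('n) / (real CARD('n) - 2)"
  define \<gamma> where "\<gamma> = (real CARD('n) - 2) / real CARD('n)"
  define m where "m = (LINT t|lborel. (grad bump t)\<^sup>2) * measure surface_measure \<Sigma> powr (2 / real CARD('n))"
  define \<delta> where "\<delta> = 1 + (1 - q) * \<gamma>"
  have n3: "real CARD('n) \<ge> 3" using n by simp
  have p: "p > 0" and \<gamma>: "\<gamma> > 0" using n3 by (auto simp: p_def \<gamma>_def)
  have "q * \<gamma> < weight_exponent TYPE('n) * \<gamma>" using q \<gamma> by simp
  also have "weight_exponent TYPE('n) * \<gamma> = 1 + \<gamma>"
    using n3 by (simp add: weight_exponent_def \<gamma>_def field_simps)
  finally have \<delta>: "\<delta> > 0" by (simp add: \<delta>_def algebra_simps)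
  obtain \<kappa> where \<kappa>: "\<kappa> > 0" "\<And>R. R \<ge> 1 \<Longrightarrow> \<kappa> * R powr (1 - q) \<le> profile_integral p q R"
    using profile_lower_bound[OF p, of q] by blast
  have bound: "C * \<kappa> powr \<gamma> * R powr \<delta> \<le> m" if R: "R \<ge> 1" for R
  proof -
    have "C * (\<kappa> * R powr (1 - q)) powr \<gamma> \<le> C * profile_integral p q R powr \<gamma>"
      using \<kappa>(2)[OF R] \<kappa>(1) C \<gamma> by (intro mult_left_mono powr_mono2) auto
    also have "\<dots> \<le> m / R"
      using profile_bound[OF n \<Sigma> hs C p_def \<gamma>_def R] by (simp add: m_def)
    finally have "C * (\<kappa> * R powr (1 - q)) powr \<gamma> * R \<le> m" using R by (simp add: le_divide_eq)
    moreover have "(\<kappa> * R powr (1 - q)) powr \<gamma> * R = \<kappa> powr \<gamma> * R powr \<delta>"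
      using \<kappa>(1) R powr_add[of R 1 "(1 - q) * \<gamma>"] by (simp add: powr_mult powr_powr \<delta>_def)
    ultimately show ?thesis by (simp add: mult.assoc)
  qed
  define R where "R = max 1 (((m + 1) / (C * \<kappa> powr \<gamma>)) powr (1 / \<delta>))"
  have Ck: "C * \<kappa> powr \<gamma> > 0" using C \<kappa>(1) by simp
  have m0: "m \<ge> 0" by (simp add: m_def)
  have "(m + 1) / (C * \<kappa> powr \<gamma>) = (((m + 1) / (C * \<kappa> powr \<gamma>)) powr (1 / \<delta>)) powr \<delta>"
    using m0 Ck \<delta> by (simp add: powr_powr)
  also have "\<dots> \<le> R powr \<delta>" using \<delta> by (intro powr_mono2) (auto simp: R_def)
  finally have "m + 1 \<le> C * \<kappa> powr \<gamma> * R powr \<delta>" using Ck by (simp add: divide_le_eq mult.commute)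
  then show False using bound[of R] by (simp add: R_def)
qed

text \<open>This is \<open>profile_bound\<close> for $R = 1$, where the radial factors are constants that depend on $n$ only.\<close>

theorem best_constant_le:
  assumes n: "CARD('n::finite) \<ge> 3"
  shows "\<exists>Cn>0. \<forall>\<Sigma> :: (real^'n) set. sphere_domain \<Sigma> \<longrightarrow>
    best_constant \<Sigma> \<le> ereal (Cn * measure surface_measure \<Sigma> powr (2 / real CARD('n)))"
proof -
  define p where "p = 2 * real CARD('n) / (real CARD('n) - 2)"
  define \<gamma> where "\<gamma> = (real CARD('n) - 2) / real CARD('n)"
  define q where "q = weight_exponent TYPE('n)"
  have p: "p > 0" using n by (simp add: p_def)
  obtain \<kappa> where \<kappa>: "\<kappa> > 0" "\<And>R. R \<ge> 1 \<Longrightarrow> \<kappa> * R powr (1 - q) \<le> profile_integral p q R"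
    using profile_lower_bound[OF p, of q] by blast
  define I where "I = profile_integral p q 1 powr \<gamma>"
  have I: "I > 0" using \<kappa>(2)[of 1] \<kappa>(1) by (simp add: I_def)
  \<comment> \<open>The summand 1 makes positivity evident.\<close>
  define Cn where "Cn = (LINT t|lborel. (grad bump t)\<^sup>2) / I + 1"
  have Cn: "Cn > 0" using I by (auto simp: Cn_def intro!: add_nonneg_pos divide_nonneg_pos)
  have "best_constant \<Sigma> \<le> ereal (Cn * measure surface_measure \<Sigma> powr (2 / real CARD('n)))"
    if \<Sigma>: "sphere_domain \<Sigma>" for \<Sigma> :: "(real^'n) set"
    unfolding best_constant_def
  proof (rule SUP_least)
    fix C assume "C \<in> {C. C > 0 \<and> hardy_sobolev \<Sigma> (weight_exponent TYPE('n)) C}"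
    then have C: "C > 0" "hardy_sobolev \<Sigma> q C" by (auto simp: q_def)
    have "C * I \<le> (LINT t|lborel. (grad bump t)\<^sup>2) * measure surface_measure \<Sigma> powr (2 / real CARD('n))"
      using profile_bound[OF n \<Sigma> C(2,1) p_def \<gamma>_def, of 1] by (simp add: I_def)
    then have "C \<le> (LINT t|lborel. (grad bump t)\<^sup>2) / I * measure surface_measure \<Sigma> powr (2 / real CARD('n))"
      using I by (simp add: le_divide_eq)
    also have "\<dots> \<le> Cn * measure surface_measure \<Sigma> powr (2 / real CARD('n))"
      by (intro mult_right_mono) (auto simp: Cn_def)
    finally show "ereal C \<le> ereal (Cn * measure surface_measure \<Sigma> powr (2 / real CARD('n)))" by simp
  qed
  then show ?thesis using Cn by blast
qed

section \<open>Thin lunes\<close>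

text \<open>A lune is bounded by two great spheres. The chart $y \mapsto \mathrm{sgn}(p + y)$ of the boundary
  condition is a central projection, under which the two conditions become affine inequalities in $y$;
  so near a face the boundary is flat, and near the edge it is the graph of the minimum of two linear
  functions.\<close>

definition lune :: "'a::euclidean_space \<Rightarrow> 'a \<Rightarrow> 'a set" where
  "lune a c = {x \<in> sphere 0 1. x \<bullet> a > 0 \<and> x \<bullet> c > 0}"

lemma sphere_domain_lune:
  fixes a c d :: "real^'n"
  assumes d: "d \<bullet> a > 0" "d \<bullet> c > 0"
  shows "sphere_domain (lune a c)"
  unfolding sphere_domain_def
proof (intro conjI)
  let ?D = "{x. x \<bullet> a > 0} \<inter> {x. x \<bullet> c > 0}"
  have "open ?D" by (intro open_Int open_Collect_less continuous_intros)
  moreover have "lune a c = sphere 0 1 \<inter> ?D" by (auto simp: lune_def)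
  ultimately show "openin (top_of_set (sphere 0 1)) (lune a c)" unfolding openin_open by blast
  have pos: "sgn x \<in> lune a c" if "x \<in> ?D" for x
  proof -
    have "x \<noteq> 0" using that by auto
    moreover have "sgn x \<bullet> v = (x \<bullet> v) / norm x" for v by (simp add: sgn_div_norm divide_inverse_commute)
    ultimately show ?thesis using that by (simp add: lune_def norm_sgn)
  qed
  have "convex ?D"
    using convex_halfspace_gt[of 0 a] convex_halfspace_gt[of 0 c]
    by (intro convex_Int) (simp_all add: inner_commute)
  then have "connected ?D" by (rule convex_connected)
  moreover have "continuous_on ?D sgn"
    unfolding sgn_div_norm[abs_def] by (intro continuous_intros) auto
  ultimately have "connected (sgn ` ?D)" by (rule connected_continuous_image[rotated])
  moreover have "sgn ` ?D = lune a c"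
  proof
    show "sgn ` ?D \<subseteq> lune a c" using pos by blast
    show "lune a c \<subseteq> sgn ` ?D"
    proof
      fix x assume "x \<in> lune a c"
      then have "x = sgn x" "x \<in> ?D" by (auto simp: lune_def sgn_unit)
      then show "x \<in> sgn ` ?D" by blast
    qed
  qed
  ultimately show "connected (lune a c)" by simp
  show "lune a c \<noteq> {}" using pos[of d] d by auto
qed

lemma sgn_mem_lune:
  assumes "x \<noteq> 0"
  shows "sgn x \<in> lune a c \<longleftrightarrow> x \<bullet> a > 0 \<and> x \<bullet> c > 0"
  using assms by (auto simp: lune_def sgn_div_norm zero_less_mult_iff)

text \<open>The second inequality is inactive in a small ball, and $a$ is normal to the boundary.\<close>

lemma lune_face_chart:
  fixes a c p :: "real^'n"
  assumes p: "norm p = 1" "p \<bullet> a = 0" "p \<bullet> c > 0" and a: "a \<noteq> 0"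
  shows "\<exists>e (g :: real^'n \<Rightarrow> real) L r. norm e = 1 \<and> e \<bullet> p = 0 \<and> r > 0 \<and>
    L-lipschitz_on {z. z \<bullet> p = 0 \<and> z \<bullet> e = 0} g \<and>
    (\<forall>y. y \<bullet> p = 0 \<and> norm y < r \<longrightarrow>
      ((p + y) \<bullet> a > 0 \<and> (p + y) \<bullet> c > 0 \<longleftrightarrow> y \<bullet> e < g (y - (y \<bullet> e) *\<^sub>R e)))"
proof (rule exI[of _ "- sgn a"], rule exI[of _ "\<lambda>_. 0"], rule exI[of _ 0],
    rule exI[of _ "(p \<bullet> c) / (norm c + 1)"], intro conjI allI impI)
  show "norm (- sgn a) = 1" using a by (simp add: norm_sgn)
  show "- sgn a \<bullet> p = 0" using p by (simp add: sgn_div_norm inner_commute)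
  show "p \<bullet> c / (norm c + 1) > 0" using p by (simp add: add_nonneg_pos)
  show "0-lipschitz_on {z. z \<bullet> p = 0 \<and> z \<bullet> - sgn a = 0} (\<lambda>_. 0::real)" by (simp add: lipschitz_on_def)
  fix y assume y: "y \<bullet> p = 0 \<and> norm y < p \<bullet> c / (norm c + 1)"
  have "\<bar>y \<bullet> c\<bar> \<le> norm y * norm c" by (rule Cauchy_Schwarz_ineq2)
  also have "\<dots> \<le> norm y * (norm c + 1)" by (intro mult_left_mono) auto
  also have "\<dots> < p \<bullet> c" using y by (simp add: less_divide_eq add_nonneg_pos)
  finally have "(p + y) \<bullet> c > 0" by (simp add: inner_add_left)
  moreover have "(p + y) \<bullet> a > 0 \<longleftrightarrow> y \<bullet> - sgn a < 0"
    using a p by (simp add: inner_add_left sgn_div_norm zero_less_mult_iff)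
  ultimately show "((p + y) \<bullet> a > 0 \<and> (p + y) \<bullet> c > 0) = (y \<bullet> - sgn a < 0)" by simp
qed

text \<open>Both linear forms increase in the direction $d$, hence each of the inequalities bounds the coordinate
  along $-d$ from above by a linear function of the remaining variables.\<close>

lemma lune_edge_chart:
  fixes a c d p :: "real^'n"
  assumes p: "norm p = 1" "p \<bullet> a = 0" "p \<bullet> c = 0" and d: "d \<bullet> a > 0" "d \<bullet> c > 0" "d \<bullet> p = 0"
  shows "\<exists>e (g :: real^'n \<Rightarrow> real) L r. norm e = 1 \<and> e \<bullet> p = 0 \<and> r > 0 \<and>
    L-lipschitz_on {z. z \<bullet> p = 0 \<and> z \<bullet> e = 0} g \<and>
    (\<forall>y. y \<bullet> p = 0 \<and> norm y < r \<longrightarrow>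
      ((p + y) \<bullet> a > 0 \<and> (p + y) \<bullet> c > 0 \<longleftrightarrow> y \<bullet> e < g (y - (y \<bullet> e) *\<^sub>R e)))"
proof -
  define e where "e = - sgn d"
  define k1 k2 where "k1 = - (e \<bullet> a)" and "k2 = - (e \<bullet> c)"
  have d0: "d \<noteq> 0" using d by auto
  have k: "k1 > 0" "k2 > 0" using d d0 by (auto simp: k1_def k2_def e_def sgn_div_norm)
  define g where "g z = min ((z \<bullet> a) / k1) ((z \<bullet> c) / k2)" for z
  have lip: "\<bar>(z \<bullet> b) / k' - (z' \<bullet> b) / k'\<bar> \<le> norm b / k' * dist z z'" if "k' > 0" for z z' b :: "real^'n" and k'
  proof -
    have "\<bar>(z \<bullet> b) / k' - (z' \<bullet> b) / k'\<bar> = \<bar>(z - z') \<bullet> b\<bar> / k'"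
      using that by (simp add: inner_diff_left diff_divide_distrib[symmetric] abs_divide)
    also have "\<dots> \<le> (norm (z - z') * norm b) / k'"
      using that by (intro divide_right_mono Cauchy_Schwarz_ineq2) auto
    finally show ?thesis by (simp add: dist_norm mult.commute)
  qed
  have "(norm a / k1 + norm c / k2)-lipschitz_on {z. z \<bullet> p = 0 \<and> z \<bullet> e = 0} g"
  proof (rule lipschitz_onI)
    fix z z' :: "real^'n"
    have "\<bar>min x y - min x' y'\<bar> \<le> \<bar>x - x'\<bar> + \<bar>y - y'\<bar>" for x y x' y' :: real by linarith
    then have "dist (g z) (g z') \<le> \<bar>(z \<bullet> a) / k1 - (z' \<bullet> a) / k1\<bar> + \<bar>(z \<bullet> c) / k2 - (z' \<bullet> c) / k2\<bar>"
      by (simp add: g_def dist_real_def)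
    also have "\<dots> \<le> norm a / k1 * dist z z' + norm c / k2 * dist z z'"
      using k by (intro add_mono lip) auto
    finally show "dist (g z) (g z') \<le> (norm a / k1 + norm c / k2) * dist z z'" by (simp add: distrib_right)
  qed (use k in \<open>simp add: less_imp_le\<close>)
  moreover have "((p + y) \<bullet> a > 0 \<and> (p + y) \<bullet> c > 0) = (y \<bullet> e < g (y - (y \<bullet> e) *\<^sub>R e))" for y
  proof -
    have "(p + y) \<bullet> a = (y - (y \<bullet> e) *\<^sub>R e) \<bullet> a - k1 * (y \<bullet> e)" "(p + y) \<bullet> c = (y - (y \<bullet> e) *\<^sub>R e) \<bullet> c - k2 * (y \<bullet> e)"
      using p by (simp_all add: inner_add_left inner_diff_left k1_def k2_def)
    then show ?thesis using k by (auto simp: g_def less_divide_eq mult.commute)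
  qed
  moreover have "norm e = 1" "e \<bullet> p = 0" using d d0 by (auto simp: e_def norm_sgn sgn_div_norm)
  ultimately show ?thesis
    by - (rule exI[of _ e], rule exI[of _ g], rule exI[of _ "norm a / k1 + norm c / k2"], rule exI[of _ 1], simp)
qed

text \<open>The direction $d$ is taken from the plane spanned by $a$ and $c$, so that it is tangential at every
  point of the edge.\<close>

lemma lipschitz_boundary_lune:
  fixes a c :: "real^'n"
  assumes d: "d \<in> span {a, c}" "d \<bullet> a > 0" "d \<bullet> c > 0"
  shows "lipschitz_boundary (lune a c)"
  unfolding lipschitz_boundary_def
proof
  fix p assume p: "p \<in> top_of_set (sphere 0 1) frontier_of lune a c"
  have op: "openin (top_of_set (sphere 0 1)) (lune a c)"
    using sphere_domain_lune[OF d(2,3)] by (simp add: sphere_domain_def)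
  have "p \<in> sphere 0 1" using p frontier_of_subset_topspace[of "top_of_set (sphere 0 1)" "lune a c"] by auto
  then have np: "norm p = 1" by simp
  have "p \<notin> lune a c" using p op by (simp add: frontier_of_def interior_of_openin)
  then have out: "\<not> (p \<bullet> a > 0 \<and> p \<bullet> c > 0)" using np by (simp add: lune_def)
  have "p \<in> top_of_set (sphere 0 1) closure_of lune a c" using p by (simp add: frontier_of_def)
  moreover have "sphere 0 1 \<inter> lune a c = lune a c" by (auto simp: lune_def)
  ultimately have "p \<in> closure (lune a c)" by (simp add: closure_of_subtopology)
  moreover have "closed ({x. x \<bullet> a \<ge> 0} \<inter> {x. x \<bullet> c \<ge> 0})"
    by (intro closed_Int closed_Collect_le continuous_intros)
  moreover have "lune a c \<subseteq> {x. x \<bullet> a \<ge> 0} \<inter> {x. x \<bullet> c \<ge> 0}" by (auto simp: lune_def)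
  ultimately have ge: "p \<bullet> a \<ge> 0" "p \<bullet> c \<ge> 0" using closure_minimal by blast+
  have nz: "a \<noteq> 0" "c \<noteq> 0" using d by auto
  have "\<exists>e (g :: real^'n \<Rightarrow> real) L r. norm e = 1 \<and> e \<bullet> p = 0 \<and> r > 0 \<and>
    L-lipschitz_on {z. z \<bullet> p = 0 \<and> z \<bullet> e = 0} g \<and>
    (\<forall>y. y \<bullet> p = 0 \<and> norm y < r \<longrightarrow>
      ((p + y) \<bullet> a > 0 \<and> (p + y) \<bullet> c > 0 \<longleftrightarrow> y \<bullet> e < g (y - (y \<bullet> e) *\<^sub>R e)))"
  proof -
    consider "p \<bullet> a = 0" "p \<bullet> c > 0" | "p \<bullet> c = 0" "p \<bullet> a > 0" | "p \<bullet> a = 0" "p \<bullet> c = 0"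
      using out ge by linarith
    then show ?thesis
    proof cases
      case 1
      then show ?thesis by (rule lune_face_chart[OF np _ _ nz(1)])
    next
      case 2
      from lune_face_chart[OF np this nz(2)] show ?thesis by (simp only: conj_commute)
    next
      case 3
      obtain s t where "d = s *\<^sub>R a + t *\<^sub>R c"
        using d(1) by (auto simp: span_insert span_singleton algebra_simps)
      then have "d \<bullet> p = 0" using 3 by (simp add: inner_add_left inner_add_right inner_commute)
      then show ?thesis by (rule lune_edge_chart[OF np 3 d(2,3)])
    qed
  qed
  moreover have "p + y \<noteq> 0" if "y \<bullet> p = 0" for y
  proof
    assume "p + y = 0"
    then have "(p + y) \<bullet> p = 0" by simp
    then have "p \<bullet> p = 0" using that by (simp add: inner_add_left)
    then show False using np by simp
  qed
  ultimately show "\<exists>e g L r. norm e = 1 \<and> e \<bullet> p = 0 \<and> r > 0 \<and>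
      L-lipschitz_on {z. z \<bullet> p = 0 \<and> z \<bullet> e = 0} (g :: real^'n \<Rightarrow> real) \<and>
      (\<forall>y. y \<bullet> p = 0 \<and> norm y < r \<longrightarrow>
         (sgn (p + y) \<in> lune a c \<longleftrightarrow> y \<bullet> e < g (y - (y \<bullet> e) *\<^sub>R e)))"
    by (simp add: sgn_mem_lune cong: conj_cong)
qed

text \<open>Lunes whose angle shrinks to zero while one of the bounding great spheres is fixed decrease to the empty set.\<close>

lemma thin_lunes:
  assumes n: "CARD('n::finite) \<ge> 3"
  shows "\<exists>\<Sigma> :: nat \<Rightarrow> (real^'n) set. (\<forall>k. sphere_domain (\<Sigma> k) \<and> lipschitz_boundary (\<Sigma> k)) \<and>
    (\<lambda>k. measure surface_measure (\<Sigma> k)) \<longlonglongrightarrow> 0"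
proof -
  obtain i j :: 'n where ij: "i \<noteq> j"
    using n card_2_iff'[of "UNIV :: 'n set"] card_le_Suc0_iff_eq[of "UNIV :: 'n set"] by auto
  define a b where "a = (axis i 1 :: real^'n)" and "b = (axis j 1 :: real^'n)"
  have ab: "a \<bullet> a = 1" "b \<bullet> b = 1" "a \<bullet> b = 0" "b \<bullet> a = 0"
    using ij by (auto simp: a_def b_def inner_axis_axis)
  define \<epsilon> where "\<epsilon> k = 1 / real (Suc k)" for k
  define c where "c k = \<epsilon> k *\<^sub>R b - a" for k
  define d where "d k = (\<epsilon> k / 2) *\<^sub>R a + b" for k
  define \<Sigma> where "\<Sigma> k = lune a (c k)" for k
  have \<epsilon>: "\<epsilon> k > 0" for k by (simp add: \<epsilon>_def)
  have d: "d k \<bullet> a > 0" "d k \<bullet> c k > 0" for k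
    using \<epsilon>[of k] ab by (auto simp: d_def c_def inner_add_left inner_diff_right)
  have "d k \<in> span {a, c k}" for k
  proof -
    have "d k = (\<epsilon> k / 2 + 1 / \<epsilon> k) *\<^sub>R a + (1 / \<epsilon> k) *\<^sub>R c k"
      using \<epsilon>[of k] by (simp add: d_def c_def algebra_simps)
    moreover have "(\<epsilon> k / 2 + 1 / \<epsilon> k) *\<^sub>R a + (1 / \<epsilon> k) *\<^sub>R c k \<in> span {a, c k}"
      by (intro span_add span_scale span_base) auto
    ultimately show ?thesis by (simp only:)
  qed
  then have dom: "sphere_domain (\<Sigma> k)" "lipschitz_boundary (\<Sigma> k)" for k
    unfolding \<Sigma>_def using d by (auto intro: sphere_domain_lune lipschitz_boundary_lune)
  have mem: "x \<in> \<Sigma> k \<longleftrightarrow> norm x = 1 \<and> x \<bullet> a > 0 \<and> (x \<bullet> a) * real (Suc k) < x \<bullet> b" for x k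
    by (auto simp: \<Sigma>_def lune_def c_def \<epsilon>_def inner_diff_right field_simps)
  have "decseq \<Sigma>"
  proof (rule decseq_SucI, rule subsetI)
    fix k x assume "x \<in> \<Sigma> (Suc k)"
    then have x: "norm x = 1" "x \<bullet> a > 0" "(x \<bullet> a) * real (Suc (Suc k)) < x \<bullet> b" by (auto simp: mem)
    have "(x \<bullet> a) * real (Suc k) \<le> (x \<bullet> a) * real (Suc (Suc k))" using x by (intro mult_left_mono) auto
    also have "\<dots> < x \<bullet> b" by (rule x(3))
    finally show "x \<in> \<Sigma> k" using x(1,2) unfolding mem by blast
  qed
  moreover have "range \<Sigma> \<subseteq> sets surface_measure" using dom sphere_domain_borel by auto
  ultimately have "(\<lambda>k. measure surface_measure (\<Sigma> k)) \<longlonglongrightarrow> measure surface_measure (\<Inter>k. \<Sigma> k)"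
    by (intro surface.finite_Lim_measure_decseq)
  moreover have "(\<Inter>k. \<Sigma> k) = {}"
  proof (rule ccontr)
    assume "(\<Inter>k. \<Sigma> k) \<noteq> {}"
    then obtain x where x: "\<And>k. x \<in> \<Sigma> k" by blast
    obtain k :: nat where "(x \<bullet> b) / (x \<bullet> a) < real k" using reals_Archimedean2 by blast
    then show False using x[of k] by (auto simp: mem field_simps)
  qed
  ultimately have "(\<lambda>k. measure surface_measure (\<Sigma> k)) \<longlonglongrightarrow> 0" by simp
  then show ?thesis using dom by blast
qed

theorem theorem5:
  assumes "CARD('n::finite) \<ge> 3"
  shows
    "(\<forall>\<Sigma> :: (real^'n) set. sphere_domain \<Sigma> \<and> lipschitz_boundary \<Sigma> \<longrightarrow>
        (\<exists>C>0. hardy_sobolev \<Sigma> (weight_exponent TYPE('n)) C) \<and>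
        (\<forall>q < weight_exponent TYPE('n). \<forall>C>0. \<not> hardy_sobolev \<Sigma> q C)) \<and>
     (\<exists>Cn>0. \<forall>\<Sigma> :: (real^'n) set. sphere_domain \<Sigma> \<and> lipschitz_boundary \<Sigma> \<longrightarrow>
        best_constant \<Sigma> \<le> ereal (Cn * measure surface_measure \<Sigma> powr (2 / real CARD('n)))) \<and>
     \<not> (\<exists>C>0. \<forall>\<Sigma> :: (real^'n) set. sphere_domain \<Sigma> \<and> lipschitz_boundary \<Sigma> \<longrightarrow>
        hardy_sobolev \<Sigma> (weight_exponent TYPE('n)) C)"
proof (intro conjI allI impI)
  fix \<Sigma> :: "(real^'n) set" assume "sphere_domain \<Sigma> \<and> lipschitz_boundary \<Sigma>"
  then show "\<exists>C>0. hardy_sobolev \<Sigma> (weight_exponent TYPE('n)) C"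
    using hardy_sobolev_inequality[OF assms] by blast
next
  fix \<Sigma> :: "(real^'n) set" and q C :: real
  assume "sphere_domain \<Sigma> \<and> lipschitz_boundary \<Sigma>" "q < weight_exponent TYPE('n)" "C > 0"
  then show "\<not> hardy_sobolev \<Sigma> q C"
    using weight_exponent_optimal[OF assms] by blast
next
  obtain Cn where Cn: "Cn > 0" "\<And>\<Sigma> :: (real^'n) set. sphere_domain \<Sigma> \<Longrightarrow>
      best_constant \<Sigma> \<le> ereal (Cn * measure surface_measure \<Sigma> powr (2 / real CARD('n)))"
    using best_constant_le[OF assms] by blast
  then show "\<exists>Cn>0. \<forall>\<Sigma> :: (real^'n) set. sphere_domain \<Sigma> \<and> lipschitz_boundary \<Sigma> \<longrightarrow>
        best_constant \<Sigma> \<le> ereal (Cn * measure surface_measure \<Sigma> powr (2 / real CARD('n)))"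
    by blast
  show "\<not> (\<exists>C>0. \<forall>\<Sigma> :: (real^'n) set. sphere_domain \<Sigma> \<and> lipschitz_boundary \<Sigma> \<longrightarrow>
        hardy_sobolev \<Sigma> (weight_exponent TYPE('n)) C)"
  proof
    assume "\<exists>C>0. \<forall>\<Sigma> :: (real^'n) set. sphere_domain \<Sigma> \<and> lipschitz_boundary \<Sigma> \<longrightarrow>
        hardy_sobolev \<Sigma> (weight_exponent TYPE('n)) C"
    then obtain C where C: "C > 0" "\<And>\<Sigma> :: (real^'n) set. sphere_domain \<Sigma> \<Longrightarrow> lipschitz_boundary \<Sigma> \<Longrightarrow>
        hardy_sobolev \<Sigma> (weight_exponent TYPE('n)) C" by blast
    obtain \<Sigma> :: "nat \<Rightarrow> (real^'n) set" where \<Sigma>: "\<And>k. sphere_domain (\<Sigma> k)" "\<And>k. lipschitz_boundary (\<Sigma> k)"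
      "(\<lambda>k. measure surface_measure (\<Sigma> k)) \<longlonglongrightarrow> 0"
      using thin_lunes[OF assms] by blast
    have le: "C \<le> Cn * measure surface_measure (\<Sigma> k) powr (2 / real CARD('n))" for k
    proof -
      have "ereal C \<le> best_constant (\<Sigma> k)"
        unfolding best_constant_def using C(1) C(2)[OF \<Sigma>(1,2)] by (intro SUP_upper) auto
      also have "\<dots> \<le> ereal (Cn * measure surface_measure (\<Sigma> k) powr (2 / real CARD('n)))"
        by (rule Cn(2)[OF \<Sigma>(1)])
      finally show ?thesis by simp
    qed
    have "(\<lambda>k. Cn * measure surface_measure (\<Sigma> k) powr (2 / real CARD('n))) \<longlonglongrightarrow> Cn * 0 powr (2 / real CARD('n))"
      using \<Sigma>(3) by (intro tendsto_mult tendsto_const tendsto_powr') auto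
    then have "C \<le> Cn * 0 powr (2 / real CARD('n))"
      by (rule LIMSEQ_le_const) (use le in blast)
    then show False using C(1) by simp
  qed
qed

end
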